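(* Let $n=n_0+n_1+n_2$, let $B$ be a matrix such that $BT$ is invertible, let $A_0,A_1,A_2$ be matrix-valued functions on $[a,b]$ of sizes $n\times n$, $n\times(n_1+n_2)$ and $n\times n_2$ respectively, and let $X,T,G_0,\dots,G_5$ be as in the context. Define $\mathcal{T}:=\mathcal{P}_{\{G_0,G_1,G_2\}}$ and $\mathcal{A}:=\mathcal{P}_{\{H_0,H_1,H_2\}}$ with $$H_0(s)=A_0(s)G_0(s)+A_1(s)G_3(s)+A_{20}(s),\qquad A_{20}(s)=\begin{bmatrix} 0&0&A_2(s)\end{bmatrix},$$ $$H_1(s,\theta)=A_0(s)G_1(s,\theta)+A_1(s)G_4(s,\theta),\qquad H_2(s,\theta)=A_0(s)G_2(s,\theta)+A_1(s)G_5(s,\theta).$$ Given $\hat{\mathbf{x}}_0\in L_2^{n}$, the function $\hat{\mathbf{x}}(t)\in L_2^{n}$ satisfies the PIE defined by $\{\mathcal{T},\mathcal{A}\}$ (with initial condition $\hat{\mathbf{x}}_0$) if and only if, for $\mathbf{x}_0=\mathcal{T}\hat{\mathbf{x}}_0$, the function $\mathbf{x}(t)=\mathcal{T}\hat{\mathbf{x}}(t)$ satisfies the PDE defined by $\{A_i,X\}$ (with initial condition $\mathbf{x}_0$).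
   Context: $L_2^m=L_2([a,b];\mathbb{R}^m)$ with its standard inner product; $H_k^m$ is the Sobolev space of $\mathbb{R}^m$-valued functions on $[a,b]$ whose derivatives up to order $k$ are in $L_2$. A subscript $s$ denotes $\partial_s$. 3-PI operators: for bounded matrix-valued functions $N_0:[a,b]\to\mathbb{R}^{n\times n}$ and $N_1,N_2:[a,b]^2\to\mathbb{R}^{n\times n}$, $$(\mathcal{P}_{\{N_0,N_1,N_2\}}\mathbf{x})(s)=N_0(s)\mathbf{x}(s)+\int_a^s N_1(s,\theta)\mathbf{x}(\theta)\,d\theta+\int_s^b N_2(s,\theta)\mathbf{x}(\theta)\,d\theta .$$ The matrix $T\in\mathbb{R}^{(2n_1+4n_2)\times(n_1+2n_2)}$ is $$T=\begin{bmatrix} I_{n_1}&0&0\\ I_{n_1}&0&0\\ 0&I_{n_2}&0\\ 0&I_{n_2}&(b-a)I_{n_2}\\ 0&0&I_{n_2}\\ 0&0&I_{n_2}\end{bmatrix}.$$ Invertibility of $BT$ means in particular $B\in\mathbb{R}^{(n_1+2n_2)\times(2n_1+4n_2)}$. The space $X$ is the set of $\mathbf{x}=(x_0,x_1,x_2)\in L_2^{n_0}\times H_1^{n_1}\times H_2^{n_2}$ such that $$B\begin{bmatrix} x_1(a)\\ x_1(b)\\ x_2(a)\\ x_2(b)\\ x_{2s}(a)\\ x_{2s}(b)\end{bmatrix}=0.$$ Define (columns of $Q$ and of $G_0,\dots,G_5$ partitioned as $n_0,n_1,n_2$; rows of $K,G_0,G_1,G_2$ partitioned as $n_0,n_1,n_2$;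 columns of $K$ and $V$ partitioned as $n_1,n_2,n_2$; rows of $V,G_3,G_4,G_5$ partitioned as $n_1,n_2$) $$Q(s,\theta)=\begin{bmatrix} 0&0&0\\ 0&I_{n_1}&0\\ 0&0&0\\ 0&0&(b-\theta)I_{n_2}\\ 0&0&0\\ 0&0&I_{n_2}\end{bmatrix},\quad K(s)=\begin{bmatrix} 0&0&0\\ I_{n_1}&0&0\\ 0&I_{n_2}&(s-a)I_{n_2}\end{bmatrix},\quad V=\begin{bmatrix} 0&0&0\\ 0&0&I_{n_2}\end{bmatrix},$$ $$G_0(s)=\begin{bmatrix} I_{n_0}&0&0\\ 0&0&0\\ 0&0&0\end{bmatrix},\quad G_2(s,\theta)=-K(s)(BT)^{-1}BQ(s,\theta),\quad G_1(s,\theta)=\begin{bmatrix} 0&0&0\\ 0&I_{n_1}&0\\ 0&0&(s-\theta)I_{n_2}\end{bmatrix}+G_2(s,\theta),$$ $$G_3(s)=\begin{bmatrix} 0&I_{n_1}&0\\ 0&0&0\end{bmatrix},\quad G_5(s,\theta)=-V(BT)^{-1}BQ(s,\theta),\quad G_4(s,\theta)=\begin{bmatrix} 0&0&0\\ 0&0&I_{n_2}\end{bmatrix}+G_5(s,\theta).$$ PDE solution: given $\mathbf{x}_0\in X$, $\mathbf{x}$ satisfies the PDE defined by $\{A_i,X\}$ if $\mathbf{x}$ is Fréchet differentiable, $\mathbf{x}(0)=\mathbf{x}_0$, $\mathbf{x}(t)=(x_0(t),x_1(t),x_2(t))\in X$, and for all $t\ge0$ $$\dot{\mathbf{x}}(t,s)=A_0(s)\mathbf{x}(t,s)+A_1(s)\begin{bmatrix}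 \partial_sx_1(t,s)\\ \partial_sx_2(t,s)\end{bmatrix}+A_2(s)\,\partial_s^2x_2(t,s).$$ PIE solution: given $\hat{\mathbf{x}}_0\in L_2^n$, $\hat{\mathbf{x}}:\mathbb{R}^+\to L_2^n$ satisfies the PIE defined by $\{\mathcal{T},\mathcal{A}\}$ if $\hat{\mathbf{x}}(0)=\hat{\mathbf{x}}_0$, $\hat{\mathbf{x}}$ is Fréchet differentiable for all $t\ge0$, and $\mathcal{T}\dot{\hat{\mathbf{x}}}(t)=\mathcal{A}\hat{\mathbf{x}}(t)$ for all $t\ge0$. *)

theory Defs
  imports "HOL-Analysis.Analysis" "Jordan_Normal_Form.Gauss_Jordan_Elimination"
begin

(* Vectors and matrices are those of Jordan_Normal_Form, whose dimensions are natural numbers: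
   each of n0, n1, n2 may be zero. *)
hide_type (open) Finite_Cartesian_Product.vec
hide_const (open) Finite_Cartesian_Product.vec Determinants.det Finite_Cartesian_Product.mat
  Finite_Cartesian_Product.row Finite_Cartesian_Product.vec_nth
unbundle no vec_syntax
unbundle no inner_syntax

section \<open>Function spaces on an interval\<close>

text \<open>Elements of function spaces are represented by functions, and two functions that agree almost
  everywhere on \<open>[a,b]\<close> represent the same element. All notions below respect this identification.\<close>

definition ae_eq :: "real \<Rightarrow> real \<Rightarrow> (real \<Rightarrow> 'c) \<Rightarrow> (real \<Rightarrow> 'c) \<Rightarrow> bool" where
  "ae_eq a b f g \<longleftrightarrow> (AE s in lebesgue_on {a..b}. f s = g s)"

definition L2 :: "real \<Rightarrow> real \<Rightarrow> (real \<Rightarrow> real) set" where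
  "L2 a b = {f \<in> borel_measurable (lebesgue_on {a..b}).
               integrable (lebesgue_on {a..b}) (\<lambda>s. (f s)\<^sup>2)}"

text \<open>Test functions: continuously differentiable with compact support in the open interval
  \<open>(a,b)\<close>. In one dimension they give the same weak derivatives as smooth test functions.\<close>

definition test_functions :: "real \<Rightarrow> real \<Rightarrow> (real \<Rightarrow> real) set" where
  "test_functions a b =
     {\<phi>. (\<forall>s. \<phi> differentiable (at s)) \<and> continuous_on UNIV (deriv \<phi>) \<and>
         (\<exists>c d. a < c \<and> c < d \<and> d < b \<and> (\<forall>s. s \<notin> {c..d} \<longrightarrow> \<phi> s = 0))}"

definition is_weak_deriv :: "real \<Rightarrow> real \<Rightarrow> (real \<Rightarrow> real) \<Rightarrow> (real \<Rightarrow> real) \<Rightarrow> bool" where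
  "is_weak_deriv a b f g \<longleftrightarrow>
     (\<forall>\<phi> \<in> test_functions a b.
        (LINT s|lebesgue_on {a..b}. f s * deriv \<phi> s) = - (LINT s|lebesgue_on {a..b}. g s * \<phi> s))"

primrec sobolev :: "real \<Rightarrow> real \<Rightarrow> nat \<Rightarrow> (real \<Rightarrow> real) set" where
  "sobolev a b 0 = L2 a b"
| "sobolev a b (Suc k) = {f \<in> L2 a b. \<exists>g \<in> sobolev a b k. is_weak_deriv a b f g}"

(* Determined up to a null set; meaningful only for f in sobolev a b 1. *)
definition weak_deriv :: "real \<Rightarrow> real \<Rightarrow> (real \<Rightarrow> real) \<Rightarrow> real \<Rightarrow> real" where
  "weak_deriv a b f = (SOME g. g \<in> L2 a b \<and> is_weak_deriv a b f g)"

(* Point values of a function in sobolev a b 1 are those of its continuous representative,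
   which is unique on [a,b] for a < b. *)
definition cont_rep :: "real \<Rightarrow> real \<Rightarrow> (real \<Rightarrow> real) \<Rightarrow> real \<Rightarrow> real" where
  "cont_rep a b f = (SOME h. continuous_on {a..b} h \<and> ae_eq a b h f)"

definition sobolev_vec :: "real \<Rightarrow> real \<Rightarrow> nat \<Rightarrow> nat \<Rightarrow> (real \<Rightarrow> real vec) set" where
  "sobolev_vec a b k m =
     {f. (\<forall>s\<in>{a..b}. f s \<in> carrier_vec m) \<and> (\<forall>i<m. (\<lambda>s. f s $ i) \<in> sobolev a b k)}"

abbreviation L2_vec :: "real \<Rightarrow> real \<Rightarrow> nat \<Rightarrow> (real \<Rightarrow> real vec) set" where
  "L2_vec a b m \<equiv> sobolev_vec a b 0 m"

definition weak_deriv_vec :: "real \<Rightarrow> real \<Rightarrow> nat \<Rightarrow> (real \<Rightarrow> real vec) \<Rightarrow> real \<Rightarrow> real vec" where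
  "weak_deriv_vec a b m f = (\<lambda>s. vec m (\<lambda>i. weak_deriv a b (\<lambda>\<theta>. f \<theta> $ i) s))"

definition cont_rep_vec :: "real \<Rightarrow> real \<Rightarrow> nat \<Rightarrow> (real \<Rightarrow> real vec) \<Rightarrow> real \<Rightarrow> real vec" where
  "cont_rep_vec a b m f = (\<lambda>s. vec m (\<lambda>i. cont_rep a b (\<lambda>\<theta>. f \<theta> $ i) s))"

definition L2_inner ::
  "real \<Rightarrow> real \<Rightarrow> (real \<Rightarrow> real vec) \<Rightarrow> (real \<Rightarrow> real vec) \<Rightarrow> real" where
  "L2_inner a b f g = (LINT s|lebesgue_on {a..b}. scalar_prod (f s) (g s))"

definition L2_norm :: "real \<Rightarrow> real \<Rightarrow> (real \<Rightarrow> real vec) \<Rightarrow> real" where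
  "L2_norm a b f = sqrt (L2_inner a b f f)"

definition sobolev_norm :: "real \<Rightarrow> real \<Rightarrow> nat \<Rightarrow> nat \<Rightarrow> (real \<Rightarrow> real vec) \<Rightarrow> real" where
  "sobolev_norm a b k m f =
     sqrt (\<Sum>j\<le>k. (L2_norm a b ((weak_deriv_vec a b m ^^ j) f))\<^sup>2)"

text \<open>\<open>d\<close> is the Frechet derivative at \<open>t \<ge> 0\<close> of the curve \<open>u\<close> on \<open>[0,\<infinity>)\<close> with values in the space
  \<open>S\<close> normed by \<open>N\<close>; the linear map \<open>h \<mapsto> h d\<close> is identified with \<open>d\<close>. At \<open>t = 0\<close> the derivative is
  one-sided.\<close>

definition has_frechet_derivative ::
  "(real \<Rightarrow> real vec) set \<Rightarrow> ((real \<Rightarrow> real vec) \<Rightarrow> real) \<Rightarrow>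
   (real \<Rightarrow> real \<Rightarrow> real vec) \<Rightarrow> (real \<Rightarrow> real vec) \<Rightarrow> real \<Rightarrow> bool" where
  "has_frechet_derivative S N u d t \<longleftrightarrow>
     d \<in> S \<and>
     ((\<lambda>r. N (\<lambda>s. u r s - u t s - (r - t) \<cdot>\<^sub>v d s) / \<bar>r - t\<bar>) \<longlongrightarrow> 0) (at t within {0..})"

section \<open>3-PI operators\<close>

text \<open>The integral of a vector-valued function is taken componentwise.\<close>

definition PI_op ::
  "real \<Rightarrow> real \<Rightarrow> nat \<Rightarrow> (real \<Rightarrow> real mat) \<Rightarrow> (real \<Rightarrow> real \<Rightarrow> real mat) \<Rightarrow>
   (real \<Rightarrow> real \<Rightarrow> real mat) \<Rightarrow> (real \<Rightarrow> real vec) \<Rightarrow> real \<Rightarrow> real vec" where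
  "PI_op a b n N0 N1 N2 x = (\<lambda>s.
     N0 s *\<^sub>v x s
     + vec n (\<lambda>i. LINT \<theta>|lebesgue_on {a..s}. (N1 s \<theta> *\<^sub>v x \<theta>) $ i)
     + vec n (\<lambda>i. LINT \<theta>|lebesgue_on {s..b}. (N2 s \<theta> *\<^sub>v x \<theta>) $ i))"

section \<open>The block matrices\<close>

definition append_cols :: "real mat \<Rightarrow> real mat \<Rightarrow> real mat"  (infixr \<open>@\<^sub>c\<close> 67) where
  "A @\<^sub>c B = four_block_mat A B (0\<^sub>m 0 (dim_col A)) (0\<^sub>m 0 (dim_col B))"

definition T_mat :: "real \<Rightarrow> real \<Rightarrow> nat \<Rightarrow> nat \<Rightarrow> real mat" where
  "T_mat a b n1 n2 =
     (1\<^sub>m n1    @\<^sub>c 0\<^sub>m n1 n2 @\<^sub>c 0\<^sub>m n1 n2) @\<^sub>r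
     (1\<^sub>m n1    @\<^sub>c 0\<^sub>m n1 n2 @\<^sub>c 0\<^sub>m n1 n2) @\<^sub>r
     (0\<^sub>m n2 n1 @\<^sub>c 1\<^sub>m n2    @\<^sub>c 0\<^sub>m n2 n2) @\<^sub>r
     (0\<^sub>m n2 n1 @\<^sub>c 1\<^sub>m n2    @\<^sub>c (b - a) \<cdot>\<^sub>m 1\<^sub>m n2) @\<^sub>r
     (0\<^sub>m n2 n1 @\<^sub>c 0\<^sub>m n2 n2 @\<^sub>c 1\<^sub>m n2) @\<^sub>r
     (0\<^sub>m n2 n1 @\<^sub>c 0\<^sub>m n2 n2 @\<^sub>c 1\<^sub>m n2)"

definition Q_mat :: "real \<Rightarrow> nat \<Rightarrow> nat \<Rightarrow> nat \<Rightarrow> real \<Rightarrow> real \<Rightarrow> real mat" where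
  "Q_mat b n0 n1 n2 s \<theta> =
     (0\<^sub>m n1 n0 @\<^sub>c 0\<^sub>m n1 n1 @\<^sub>c 0\<^sub>m n1 n2) @\<^sub>r
     (0\<^sub>m n1 n0 @\<^sub>c 1\<^sub>m n1    @\<^sub>c 0\<^sub>m n1 n2) @\<^sub>r
     (0\<^sub>m n2 n0 @\<^sub>c 0\<^sub>m n2 n1 @\<^sub>c 0\<^sub>m n2 n2) @\<^sub>r
     (0\<^sub>m n2 n0 @\<^sub>c 0\<^sub>m n2 n1 @\<^sub>c (b - \<theta>) \<cdot>\<^sub>m 1\<^sub>m n2) @\<^sub>r
     (0\<^sub>m n2 n0 @\<^sub>c 0\<^sub>m n2 n1 @\<^sub>c 0\<^sub>m n2 n2) @\<^sub>r
     (0\<^sub>m n2 n0 @\<^sub>c 0\<^sub>m n2 n1 @\<^sub>c 1\<^sub>m n2)"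

definition K_mat :: "real \<Rightarrow> nat \<Rightarrow> nat \<Rightarrow> nat \<Rightarrow> real \<Rightarrow> real mat" where
  "K_mat a n0 n1 n2 s =
     (0\<^sub>m n0 n1 @\<^sub>c 0\<^sub>m n0 n2 @\<^sub>c 0\<^sub>m n0 n2) @\<^sub>r
     (1\<^sub>m n1    @\<^sub>c 0\<^sub>m n1 n2 @\<^sub>c 0\<^sub>m n1 n2) @\<^sub>r
     (0\<^sub>m n2 n1 @\<^sub>c 1\<^sub>m n2    @\<^sub>c (s - a) \<cdot>\<^sub>m 1\<^sub>m n2)"

definition V_mat :: "nat \<Rightarrow> nat \<Rightarrow> real mat" where
  "V_mat n1 n2 =
     (0\<^sub>m n1 n1 @\<^sub>c 0\<^sub>m n1 n2 @\<^sub>c 0\<^sub>m n1 n2) @\<^sub>r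
     (0\<^sub>m n2 n1 @\<^sub>c 0\<^sub>m n2 n2 @\<^sub>c 1\<^sub>m n2)"

definition BT_inv :: "real \<Rightarrow> real \<Rightarrow> nat \<Rightarrow> nat \<Rightarrow> real mat \<Rightarrow> real mat" where
  "BT_inv a b n1 n2 B = the (mat_inverse (B * T_mat a b n1 n2))"

definition G0 :: "nat \<Rightarrow> nat \<Rightarrow> nat \<Rightarrow> real \<Rightarrow> real mat" where
  "G0 n0 n1 n2 s =
     (1\<^sub>m n0    @\<^sub>c 0\<^sub>m n0 n1 @\<^sub>c 0\<^sub>m n0 n2) @\<^sub>r
     (0\<^sub>m n1 n0 @\<^sub>c 0\<^sub>m n1 n1 @\<^sub>c 0\<^sub>m n1 n2) @\<^sub>r
     (0\<^sub>m n2 n0 @\<^sub>c 0\<^sub>m n2 n1 @\<^sub>c 0\<^sub>m n2 n2)"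

definition G2 ::
  "real \<Rightarrow> real \<Rightarrow> nat \<Rightarrow> nat \<Rightarrow> nat \<Rightarrow> real mat \<Rightarrow> real \<Rightarrow> real \<Rightarrow> real mat" where
  "G2 a b n0 n1 n2 B s \<theta> =
     - (K_mat a n0 n1 n2 s * BT_inv a b n1 n2 B * B * Q_mat b n0 n1 n2 s \<theta>)"

definition G1 ::
  "real \<Rightarrow> real \<Rightarrow> nat \<Rightarrow> nat \<Rightarrow> nat \<Rightarrow> real mat \<Rightarrow> real \<Rightarrow> real \<Rightarrow> real mat" where
  "G1 a b n0 n1 n2 B s \<theta> =
     ((0\<^sub>m n0 n0 @\<^sub>c 0\<^sub>m n0 n1 @\<^sub>c 0\<^sub>m n0 n2) @\<^sub>r
      (0\<^sub>m n1 n0 @\<^sub>c 1\<^sub>m n1    @\<^sub>c 0\<^sub>m n1 n2) @\<^sub>r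
      (0\<^sub>m n2 n0 @\<^sub>c 0\<^sub>m n2 n1 @\<^sub>c (s - \<theta>) \<cdot>\<^sub>m 1\<^sub>m n2))
     + G2 a b n0 n1 n2 B s \<theta>"

definition G3 :: "nat \<Rightarrow> nat \<Rightarrow> nat \<Rightarrow> real \<Rightarrow> real mat" where
  "G3 n0 n1 n2 s =
     (0\<^sub>m n1 n0 @\<^sub>c 1\<^sub>m n1    @\<^sub>c 0\<^sub>m n1 n2) @\<^sub>r
     (0\<^sub>m n2 n0 @\<^sub>c 0\<^sub>m n2 n1 @\<^sub>c 0\<^sub>m n2 n2)"

definition G5 ::
  "real \<Rightarrow> real \<Rightarrow> nat \<Rightarrow> nat \<Rightarrow> nat \<Rightarrow> real mat \<Rightarrow> real \<Rightarrow> real \<Rightarrow> real mat" where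
  "G5 a b n0 n1 n2 B s \<theta> =
     - (V_mat n1 n2 * BT_inv a b n1 n2 B * B * Q_mat b n0 n1 n2 s \<theta>)"

definition G4 ::
  "real \<Rightarrow> real \<Rightarrow> nat \<Rightarrow> nat \<Rightarrow> nat \<Rightarrow> real mat \<Rightarrow> real \<Rightarrow> real \<Rightarrow> real mat" where
  "G4 a b n0 n1 n2 B s \<theta> =
     ((0\<^sub>m n1 n0 @\<^sub>c 0\<^sub>m n1 n1 @\<^sub>c 0\<^sub>m n1 n2) @\<^sub>r
      (0\<^sub>m n2 n0 @\<^sub>c 0\<^sub>m n2 n1 @\<^sub>c 1\<^sub>m n2))
     + G5 a b n0 n1 n2 B s \<theta>"

section \<open>The state space and its norm\<close>

definition part0 :: "nat \<Rightarrow> (real \<Rightarrow> real vec) \<Rightarrow> real \<Rightarrow> real vec" where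
  "part0 n0 x = (\<lambda>s. vec n0 (\<lambda>i. x s $ i))"

definition part1 :: "nat \<Rightarrow> nat \<Rightarrow> (real \<Rightarrow> real vec) \<Rightarrow> real \<Rightarrow> real vec" where
  "part1 n0 n1 x = (\<lambda>s. vec n1 (\<lambda>i. x s $ (n0 + i)))"

definition part2 :: "nat \<Rightarrow> nat \<Rightarrow> nat \<Rightarrow> (real \<Rightarrow> real vec) \<Rightarrow> real \<Rightarrow> real vec" where
  "part2 n0 n1 n2 x = (\<lambda>s. vec n2 (\<lambda>i. x s $ (n0 + n1 + i)))"

definition boundary_vec ::
  "real \<Rightarrow> real \<Rightarrow> nat \<Rightarrow> nat \<Rightarrow> (real \<Rightarrow> real vec) \<Rightarrow> (real \<Rightarrow> real vec) \<Rightarrow> real vec" where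
  "boundary_vec a b n1 n2 x1 x2 =
     cont_rep_vec a b n1 x1 a @\<^sub>v cont_rep_vec a b n1 x1 b @\<^sub>v
     cont_rep_vec a b n2 x2 a @\<^sub>v cont_rep_vec a b n2 x2 b @\<^sub>v
     cont_rep_vec a b n2 (weak_deriv_vec a b n2 x2) a @\<^sub>v
     cont_rep_vec a b n2 (weak_deriv_vec a b n2 x2) b"

definition X_space ::
  "real \<Rightarrow> real \<Rightarrow> nat \<Rightarrow> nat \<Rightarrow> nat \<Rightarrow> real mat \<Rightarrow> (real \<Rightarrow> real vec) set" where
  "X_space a b n0 n1 n2 B =
     {x. (\<forall>s\<in>{a..b}. x s \<in> carrier_vec (n0 + n1 + n2)) \<and>
         part0 n0 x \<in> L2_vec a b n0 \<and>
         part1 n0 n1 x \<in> sobolev_vec a b 1 n1 \<and>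
         part2 n0 n1 n2 x \<in> sobolev_vec a b 2 n2 \<and>
         B *\<^sub>v boundary_vec a b n1 n2 (part1 n0 n1 x) (part2 n0 n1 n2 x) = 0\<^sub>v (n1 + 2 * n2)}"

text \<open>The norm that \<open>X\<close> inherits from the product of \<open>L\<^sub>2\<close>, \<open>H\<^sub>1\<close> and \<open>H\<^sub>2\<close>.\<close>

definition X_norm ::
  "real \<Rightarrow> real \<Rightarrow> nat \<Rightarrow> nat \<Rightarrow> nat \<Rightarrow> (real \<Rightarrow> real vec) \<Rightarrow> real" where
  "X_norm a b n0 n1 n2 x =
     sqrt ((L2_norm a b (part0 n0 x))\<^sup>2 + (sobolev_norm a b 1 n1 (part1 n0 n1 x))\<^sup>2
           + (sobolev_norm a b 2 n2 (part2 n0 n1 n2 x))\<^sup>2)"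

section \<open>Solutions\<close>

text \<open>\<open>\<partial>\<^sub>t x(t)\<close> and the two sides of each evolution equation are elements of \<open>L\<^sub>2\<close>, so the equations are
  required almost everywhere in \<open>s\<close>; the derivative \<open>d\<close> is unique up to null sets.\<close>

definition PDE_solution ::
  "real \<Rightarrow> real \<Rightarrow> nat \<Rightarrow> nat \<Rightarrow> nat \<Rightarrow> real mat \<Rightarrow>
   (real \<Rightarrow> real mat) \<Rightarrow> (real \<Rightarrow> real mat) \<Rightarrow> (real \<Rightarrow> real mat) \<Rightarrow>
   (real \<Rightarrow> real vec) \<Rightarrow> (real \<Rightarrow> real \<Rightarrow> real vec) \<Rightarrow> bool" where
  "PDE_solution a b n0 n1 n2 B A0 A1 A2 x_init x \<longleftrightarrow>
     x_init \<in> X_space a b n0 n1 n2 B \<and>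
     ae_eq a b (x 0) x_init \<and>
     (\<forall>t\<ge>0. x t \<in> X_space a b n0 n1 n2 B) \<and>
     (\<forall>t\<ge>0. \<exists>d. has_frechet_derivative (X_space a b n0 n1 n2 B) (X_norm a b n0 n1 n2) x d t \<and>
        ae_eq a b d (\<lambda>s.
          A0 s *\<^sub>v x t s
          + A1 s *\<^sub>v (weak_deriv_vec a b n1 (part1 n0 n1 (x t)) s
                      @\<^sub>v weak_deriv_vec a b n2 (part2 n0 n1 n2 (x t)) s)
          + A2 s *\<^sub>v (weak_deriv_vec a b n2 (weak_deriv_vec a b n2 (part2 n0 n1 n2 (x t)))) s))"

definition PIE_solution ::
  "real \<Rightarrow> real \<Rightarrow> nat \<Rightarrow>
   ((real \<Rightarrow> real vec) \<Rightarrow> real \<Rightarrow> real vec) \<Rightarrow> ((real \<Rightarrow> real vec) \<Rightarrow> real \<Rightarrow> real vec) \<Rightarrow>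
   (real \<Rightarrow> real vec) \<Rightarrow> (real \<Rightarrow> real \<Rightarrow> real vec) \<Rightarrow> bool" where
  "PIE_solution a b n \<T> \<A> xh_init xh \<longleftrightarrow>
     xh_init \<in> L2_vec a b n \<and>
     ae_eq a b (xh 0) xh_init \<and>
     (\<forall>t\<ge>0. xh t \<in> L2_vec a b n) \<and>
     (\<forall>t\<ge>0. \<exists>d. has_frechet_derivative (L2_vec a b n) (L2_norm a b) xh d t \<and>
        ae_eq a b (\<T> d) (\<A> (xh t)))"

end

theory Submission
  imports Defs
begin

text \<open>The operator \<open>\<T>\<close> is a linear isomorphism, bounded in both directions, from \<open>L\<^sub>2\<close> onto \<open>X\<close>; its
  inverse is \<open>(x\<^sub>0, x\<^sub>1, x\<^sub>2) \<mapsto> (x\<^sub>0, \<partial>x\<^sub>1, \<partial>\<^sup>2x\<^sub>2)\<close>. Indeed an element of \<open>H\<^sub>1\<close> or \<open>H\<^sub>2\<close> is determined by its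
  highest derivative and its values \<open>c\<close> at \<open>a\<close>; its boundary vector is then \<open>T c + q\<close>, where \<open>q\<close> is the
  integral of \<open>Q\<close> applied to the derivatives, so that the boundary condition \<open>B(T c + q) = 0\<close> forces
  \<open>c = -(B T)\<^sup>-\<^sup>1 B q\<close>. Inserting this \<open>c\<close> in Taylor's formula gives the kernels \<open>G\<^sub>0, G\<^sub>1, G\<^sub>2\<close>, and
  differentiating once gives \<open>G\<^sub>3, G\<^sub>4, G\<^sub>5\<close>; hence \<open>\<A>\<close> is the right-hand side of the PDE composed
  with \<open>\<T>\<close>. Since \<open>\<T>\<close> is an isomorphism of normed spaces, it transports Frechet derivatives in both
  directions.\<close>

section \<open>Integration on an interval\<close>

text \<open>Elements of the spaces are functions up to null sets, and \<open>weak_deriv\<close> and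
  \<open>cont_rep\<close> are arbitrary choices, so \<open>\<T>\<close> and its inverse undo each
  other only almost everywhere. In place of equalities the proof uses a relation
  \<open>represents c z x\<close>: the coordinates of x agree almost everywhere with explicit
  primitives of z with integration constants c. Whatever concerns X (weak derivatives, boundary
  values, norms) is then computed from c and z. The analytic input is that a weak derivative
  determines its function up to a constant; this is the lemma of du Bois-Reymond. That derivatives
  of curves in X are taken in the norm containing the space derivatives is what makes the
  equivalence work: with it, the norm of z is at most that of x term by term. Conversely, primitives
  are bounded by the L2 norm through Cauchy-Schwarz, and so are the finitely many constants c, which
  depend linearly on values of primitives at b.\<close>

lemma lebesgue_sets_Icc: "{a..b::real} \<in> sets lebesgue"
  by simp

lemma L2_measurable: "f \<in> L2 a b \<Longrightarrow> f \<in> borel_measurable (lebesgue_on {a..b})"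
  by (simp add: L2_def)

lemma finite_measure_lebesgue_Icc: "finite_measure (lebesgue_on {a..b::real})"
  by (rule finite_measure_lebesgue_on) simp

lemma integrable_const_Icc: "integrable (lebesgue_on {a..b::real}) (\<lambda>_. c :: real)"
  by (rule finite_measure.integrable_const[OF finite_measure_lebesgue_Icc])

lemma L2_mult_integrable:
  assumes f: "f \<in> L2 a b" and g: "g \<in> L2 a b"
  shows "integrable (lebesgue_on {a..b}) (\<lambda>s. f s * g s)"
proof (rule Bochner_Integration.integrable_bound)
  show "integrable (lebesgue_on {a..b}) (\<lambda>s. (f s)\<^sup>2 + (g s)\<^sup>2)"
    using f g by (auto simp: L2_def)
  show "(\<lambda>s. f s * g s) \<in> borel_measurable (lebesgue_on {a..b})"
    using f[THEN L2_measurable] g[THEN L2_measurable] by measurable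
  have "\<bar>x * y\<bar> \<le> x\<^sup>2 + y\<^sup>2" for x y :: real
  proof -
    have "2 * \<bar>x * y\<bar> \<le> x\<^sup>2 + y\<^sup>2"
      using sum_squares_bound[of "\<bar>x\<bar>" "\<bar>y\<bar>"] by (simp add: abs_mult)
    then show ?thesis by linarith
  qed
  then show "AE s in lebesgue_on {a..b}. norm (f s * g s) \<le> norm ((f s)\<^sup>2 + (g s)\<^sup>2)"
    by simp
qed

lemma L2_const: "(\<lambda>_. c) \<in> L2 a b"
  by (simp add: L2_def integrable_const_Icc)

lemma L2_integrable: "f \<in> L2 a b \<Longrightarrow> integrable (lebesgue_on {a..b}) f"
  using L2_mult_integrable[of f a b "\<lambda>_. 1"] L2_const by simp

lemma L2_add:
  assumes "f \<in> L2 a b" "g \<in> L2 a b"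
  shows "(\<lambda>s. f s + g s) \<in> L2 a b"
  using assms L2_mult_integrable[OF assms]
  by (auto simp: L2_def power2_sum mult.assoc)

lemma L2_cmult: "f \<in> L2 a b \<Longrightarrow> (\<lambda>s. c * f s) \<in> L2 a b"
  by (auto simp: L2_def power_mult_distrib)

lemma L2_diff:
  assumes "f \<in> L2 a b" "g \<in> L2 a b"
  shows "(\<lambda>s. f s - g s) \<in> L2 a b"
  using L2_add[OF assms(1) L2_cmult[OF assms(2), of "-1"]] by simp

lemma L2_cong: "(\<And>s. s \<in> {a..b} \<Longrightarrow> f s = g s) \<Longrightarrow> f \<in> L2 a b \<longleftrightarrow> g \<in> L2 a b"
  using measurable_lebesgue_cong[of "{a..b}" f g borel]
    Bochner_Integration.integrable_cong[of "lebesgue_on {a..b}" "lebesgue_on {a..b}" "\<lambda>s. (f s)\<^sup>2" "\<lambda>s. (g s)\<^sup>2"]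
  by (simp add: L2_def)

lemma integrable_continuous_mult:
  fixes f h :: "real \<Rightarrow> real"
  assumes h: "continuous_on {a..b} h" and f: "integrable (lebesgue_on {a..b}) f"
  shows "integrable (lebesgue_on {a..b}) (\<lambda>s. h s * f s)"
proof -
  have "compact (h ` {a..b})" using h by (rule compact_continuous_image) simp
  then obtain M where M: "\<And>s. s \<in> {a..b} \<Longrightarrow> \<bar>h s\<bar> \<le> M"
    by (metis bounded_real compact_imp_bounded image_eqI)
  show ?thesis
  proof (rule Bochner_Integration.integrable_bound)
    show "integrable (lebesgue_on {a..b}) (\<lambda>s. M * f s)" using f by simp
    have "h \<in> borel_measurable (lebesgue_on {a..b})"
      using h by (rule continuous_imp_measurable_on_sets_lebesgue) simp
    then show "(\<lambda>s. h s * f s) \<in> borel_measurable (lebesgue_on {a..b})" using f by auto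
    have "\<bar>h s * f s\<bar> \<le> \<bar>M * f s\<bar>" if "s \<in> {a..b}" for s
      using M[OF that] by (simp add: abs_mult mult_right_mono)
    then show "AE s in lebesgue_on {a..b}. norm (h s * f s) \<le> norm (M * f s)"
      by (auto intro!: AE_I2)
  qed
qed

lemma integrable_continuous: "continuous_on {a..b} h \<Longrightarrow> integrable (lebesgue_on {a..b}) h"
  for h :: "real \<Rightarrow> real"
  using integrable_continuous_mult[OF _ integrable_const_Icc[of a b 1]] by simp

lemma L2_continuous: "continuous_on {a..b} h \<Longrightarrow> h \<in> L2 a b"
  unfolding L2_def
  by (auto intro!: integrable_continuous continuous_intros continuous_imp_measurable_on_sets_lebesgue)

section \<open>Primitives and the exchange of integrals over a triangle\<close>

text \<open>A primitive is a genuine function: changing g on a null set does not change it.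
  Primitives therefore serve as the continuous representatives whose boundary values can be
  computed.\<close>

definition primitive :: "real \<Rightarrow> (real \<Rightarrow> real) \<Rightarrow> real \<Rightarrow> real" where
  "primitive a g s = (LINT \<theta>|lebesgue_on {a..s}. g \<theta>)"

lemma continuous_on_primitive:
  "integrable (lebesgue_on {a..b}) g \<Longrightarrow> continuous_on {a..b} (primitive a g)"
  unfolding primitive_def[abs_def] by (rule indefinite_integral_continuous_real)

lemma primitive_self [simp]: "primitive a g a = 0"
  unfolding primitive_def by (rule integral_eq_zero_null_sets) simp

lemma integral_Icc_combine:
  fixes h :: "real \<Rightarrow> real"
  assumes h: "integrable (lebesgue_on {a..b}) h" and s: "s \<in> {a..b}"
  shows "(LINT x|lebesgue_on {a..s}. h x) + (LINT x|lebesgue_on {s..b}. h x)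
       = (LINT x|lebesgue_on {a..b}. h x)"
proof -
  have i: "integrable (lebesgue_on {a..s}) h" "integrable (lebesgue_on {s..b}) h"
    using s by (auto intro!: integrable_subinterval[OF h])
  show ?thesis
    unfolding lebesgue_integral_eq_integral[OF i(1) lebesgue_sets_Icc] lebesgue_integral_eq_integral[OF i(2) lebesgue_sets_Icc]
      lebesgue_integral_eq_integral[OF h lebesgue_sets_Icc]
    using s by (intro Henstock_Kurzweil_Integration.integral_combine integrable_on_lebesgue_on[OF h]) simp_all
qed

lemma integral_primitive_tail:
  assumes h: "integrable (lebesgue_on {a..b}) h" and s: "s \<in> {a..b}"
  shows "(LINT x|lebesgue_on {s..b}. h x) = (LINT x|lebesgue_on {a..b}. h x) - primitive a h s"
  using integral_Icc_combine[OF h s] by (simp add: primitive_def)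

text \<open>Fubini's theorem will be applied to the product of \<open>lborel\<close> with itself,
  where integrands have to be Borel measurable. This moves an integral from the completed measure to
  \<open>lborel\<close> by means of a Borel function that agrees with the given one almost
  everywhere on S; the domain T may be any Borel part of S.\<close>

lemma integral_lebesgue_on_borel_version:
  fixes g g' :: "real \<Rightarrow> real"
  assumes g: "integrable (lebesgue_on S) g" and S: "S \<in> sets lebesgue"
    and g': "g' \<in> borel_measurable lborel" "AE x in lborel. indicator S x * g x = g' x"
    and T: "T \<subseteq> S" "T \<in> sets borel"
  shows "(LINT x|lebesgue_on T. g x) = (LINT x|lborel. indicator T x * g' x)"
proof -
  have T': "T \<in> sets lebesgue" using T by auto
  have "(LINT x|lebesgue_on T. g x) = (LINT x|lebesgue. indicator T x * g x)"
    using T' by (simp add: integral_restrict_space)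
  also have "\<dots> = (LINT x|lebesgue. indicator T x * g' x)"
  proof (rule integral_cong_AE)
    have "integrable (lebesgue_on T) g"
      using g S T' T(1)
      by (metis absolutely_integrable_imp_integrable integrable_restrict_space set_integrable_def
          set_integrable_subset sets.Int_space_eq2)
    then show "(\<lambda>x. indicator T x * g x) \<in> borel_measurable lebesgue"
      using T' by (simp add: integrable_restrict_space borel_measurable_integrable)
    show "(\<lambda>x. indicat_real T x * g' x) \<in> borel_measurable lebesgue"
      using g' T by (auto intro!: measurable_completion)
    have "AE x in lebesgue. indicator S x * g x = g' x" using g'(2) by (rule AE_completion)
    then show "AE x in lebesgue. indicat_real T x * g x = indicat_real T x * g' x"
      by eventually_elim (use T in \<open>auto simp: indicator_def\<close>)
  qed
  also have "\<dots> = (LINT x|lborel. indicator T x * g' x)"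
    using g' T by (intro integral_completion) auto
  finally show ?thesis .
qed

lemma ex_borel_version:
  fixes g :: "real \<Rightarrow> real"
  assumes g: "integrable (lebesgue_on S) g" and S: "S \<in> sets lebesgue"
  shows "\<exists>g'. integrable lborel g' \<and> (AE x in lborel. indicator S x * g x = g' x)"
proof -
  have i: "integrable lebesgue (\<lambda>x. indicator S x * g x)"
    using g S by (simp add: integrable_restrict_space)
  obtain g' where g': "g' \<in> borel_measurable lborel" "AE x in lborel. indicator S x * g x = g' x"
    using completion_ex_borel_measurable_real[OF borel_measurable_integrable[OF i]] by auto
  have "integrable lebesgue g'"
    using i g' by (subst integrable_cong_AE[symmetric, of "\<lambda>x. indicator S x * g x"])
      (auto intro: AE_completion measurable_completion)
  then have "integrable lborel g'"
    using g' by (simp add: integrable_completion)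
  with g' show ?thesis by blast
qed

text \<open>Both sides are iterated integrals of g(\<theta>) h(s) over the triangle a \<le> \<theta>
  \<le> s \<le> b. With h the derivative of a test function this is integration by parts; with h = 1
  it is Taylor's formula with integral remainder.\<close>

lemma integral_primitive_mult:
  fixes g h :: "real \<Rightarrow> real"
  assumes g: "integrable (lebesgue_on {a..b}) g" and h: "integrable (lebesgue_on {a..b}) h"
  shows "(LINT s|lebesgue_on {a..b}. primitive a g s * h s)
       = (LINT \<theta>|lebesgue_on {a..b}. g \<theta> * (LINT s|lebesgue_on {\<theta>..b}. h s))"
proof -
  obtain g' where g': "integrable lborel g'" "AE x in lborel. indicator {a..b} x * g x = g' x"
    using ex_borel_version[OF g] by auto
  obtain h' where h': "integrable lborel h'" "AE x in lborel. indicator {a..b} x * h x = h' x"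
    using ex_borel_version[OF h] by auto
  have [measurable]: "g' \<in> borel_measurable borel" "h' \<in> borel_measurable borel"
    using g' h' by (auto dest: borel_measurable_integrable)
  \<comment> \<open>The half-line indicator evaluated at s - \<theta> cuts out the triangle \<theta>
    \<le> s by a jointly measurable expression.\<close>
  define F where "F = (\<lambda>(s::real, \<theta>::real). indicator {0..} (s - \<theta>) * indicator {a..b} s * indicator {a..b} \<theta> * g' \<theta> * h' s)"
  have F_meas: "F \<in> borel_measurable (lborel \<Otimes>\<^sub>M lborel)" unfolding F_def by measurable
  have prod: "integrable (lborel \<Otimes>\<^sub>M lborel) (\<lambda>(s, \<theta>). h' s * g' \<theta>)"
  proof (rule lborel_pair.Fubini_integrable)
    show "integrable lborel (\<lambda>x. LINT y|lborel. norm (case (x, y) of (s, \<theta>) \<Rightarrow> h' s * g' \<theta>))"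
      using h'(1) g'(1) by (simp add: abs_mult)
    show "AE x in lborel. integrable lborel (\<lambda>y. case (x, y) of (s, \<theta>) \<Rightarrow> h' s * g' \<theta>)"
      using g'(1) by simp
  qed (measurable)
  have intF: "integrable (lborel \<Otimes>\<^sub>M lborel) F"
    by (rule Bochner_Integration.integrable_bound[OF prod F_meas])
       (auto simp: F_def indicator_def abs_mult)
  have swap: "(LINT s|lborel. LINT \<theta>|lborel. F (s, \<theta>)) = (LINT \<theta>|lborel. LINT s|lborel. F (s, \<theta>))"
    using lborel_pair.Fubini_integral[of "\<lambda>s \<theta>. F (s, \<theta>)"] intF by simp
  have m1: "integrable (lebesgue_on {a..b}) (\<lambda>s. primitive a g s * h s)"
    by (rule integrable_continuous_mult[OF continuous_on_primitive[OF g] h])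
  have P: "primitive a g s = (LINT \<theta>|lborel. indicator {a..s} \<theta> * g' \<theta>)" if "s \<in> {a..b}" for s
    unfolding primitive_def
    by (rule integral_lebesgue_on_borel_version[OF g _ _ g'(2)]) (use that in auto)
  have H: "(LINT s|lebesgue_on {\<theta>..b}. h s) = (LINT s|lborel. indicator {\<theta>..b} s * h' s)"
    if "\<theta> \<in> {a..b}" for \<theta>
    by (rule integral_lebesgue_on_borel_version[OF h _ _ h'(2)]) (use that in auto)
  have [measurable]: "(\<lambda>x. indicat_real {a..fst x} (snd x)) \<in> borel_measurable (borel \<Otimes>\<^sub>M borel)"
    "(\<lambda>x. indicat_real {fst x..b} (snd x)) \<in> borel_measurable (borel \<Otimes>\<^sub>M borel)"
  proof -
    \<comment> \<open>An interval with a moving end point becomes a product of indicators of fixed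
      half-lines, one in a coordinate and one in the difference of the coordinates.\<close>
    have "(\<lambda>x. indicat_real {a..fst x} (snd x)) = (\<lambda>x. indicat_real {a..} (snd x) * indicat_real {0..} (fst x - snd x :: real))"
      "(\<lambda>x. indicat_real {fst x..b} (snd x)) = (\<lambda>x. indicat_real {..b} (snd x) * indicat_real {0..} (snd x - fst x :: real))"
      by (auto simp: indicator_def fun_eq_iff)
    then show "(\<lambda>x. indicat_real {a..fst x} (snd x)) \<in> borel_measurable (borel \<Otimes>\<^sub>M borel)"
      "(\<lambda>x. indicat_real {fst x..b} (snd x)) \<in> borel_measurable (borel \<Otimes>\<^sub>M borel)"
      by simp_all
  qed
  \<comment> \<open>The indicator appears twice below: the outer one is the domain of integration,
    the inner one is part of the Borel version of the integrand.\<close>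
  have "(LINT s|lebesgue_on {a..b}. primitive a g s * h s)
      = (LINT s|lborel. indicator {a..b} s * (indicator {a..b} s * (LINT \<theta>|lborel. indicator {a..s} \<theta> * g' \<theta>) * h' s))"
  proof (rule integral_lebesgue_on_borel_version[OF m1])
    show "AE s in lborel. indicat_real {a..b} s * (primitive a g s * h s)
        = indicator {a..b} s * (LINT \<theta>|lborel. indicator {a..s} \<theta> * g' \<theta>) * h' s"
      using h'(2) by eventually_elim (use P in \<open>auto simp: indicator_def split: if_splits\<close>)
  qed auto
  also have "\<dots> = (LINT s|lborel. LINT \<theta>|lborel. F (s, \<theta>))"
  proof (rule Bochner_Integration.integral_cong[OF refl])
    fix s
    have "(LINT \<theta>|lborel. F (s, \<theta>)) = (LINT \<theta>|lborel. (indicator {a..b} s * h' s) * (indicator {a..s} \<theta> * g' \<theta>))"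
      by (rule Bochner_Integration.integral_cong) (auto simp: F_def indicator_def)
    then show "indicator {a..b} s * (indicator {a..b} s * (LINT \<theta>|lborel. indicator {a..s} \<theta> * g' \<theta>) * h' s) = (LINT \<theta>|lborel. F (s, \<theta>))"
      by (simp add: indicator_def)
  qed
  also have "\<dots> = (LINT \<theta>|lborel. indicator {a..b} \<theta> * (indicator {a..b} \<theta> * (g' \<theta> * (LINT s|lborel. indicator {\<theta>..b} s * h' s))))"
    unfolding swap
  proof (rule Bochner_Integration.integral_cong[OF refl])
    fix \<theta>
    have "(LINT s|lborel. F (s, \<theta>)) = (LINT s|lborel. (indicator {a..b} \<theta> * g' \<theta>) * (indicator {\<theta>..b} s * h' s))"
      by (rule Bochner_Integration.integral_cong) (auto simp: F_def indicator_def)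
    then show "(LINT s|lborel. F (s, \<theta>)) = indicator {a..b} \<theta> * (indicator {a..b} \<theta> * (g' \<theta> * (LINT s|lborel. indicator {\<theta>..b} s * h' s)))"
      by (simp add: indicator_def)
  qed
  also have "\<dots> = (LINT \<theta>|lebesgue_on {a..b}. g \<theta> * (LINT s|lebesgue_on {\<theta>..b}. h s))"
  proof (rule integral_lebesgue_on_borel_version[symmetric])
    have "integrable (lebesgue_on {a..b}) (\<lambda>\<theta>. ((LINT s|lebesgue_on {a..b}. h s) - primitive a h \<theta>) * g \<theta>)"
      by (intro integrable_continuous_mult continuous_intros continuous_on_primitive h g)
    moreover have "integrable (lebesgue_on {a..b}) (\<lambda>\<theta>. ((LINT s|lebesgue_on {a..b}. h s) - primitive a h \<theta>) * g \<theta>)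
      \<longleftrightarrow> integrable (lebesgue_on {a..b}) (\<lambda>\<theta>. g \<theta> * (LINT s|lebesgue_on {\<theta>..b}. h s))"
    proof (rule Bochner_Integration.integrable_cong[OF refl])
      fix \<theta> assume "\<theta> \<in> space (lebesgue_on {a..b})"
      then have "(LINT s|lebesgue_on {\<theta>..b}. h s) = (LINT s|lebesgue_on {a..b}. h s) - primitive a h \<theta>"
        by (intro integral_primitive_tail[OF h]) simp
      then show "((LINT s|lebesgue_on {a..b}. h s) - primitive a h \<theta>) * g \<theta> = g \<theta> * (LINT s|lebesgue_on {\<theta>..b}. h s)"
        by simp
    qed
    ultimately show "integrable (lebesgue_on {a..b}) (\<lambda>\<theta>. g \<theta> * (LINT s|lebesgue_on {\<theta>..b}. h s))"
      by blast
    show "AE \<theta> in lborel. indicat_real {a..b} \<theta> * (g \<theta> * (LINT s|lebesgue_on {\<theta>..b}. h s))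
        = indicator {a..b} \<theta> * (g' \<theta> * (LINT s|lborel. indicator {\<theta>..b} s * h' s))"
      using g'(2) by eventually_elim (use H in \<open>auto simp: indicator_def split: if_splits\<close>)
  qed auto
  finally show ?thesis .
qed

section \<open>Weak derivatives in one dimension\<close>

text \<open>The integral of f over every half-line within [a,b] vanishes, so the positive and the
  negative part of f are densities of two finite measures that agree on all sets
  \<open>{c<..}\<close>. Such measures coincide, and densities are unique almost everywhere; a
  function whose positive and negative parts agree is zero.\<close>

lemma AE_zero_if_primitive_zero:
  fixes f :: "real \<Rightarrow> real"
  assumes f: "integrable (lebesgue_on {a..b}) f"
    and 0: "\<And>x. x \<in> {a..b} \<Longrightarrow> primitive a f x = 0"
  shows "AE x in lebesgue_on {a..b}. f x = 0"
proof (cases "a \<le> b")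
  case ab: True
  obtain g where g: "integrable lborel g" "AE x in lborel. indicator {a..b} x * f x = g x"
    using ex_borel_version[OF f] by auto
  have [measurable]: "g \<in> borel_measurable borel"
    using g by (auto dest: borel_measurable_integrable)
  define k where "k x = indicator {a..b} x * g x" for x
  have [measurable]: "k \<in> borel_measurable borel" unfolding k_def by simp
  have k: "integrable lborel k" unfolding k_def using integrable_mult_indicator[OF _ g(1), of "{a..b}"] by simp
  have Ioi: "(LINT x|lborel. indicator {c<..} x * k x) = 0" for c
  proof -
    \<comment> \<open>Since k vanishes off [a,b], the half-line above c may be replaced by [c', b],
      and that integral is a difference of two values of the primitive.\<close>
    define c' where "c' = max a c"
    show ?thesis
    proof (cases "c' < b")
      case True
      have "(LINT x|lborel. indicator {c<..} x * k x) = (LINT x|lborel. indicator {c'..b} x * g x)"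
      proof (rule integral_cong_AE)
        have "AE x in lborel. x \<noteq> a" "AE x in lborel. x \<noteq> c" by (simp_all add: AE_lborel_singleton)
        then show "AE x in lborel. indicator {c<..} x * k x = indicator {c'..b} x * g x"
          by eventually_elim (auto simp: k_def c'_def indicator_def)
      qed auto
      also have "\<dots> = (LINT x|lebesgue_on {c'..b}. f x)"
        by (rule integral_lebesgue_on_borel_version[OF f _ _ g(2), symmetric]) (auto simp: c'_def)
      also have "\<dots> = (LINT x|lebesgue_on {a..b}. f x) - primitive a f c'"
        using True by (intro integral_primitive_tail[OF f]) (auto simp: c'_def)
      also have "\<dots> = 0"
        using 0[of c'] 0[of b] ab True by (simp add: primitive_def c'_def)
      finally show ?thesis .
    next
      case False
      have "(LINT x|lborel. indicator {c<..} x * k x) = (LINT x::real|lborel. 0)"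
      proof (rule integral_cong_AE)
        have "AE x in lborel. x \<noteq> b" by (simp add: AE_lborel_singleton)
        then show "AE x in lborel. indicator {c<..} x * k x = 0"
          by eventually_elim (use False ab in \<open>auto simp: k_def c'_def indicator_def\<close>)
      qed auto
      then show ?thesis by simp
    qed
  qed
  have em: "emeasure (density lborel (\<lambda>x. ennreal (p x))) {c<..} = ennreal (LINT x|lborel. indicator {c<..} x * p x)"
    if p: "p = (\<lambda>x. max 0 (k x)) \<or> p = (\<lambda>x. max 0 (- k x))" for p c
  proof -
    have [measurable]: "p \<in> borel_measurable borel" using p by auto
    have "integrable lborel p" using p k by auto
    then have i: "integrable lborel (\<lambda>x. indicator {c<..} x * p x)"
      using integrable_mult_indicator[of "{c<..}" lborel p] by simp
    have "emeasure (density lborel (\<lambda>x. ennreal (p x))) {c<..} = (\<integral>\<^sup>+x. ennreal (p x) * indicator {c<..} x \<partial>lborel)"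
      by (simp add: emeasure_density)
    also have "\<dots> = (\<integral>\<^sup>+x. ennreal (indicator {c<..} x * p x) \<partial>lborel)"
      by (rule nn_integral_cong) (auto simp: indicator_def)
    also have "\<dots> = ennreal (LINT x|lborel. indicator {c<..} x * p x)"
      using i p by (intro nn_integral_eq_integral) auto
    finally show ?thesis .
  qed
  have "density lborel (\<lambda>x. ennreal (max 0 (k x))) = density lborel (\<lambda>x. ennreal (max 0 (- k x)))"
  proof (rule measure_eqI_lessThan)
    show "emeasure (density lborel (\<lambda>x. ennreal (max 0 (k x)))) {c<..} < \<infinity>" for c
      by (simp add: em)
    fix c
    have i: "integrable lborel (\<lambda>x. indicator {c<..} x * max 0 (k x))" "integrable lborel (\<lambda>x. indicator {c<..} x * max 0 (- k x))"
      using integrable_mult_indicator[of "{c<..}" lborel "\<lambda>x. max 0 (k x)"]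
        integrable_mult_indicator[of "{c<..}" lborel "\<lambda>x. max 0 (- k x)"] k by simp_all
    have "(LINT x|lborel. indicator {c<..} x * max 0 (k x)) - (LINT x|lborel. indicator {c<..} x * max 0 (- k x))
       = (LINT x|lborel. indicator {c<..} x * k x)"
      unfolding Bochner_Integration.integral_diff[OF i, symmetric]
      by (rule Bochner_Integration.integral_cong) (auto simp: max_def indicator_def)
    then show "emeasure (density lborel (\<lambda>x. ennreal (max 0 (k x)))) {c<..} = emeasure (density lborel (\<lambda>x. ennreal (max 0 (- k x)))) {c<..}"
      using Ioi[of c] by (simp add: em)
  qed simp_all
  then have "AE x in lborel. ennreal (max 0 (k x)) = ennreal (max 0 (- k x))"
    by (intro sigma_finite_measure.density_unique lborel.sigma_finite_measure_axioms) auto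
  then have "AE x in lborel. k x = 0"
    by eventually_elim (auto simp: max_def split: if_splits)
  with g(2) have "AE x in lborel. x \<in> {a..b} \<longrightarrow> f x = 0"
    by eventually_elim (auto simp: k_def)
  then have "AE x in lebesgue. x \<in> {a..b} \<longrightarrow> f x = 0" by (rule AE_completion)
  then show ?thesis by (simp add: AE_restrict_space_iff)
qed (auto intro!: AE_I2)

text \<open>Continuous approximations of the indicator of \<open>(u,v)\<close> with support in \<open>[u + 1/k, v - 1/k]\<close>. A
  combination of two of them with vanishing integral is the derivative of a test function.\<close>

definition trapezoid :: "real \<Rightarrow> real \<Rightarrow> nat \<Rightarrow> real \<Rightarrow> real" where
  "trapezoid u v k s = min 1 (max 0 (real k * (s - u) - 1)) * min 1 (max 0 (real k * (v - s) - 1))"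

lemma continuous_on_trapezoid: "continuous_on S (trapezoid u v k)"
  unfolding trapezoid_def[abs_def] by (intro continuous_intros)

lemma trapezoid_bounds: "0 \<le> trapezoid u v k s" "trapezoid u v k s \<le> 1"
  unfolding trapezoid_def by (auto intro!: mult_nonneg_nonneg mult_le_one)

lemma trapezoid_eq_0:
  assumes "k > 0" "s \<notin> {u + 1 / real k..v - 1 / real k}"
  shows "trapezoid u v k s = 0"
proof -
  have "real k * (s - u) \<le> 1 \<or> real k * (v - s) \<le> 1"
    using assms by (auto simp: field_simps not_le)
  then show ?thesis by (auto simp: trapezoid_def)
qed

lemma trapezoid_tendsto: "(\<lambda>k. trapezoid u v k s) \<longlonglongrightarrow> indicator {u<..<v} s"
proof (cases "s \<in> {u<..<v}")
  case True
  \<comment> \<open>Once k(s - u) and k(v - s) are at least 2, both truncated factors have reached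
    1, so the sequence is eventually constant.\<close>
  obtain N where N: "real N \<ge> 2 / (s - u)" "real N \<ge> 2 / (v - s)"
    using real_arch_simple[of "max (2 / (s - u)) (2 / (v - s))"] by auto
  have "trapezoid u v k s = 1" if "k \<ge> N" for k
  proof -
    have "real k \<ge> 2 / (s - u)" "real k \<ge> 2 / (v - s)" using N that by linarith+
    then have "real k * (s - u) \<ge> 2" "real k * (v - s) \<ge> 2" using True by (auto simp: field_simps)
    then show ?thesis by (auto simp: trapezoid_def)
  qed
  then show ?thesis using True
    by (intro tendsto_eventually) (auto simp: eventually_sequentially)
next
  case False
  have "trapezoid u v k s = 0" for k
  proof -
    have "s - u \<le> 0 \<or> v - s \<le> 0" using False by auto
    then have "real k * (s - u) \<le> 0 \<or> real k * (v - s) \<le> 0" by (auto simp: mult_nonneg_nonpos)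
    then show ?thesis by (auto simp: trapezoid_def)
  qed
  then show ?thesis using False by simp
qed

lemma integral_trapezoid_tendsto:
  assumes f: "integrable (lebesgue_on {a..b}) f" and uv: "a \<le> u" "v \<le> b"
  shows "(\<lambda>k. LINT s|lebesgue_on {a..b}. f s * trapezoid u v k s) \<longlonglongrightarrow> (LINT s|lebesgue_on {u..v}. f s)"
proof -
  have fm: "f \<in> borel_measurable (lebesgue_on {a..b})" using f by auto
  have "(\<lambda>k. LINT s|lebesgue_on {a..b}. f s * trapezoid u v k s) \<longlonglongrightarrow> (LINT s|lebesgue_on {a..b}. f s * indicator {u<..<v} s)"
  proof (rule integral_dominated_convergence)
    show "integrable (lebesgue_on {a..b}) (\<lambda>s. norm (f s))" using f by simp
    have "{u<..<v} \<in> sets lebesgue" by simp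
    then have "indicat_real {u<..<v} \<in> borel_measurable (lebesgue_on {a..b})"
      by (intro measurable_restrict_space1 borel_measurable_indicator)
    then show "(\<lambda>s. f s * indicator {u<..<v} s) \<in> borel_measurable (lebesgue_on {a..b})"
      using fm by measurable
    show "(\<lambda>s. f s * trapezoid u v k s) \<in> borel_measurable (lebesgue_on {a..b})" for k
      using fm continuous_imp_measurable_on_sets_lebesgue[OF continuous_on_trapezoid[of "{a..b}" u v k] lebesgue_sets_Icc]
      by measurable
    show "AE s in lebesgue_on {a..b}. (\<lambda>k. f s * trapezoid u v k s) \<longlonglongrightarrow> f s * indicator {u<..<v} s"
      by (intro AE_I2 tendsto_intros trapezoid_tendsto)
    show "AE s in lebesgue_on {a..b}. norm (f s * trapezoid u v k s) \<le> norm (f s)" for k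
      using trapezoid_bounds by (auto simp: abs_mult intro!: mult_left_le)
  qed
  also have "(LINT s|lebesgue_on {a..b}. f s * indicator {u<..<v} s) = (LINT s|lebesgue_on {a..b}. (if s \<in> {u<..<v} then f s else 0))"
    by (rule Bochner_Integration.integral_cong) (auto simp: indicator_def)
  also have "\<dots> = (LINT s|lebesgue_on {u<..<v}. f s)"
    using uv by (intro integral_restrict) auto
  \<comment> \<open>The end points u and v form a null set. Measurability on the whole line is
    obtained by inserting the indicator of [a,b], which contains both intervals.\<close>
  also have "\<dots> = (LINT s|lebesgue_on {u..v}. f s)"
  proof -
    have "(LINT s|lebesgue_on {u..v}. f s) = (LINT s|lebesgue. indicator {u..v} s * f s)"
      by (simp add: integral_restrict_space)
    also have "\<dots> = (LINT s|lebesgue. indicator {u<..<v} s * f s)"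
    proof (rule integral_cong_AE)
      show "(\<lambda>s. indicator {u..v} s * f s) \<in> borel_measurable lebesgue"
        using integrable_subinterval[OF f, of u v] uv
        by (auto simp: integrable_restrict_space)
      show "(\<lambda>s. indicator {u<..<v} s * f s) \<in> borel_measurable lebesgue"
      proof -
        have "(\<lambda>s. indicator {a..b} s * f s) \<in> borel_measurable lebesgue"
          using f by (auto simp: integrable_restrict_space)
        then have "(\<lambda>s. indicator {u<..<v} s * (indicator {a..b} s * f s)) \<in> borel_measurable lebesgue"
          by (rule borel_measurable_times[OF borel_measurable_indicator, rotated]) simp
        also have "(\<lambda>s. indicator {u<..<v} s * (indicator {a..b} s * f s)) = (\<lambda>s. indicator {u<..<v} s * f s)"
          using uv by (auto simp: indicator_def fun_eq_iff)
        finally show ?thesis .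
      qed
      have "AE s in lebesgue. s \<noteq> u" "AE s in lebesgue. s \<noteq> v"
        by (auto intro!: AE_completion simp: AE_lborel_singleton)
      then show "AE s in lebesgue. indicator {u..v} s * f s = indicator {u<..<v} s * f s"
        by eventually_elim (auto simp: indicator_def)
    qed
    also have "\<dots> = (LINT s|lebesgue_on {u<..<v}. f s)"
      by (simp add: integral_restrict_space)
    finally show ?thesis by simp
  qed
  finally show ?thesis .
qed

text \<open>Take the antiderivative of \<psi> that vanishes at a. It is zero to the left of the
  support; to the right it is constant, and that constant is the integral of \<psi>, which is
  zero.\<close>

lemma ex_test_function_with_deriv:
  assumes \<psi>: "continuous_on UNIV \<psi>" and cd: "a < c" "c < d" "d < b"
    and supp: "\<And>s. s \<notin> {c..d} \<Longrightarrow> \<psi> s = 0"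
    and int: "(LINT s|lebesgue_on {a..b}. \<psi> s) = 0"
  shows "\<exists>\<phi>\<in>test_functions a b. deriv \<phi> = \<psi>"
proof -
  \<comment> \<open>The antiderivative is taken on the whole line, because a test function has to be
    differentiable at every real point.\<close>
  obtain F where "\<forall>x. -\<infinity> < ereal x \<longrightarrow> ereal x < \<infinity> \<longrightarrow> (F has_vector_derivative \<psi> x) (at x)"
    using einterval_antiderivative[of "-\<infinity>" "\<infinity>" \<psi>] \<psi> by (auto simp: continuous_on_eq_continuous_at)
  then have F: "(F has_real_derivative \<psi> x) (at x)" for x
    by (simp add: has_real_derivative_iff_has_vector_derivative)
  define \<phi> where "\<phi> s = F s - F a" for s
  have \<phi>: "(\<phi> has_real_derivative \<psi> x) (at x)" for x
    unfolding \<phi>_def by (auto intro!: derivative_eq_intros F)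
  have "\<phi> s = 0" if "s < c" for s
  proof -
    have "\<exists>k. \<forall>x\<in>{..<c}. F x = k"
    proof (rule has_field_derivative_zero_constant)
      show "(F has_real_derivative 0) (at x within {..<c})" if "x \<in> {..<c}" for x
        using has_field_derivative_at_within[OF F[of x]] supp[of x] that cd by simp
    qed simp
    then show ?thesis using that cd by (auto simp: \<phi>_def)
  qed
  moreover have "\<phi> s = 0" if "s > d" for s
  proof -
    have "\<exists>k. \<forall>x\<in>{d<..}. F x = k"
    proof (rule has_field_derivative_zero_constant)
      show "(F has_real_derivative 0) (at x within {d<..})" if "x \<in> {d<..}" for x
        using has_field_derivative_at_within[OF F[of x]] supp[of x] that cd by simp
    qed simp
    then have "F s = F b" using that cd by auto
    moreover have "(\<psi> has_integral (F b - F a)) {a..b}"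
      using cd F by (intro fundamental_theorem_of_calculus)
        (auto simp: has_real_derivative_iff_has_vector_derivative[symmetric] intro: has_field_derivative_at_within)
    moreover have "integral {a..b} \<psi> = 0"
      using int lebesgue_integral_eq_integral[OF integrable_continuous[OF continuous_on_subset[OF \<psi>]] lebesgue_sets_Icc, of a b] by simp
    ultimately show ?thesis by (auto simp: \<phi>_def dest: integral_unique)
  qed
  ultimately have "\<phi> s = 0" if "s \<notin> {c..d}" for s using that by (auto simp: not_le)
  moreover have "deriv \<phi> = \<psi>" using \<phi> by (auto intro: DERIV_imp_deriv)
  moreover have "\<phi> differentiable (at s)" for s
    using \<phi> real_differentiable_def by blast
  ultimately have "\<phi> \<in> test_functions a b"
    unfolding test_functions_def using \<psi> cd by auto
  with \<open>deriv \<phi> = \<psi>\<close> show ?thesis by blast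
qed

text \<open>Testing with the mean-zero combinations of trapezoids and letting them tend to
  indicators shows that the integral of f over [u,v] is proportional to v - u. Hence f minus its
  mean I / (b - a) has vanishing primitive.\<close>

lemma du_Bois_Reymond:
  assumes ab: "a < b" and f: "integrable (lebesgue_on {a..b}) f"
    and ortho: "\<And>\<phi>. \<phi> \<in> test_functions a b \<Longrightarrow> (LINT s|lebesgue_on {a..b}. f s * deriv \<phi> s) = 0"
  shows "\<exists>c. AE s in lebesgue_on {a..b}. f s = c"
proof -
  define I where "I = (LINT s|lebesgue_on {a..b}. f s)"
  define m where "m u v k = (LINT s|lebesgue_on {a..b}. trapezoid u v k s)" for u v k
  have int_trap: "integrable (lebesgue_on {a..b}) (\<lambda>s. f s * trapezoid u v k s)" for u v k
    using integrable_continuous_mult[OF continuous_on_trapezoid f] by (simp add: mult.commute)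
  have eq: "(b - a) * (LINT s|lebesgue_on {u..v}. f s) = (v - u) * I" if uv: "a \<le> u" "u \<le> v" "v \<le> b" for u v
  proof -
    \<comment> \<open>From this index on a + 1/k < b - 1/k, so that the support is a nondegenerate
      interval, as the definition of test functions demands.\<close>
    obtain N where N: "real N > 2 / (b - a)" using reals_Archimedean2 by blast
    have ev: "m a b k * (LINT s|lebesgue_on {a..b}. f s * trapezoid u v k s)
        = m u v k * (LINT s|lebesgue_on {a..b}. f s * trapezoid a b k s)" if "k \<ge> N" for k
    proof -
      have "0 < 2 / (b - a)" using ab by simp
      moreover have "real N \<le> real k" using that by simp
      ultimately have k: "k > 0" "real k > 2 / (b - a)" using N by (linarith, linarith)
      \<comment> \<open>Each trapezoid is weighted by the mass of the other. The integral of the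
        difference is then zero, without division by a mass.\<close>
      define \<psi> where "\<psi> s = m a b k * trapezoid u v k s - m u v k * trapezoid a b k s" for s
      have "\<exists>\<phi>\<in>test_functions a b. deriv \<phi> = \<psi>"
      proof (rule ex_test_function_with_deriv)
        show "continuous_on UNIV \<psi>" unfolding \<psi>_def[abs_def]
          by (intro continuous_intros continuous_on_trapezoid)
        show "a < a + 1 / real k" "b - 1 / real k < b" using k by auto
        have "2 / real k < b - a" using k ab by (simp add: field_simps)
        then show "a + 1 / real k < b - 1 / real k" by simp
        show "\<psi> s = 0" if "s \<notin> {a + 1 / real k..b - 1 / real k}" for s
        proof -
          have "s \<notin> {u + 1 / real k..v - 1 / real k}" using that uv by auto
          then show ?thesis using that k by (simp add: \<psi>_def trapezoid_eq_0)
        qed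
        show "(LINT s|lebesgue_on {a..b}. \<psi> s) = 0"
          unfolding \<psi>_def
          by (simp add: integrable_continuous continuous_on_trapezoid m_def)
      qed
      then have "(LINT s|lebesgue_on {a..b}. f s * \<psi> s) = 0" using ortho by auto
      moreover have "(\<lambda>s. f s * \<psi> s) = (\<lambda>s. m a b k * (f s * trapezoid u v k s) - m u v k * (f s * trapezoid a b k s))"
        by (auto simp: \<psi>_def algebra_simps)
      ultimately show ?thesis using int_trap by simp
    qed
    have m: "(\<lambda>k. m u' v' k) \<longlonglongrightarrow> v' - u'" if "a \<le> u'" "u' \<le> v'" "v' \<le> b" for u' v'
      using integral_trapezoid_tendsto[OF integrable_const_Icc that(1,3), of 1] that
      by (simp add: m_def[abs_def] measure_restrict_space)
    have "(\<lambda>k. m a b k * (LINT s|lebesgue_on {a..b}. f s * trapezoid u v k s)) \<longlonglongrightarrow> (b - a) * (LINT s|lebesgue_on {u..v}. f s)"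
      using uv ab by (intro tendsto_mult m integral_trapezoid_tendsto f) auto
    moreover have "(\<lambda>k. m u v k * (LINT s|lebesgue_on {a..b}. f s * trapezoid a b k s)) \<longlonglongrightarrow> (v - u) * I"
      unfolding I_def using uv ab by (intro tendsto_mult m integral_trapezoid_tendsto f) auto
    then have "(\<lambda>k. m a b k * (LINT s|lebesgue_on {a..b}. f s * trapezoid u v k s)) \<longlonglongrightarrow> (v - u) * I"
      by (rule Lim_transform_eventually) (use ev in \<open>auto simp: eventually_sequentially intro!: exI[of _ N]\<close>)
    ultimately show ?thesis by (rule LIMSEQ_unique)
  qed
  have "AE s in lebesgue_on {a..b}. f s - I / (b - a) = 0"
  proof (rule AE_zero_if_primitive_zero)
    show "integrable (lebesgue_on {a..b}) (\<lambda>s. f s - I / (b - a))"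
      using f integrable_const_Icc by auto
    fix x assume x: "x \<in> {a..b}"
    have "integrable (lebesgue_on {a..x}) f" using x by (intro integrable_subinterval[OF f]) auto
    then have "primitive a (\<lambda>s. f s - I / (b - a)) x = (LINT s|lebesgue_on {a..x}. f s) - (x - a) * (I / (b - a))"
      unfolding primitive_def using x integrable_const_Icc
      by (subst Bochner_Integration.integral_diff) (auto simp: measure_restrict_space)
    also have "\<dots> = 0" using eq[of a x] x ab by (simp add: field_simps)
    finally show "primitive a (\<lambda>s. f s - I / (b - a)) x = 0" .
  qed
  then show ?thesis by (intro exI[of _ "I / (b - a)"]) simp
qed

section \<open>Weak derivatives of primitives, uniqueness and representation\<close>

lemma test_function_boundary:
  assumes "\<phi> \<in> test_functions a b"
  shows "\<phi> a = 0" "\<phi> b = 0"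
proof -
  obtain c d where "a < c" "c < d" "d < b" "\<And>s. s \<notin> {c..d} \<Longrightarrow> \<phi> s = 0"
    using assms by (auto simp: test_functions_def)
  then show "\<phi> a = 0" "\<phi> b = 0" by auto
qed

lemma test_function_continuous:
  assumes "\<phi> \<in> test_functions a b"
  shows "continuous_on S \<phi>" "continuous_on S (deriv \<phi>)"
proof -
  have "\<And>s. \<phi> differentiable (at s)" using assms by (auto simp: test_functions_def)
  then show "continuous_on S \<phi>"
    by (meson continuous_at_imp_continuous_on differentiable_imp_continuous_within)
  show "continuous_on S (deriv \<phi>)"
    using assms by (auto simp: test_functions_def intro: continuous_on_subset)
qed

lemma integral_deriv_test_function:
  assumes \<phi>: "\<phi> \<in> test_functions a b" and le: "u \<le> v"
  shows "(LINT s|lebesgue_on {u..v}. deriv \<phi> s) = \<phi> v - \<phi> u"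
proof -
  have "(deriv \<phi> has_integral (\<phi> v - \<phi> u)) {u..v}"
  proof (rule fundamental_theorem_of_calculus[OF le])
    fix x
    have "\<phi> differentiable (at x)" using \<phi> by (auto simp: test_functions_def)
    then have "(\<phi> has_real_derivative deriv \<phi> x) (at x)"
      using DERIV_deriv_iff_real_differentiable by blast
    then show "(\<phi> has_vector_derivative deriv \<phi> x) (at x within {u..v})"
      by (auto simp: has_real_derivative_iff_has_vector_derivative[symmetric] intro: has_field_derivative_at_within)
  qed
  then show ?thesis
    using lebesgue_integral_eq_integral[OF integrable_continuous[OF test_function_continuous(2)[OF \<phi>]] lebesgue_sets_Icc]
    by (simp add: integral_unique)
qed

text \<open>After exchanging the integrals the inner one is that of the derivative of \<phi> over
  [\<theta>, b], which equals -\<phi>(\<theta>) since \<phi>(b) = 0. The constant c drops out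
  because \<phi> vanishes at both ends.\<close>

lemma is_weak_deriv_primitive:
  assumes ab: "a < b" and g: "integrable (lebesgue_on {a..b}) g"
  shows "is_weak_deriv a b (\<lambda>s. c + primitive a g s) g"
  unfolding is_weak_deriv_def
proof
  fix \<phi> assume \<phi>: "\<phi> \<in> test_functions a b"
  have i: "integrable (lebesgue_on {a..b}) (deriv \<phi>)"
    using test_function_continuous[OF \<phi>] by (intro integrable_continuous)
  have "(LINT s|lebesgue_on {a..b}. (c + primitive a g s) * deriv \<phi> s)
      = c * (LINT s|lebesgue_on {a..b}. deriv \<phi> s) + (LINT s|lebesgue_on {a..b}. primitive a g s * deriv \<phi> s)"
    unfolding distrib_right
    by (subst Bochner_Integration.integral_add)
       (auto intro!: integrable_continuous_mult[OF continuous_on_primitive[OF g] i] i)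
  also have "(LINT s|lebesgue_on {a..b}. deriv \<phi> s) = 0"
    using integral_deriv_test_function[OF \<phi>, of a b] ab test_function_boundary[OF \<phi>] by simp
  also have "(LINT s|lebesgue_on {a..b}. primitive a g s * deriv \<phi> s)
     = (LINT \<theta>|lebesgue_on {a..b}. g \<theta> * (LINT s|lebesgue_on {\<theta>..b}. deriv \<phi> s))"
    by (rule integral_primitive_mult[OF g i])
  also have "\<dots> = (LINT \<theta>|lebesgue_on {a..b}. - (g \<theta> * \<phi> \<theta>))"
    by (rule Bochner_Integration.integral_cong)
       (auto simp: integral_deriv_test_function[OF \<phi>] test_function_boundary[OF \<phi>])
  finally show "(LINT s|lebesgue_on {a..b}. (c + primitive a g s) * deriv \<phi> s) = - (LINT s|lebesgue_on {a..b}. g s * \<phi> s)"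
    by simp
qed

lemma integrable_test_mult:
  assumes "\<phi> \<in> test_functions a b" "integrable (lebesgue_on {a..b}) f"
  shows "integrable (lebesgue_on {a..b}) (\<lambda>s. f s * \<phi> s)" "integrable (lebesgue_on {a..b}) (\<lambda>s. f s * deriv \<phi> s)"
  using integrable_continuous_mult[OF test_function_continuous(1)[OF assms(1)] assms(2)]
    integrable_continuous_mult[OF test_function_continuous(2)[OF assms(1)] assms(2)]
  by (simp_all add: mult.commute)

lemma is_weak_deriv_diff:
  assumes "is_weak_deriv a b f g" "is_weak_deriv a b f' g'"
    and "integrable (lebesgue_on {a..b}) f" "integrable (lebesgue_on {a..b}) g"
    and "integrable (lebesgue_on {a..b}) f'" "integrable (lebesgue_on {a..b}) g'"
  shows "is_weak_deriv a b (\<lambda>s. f s - f' s) (\<lambda>s. g s - g' s)"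
  using assms unfolding is_weak_deriv_def
  by (simp add: left_diff_distrib integrable_test_mult)

lemma is_weak_deriv_cong_AE:
  assumes w: "is_weak_deriv a b f g"
    and f: "ae_eq a b f f'" and g: "ae_eq a b g g'"
    and m: "f \<in> borel_measurable (lebesgue_on {a..b})" "f' \<in> borel_measurable (lebesgue_on {a..b})"
      "g \<in> borel_measurable (lebesgue_on {a..b})" "g' \<in> borel_measurable (lebesgue_on {a..b})"
  shows "is_weak_deriv a b f' g'"
  unfolding is_weak_deriv_def
proof
  fix \<phi> assume \<phi>: "\<phi> \<in> test_functions a b"
  have [measurable]: "\<phi> \<in> borel_measurable (lebesgue_on {a..b})" "deriv \<phi> \<in> borel_measurable (lebesgue_on {a..b})"
    by (intro continuous_imp_measurable_on_sets_lebesgue test_function_continuous[OF \<phi>] lebesgue_sets_Icc)+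
  note m[measurable]
  have "(LINT s|lebesgue_on {a..b}. f' s * deriv \<phi> s) = (LINT s|lebesgue_on {a..b}. f s * deriv \<phi> s)"
    using f by (intro integral_cong_AE) (auto simp: ae_eq_def)
  also have "\<dots> = - (LINT s|lebesgue_on {a..b}. g s * \<phi> s)"
    using w \<phi> by (simp add: is_weak_deriv_def)
  also have "(LINT s|lebesgue_on {a..b}. g s * \<phi> s) = (LINT s|lebesgue_on {a..b}. g' s * \<phi> s)"
    using g by (intro integral_cong_AE) (auto simp: ae_eq_def)
  finally show "(LINT s|lebesgue_on {a..b}. f' s * deriv \<phi> s) = - (LINT s|lebesgue_on {a..b}. g' s * \<phi> s)" .
qed

text \<open>Inside (a,b) the set where f and g differ is open, and a nonempty open set is not null.
  Continuity extends the equality to the end points, where the boundary values are read off.\<close>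

lemma continuous_ae_eq_imp_eq:
  fixes f g :: "real \<Rightarrow> real"
  assumes ab: "a < b" and f: "continuous_on {a..b} f" and g: "continuous_on {a..b} g"
    and ae: "ae_eq a b f g" and s: "s \<in> {a..b}"
  shows "f s = g s"
proof -
  define k where "k = (\<lambda>s. f s - g s)"
  have k: "continuous_on {a..b} k" unfolding k_def by (intro continuous_intros f g)
  have 0: "k x = 0" if x: "x \<in> {a<..<b}" for x
  proof (rule ccontr)
    assume "k x \<noteq> 0"
    have "open ({a<..<b} \<inter> k -` (- {0}))"
      by (rule continuous_open_preimage[OF continuous_on_subset[OF k]]) auto
    moreover have "x \<in> {a<..<b} \<inter> k -` (- {0})" using x \<open>k x \<noteq> 0\<close> by simp
    ultimately have "\<not> negligible ({a<..<b} \<inter> k -` (- {0}))"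
      using open_not_negligible by blast
    moreover have "AE s in lebesgue. s \<notin> {a<..<b} \<inter> k -` (- {0})"
      using ae by (auto simp: ae_eq_def AE_restrict_space_iff k_def elim!: eventually_mono)
    then have "negligible ({a<..<b} \<inter> k -` (- {0}))"
      using \<open>open _\<close> by (subst negligible_iff_null_sets, subst AE_iff_null_sets) (auto intro: borel_open)
    ultimately show False by blast
  qed
  have "k s = 0"
  proof (rule continuous_constant_on_closure[where S="{a<..<b}" and f=k])
    show "continuous_on (closure {a<..<b}) k" using k ab by simp
    show "s \<in> closure {a<..<b}" using s ab by simp
  qed (use 0 in auto)
  then show ?thesis by (simp add: k_def)
qed

text \<open>The difference h is orthogonal to all test functions, so its primitive is orthogonal to
  all their derivatives and hence constant. The primitive vanishes at a, so the constant is zero,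
  and then h vanishes almost everywhere. In this way du Bois-Reymond replaces an argument by density
  of the test functions.\<close>

lemma weak_deriv_unique:
  assumes ab: "a < b"
    and w: "is_weak_deriv a b f g" "is_weak_deriv a b f g'"
    and i: "integrable (lebesgue_on {a..b}) g" "integrable (lebesgue_on {a..b}) g'"
  shows "ae_eq a b g g'"
proof -
  define h where "h s = g s - g' s" for s
  have h: "integrable (lebesgue_on {a..b}) h" unfolding h_def[abs_def] using i by simp
  have h0: "(LINT s|lebesgue_on {a..b}. h s * \<phi> s) = 0" if "\<phi> \<in> test_functions a b" for \<phi>
    using w that i by (auto simp: is_weak_deriv_def h_def left_diff_distrib integrable_test_mult)
  have P: "integrable (lebesgue_on {a..b}) (primitive a h)"
    by (intro integrable_continuous continuous_on_primitive h)
  have "(LINT s|lebesgue_on {a..b}. primitive a h s * deriv \<phi> s) = 0" if "\<phi> \<in> test_functions a b" for \<phi>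
    using is_weak_deriv_primitive[OF ab h, of 0] h0[OF that] that by (simp add: is_weak_deriv_def)
  then obtain c where "AE s in lebesgue_on {a..b}. primitive a h s = c"
    using du_Bois_Reymond[OF ab P] by blast
  then have c: "primitive a h s = c" if "s \<in> {a..b}" for s
    using that by (intro continuous_ae_eq_imp_eq[OF ab continuous_on_primitive[OF h]]) (auto simp: ae_eq_def)
  then have "primitive a h s = 0" if "s \<in> {a..b}" for s
    using c[of a] c[OF that] ab by simp
  then have "AE s in lebesgue_on {a..b}. h s = 0"
    by (intro AE_zero_if_primitive_zero h)
  then show ?thesis by (simp add: ae_eq_def h_def)
qed

text \<open>Subtracting the primitive of g leaves a function with weak derivative zero, to which du
  Bois-Reymond applies.\<close>

lemma weak_deriv_representation:
  assumes ab: "a < b" and w: "is_weak_deriv a b f g"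
    and i: "integrable (lebesgue_on {a..b}) f" "integrable (lebesgue_on {a..b}) g"
  shows "\<exists>c. ae_eq a b f (\<lambda>s. c + primitive a g s)"
proof -
  have P: "integrable (lebesgue_on {a..b}) (primitive a g)"
    by (intro integrable_continuous continuous_on_primitive i)
  have "is_weak_deriv a b (\<lambda>s. f s - primitive a g s) (\<lambda>s. g s - g s)"
    using is_weak_deriv_primitive[OF ab i(2), of 0] by (intro is_weak_deriv_diff w i P) simp
  then obtain c where "AE s in lebesgue_on {a..b}. f s - primitive a g s = c"
    using i P du_Bois_Reymond[OF ab, of "\<lambda>s. f s - primitive a g s"] by (auto simp: is_weak_deriv_def)
  then have "ae_eq a b f (\<lambda>s. c + primitive a g s)"
    unfolding ae_eq_def by eventually_elim simp
  then show ?thesis by blast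
qed

text \<open>One square-integrable witness g makes the choice in \<open>weak_deriv\<close> a genuine
  weak derivative, and by uniqueness the chosen function is g up to a null set.\<close>

lemma weak_deriv_props:
  assumes ab: "a < b" and w: "is_weak_deriv a b f g" and g: "g \<in> L2 a b"
  shows "weak_deriv a b f \<in> L2 a b" "is_weak_deriv a b f (weak_deriv a b f)" "ae_eq a b (weak_deriv a b f) g"
proof -
  have *: "weak_deriv a b f \<in> L2 a b \<and> is_weak_deriv a b f (weak_deriv a b f)"
    unfolding weak_deriv_def by (rule someI[of _ g]) (use w g in auto)
  then show "weak_deriv a b f \<in> L2 a b" "is_weak_deriv a b f (weak_deriv a b f)" by auto
  show "ae_eq a b (weak_deriv a b f) g"
    using * w g by (intro weak_deriv_unique[OF ab]) (auto intro: L2_integrable)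
qed

lemma ae_eq_sym: "ae_eq a b f g \<Longrightarrow> ae_eq a b g f"
  by (auto simp: ae_eq_def elim!: eventually_mono)

lemma ae_eq_trans: "ae_eq a b f g \<Longrightarrow> ae_eq a b g h \<Longrightarrow> ae_eq a b f h"
  unfolding ae_eq_def by (erule (1) eventually_elim2) simp

lemma ae_eq_pointwise: "(\<And>s. s \<in> {a..b} \<Longrightarrow> f s = g s) \<Longrightarrow> ae_eq a b f g"
  unfolding ae_eq_def by (rule AE_I2) simp

lemma cont_rep_eq:
  assumes ab: "a < b" and h: "continuous_on {a..b} h" and ae: "ae_eq a b f h" and s: "s \<in> {a..b}"
  shows "cont_rep a b f s = h s"
proof -
  have *: "continuous_on {a..b} (cont_rep a b f) \<and> ae_eq a b (cont_rep a b f) f"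
    unfolding cont_rep_def by (rule someI[of _ h]) (use h ae in \<open>auto intro: ae_eq_sym\<close>)
  then show ?thesis
    using h s ae by (intro continuous_ae_eq_imp_eq[OF ab]) (auto intro: ae_eq_trans)
qed

lemma is_weak_deriv_cong:
  assumes "\<And>s. s \<in> {a..b} \<Longrightarrow> f s = f' s" "\<And>s. s \<in> {a..b} \<Longrightarrow> g s = g' s"
  shows "is_weak_deriv a b f g \<longleftrightarrow> is_weak_deriv a b f' g'"
proof -
  have "(LINT s|lebesgue_on {a..b}. f s * deriv \<phi> s) = (LINT s|lebesgue_on {a..b}. f' s * deriv \<phi> s)"
    "(LINT s|lebesgue_on {a..b}. g s * \<phi> s) = (LINT s|lebesgue_on {a..b}. g' s * \<phi> s)" for \<phi>
    by (rule Bochner_Integration.integral_cong; use assms in simp)+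
  then show ?thesis by (simp add: is_weak_deriv_def)
qed

text \<open>This is the exchange of integrals with h = 1: the inner integral is the length s -
  \<theta> of [\<theta>, s]. It identifies the kernel entries s - \<theta> and b - \<theta> with
  twofold integration.\<close>

lemma double_primitive:
  assumes g: "integrable (lebesgue_on {a..b}) g" and s: "s \<in> {a..b}"
  shows "primitive a (primitive a g) s = (LINT \<theta>|lebesgue_on {a..s}. (s - \<theta>) * g \<theta>)"
proof -
  have g': "integrable (lebesgue_on {a..s}) g" using s by (intro integrable_subinterval[OF g]) auto
  have "primitive a (primitive a g) s = (LINT x|lebesgue_on {a..s}. primitive a g x * 1)"
    by (simp add: primitive_def)
  also have "\<dots> = (LINT \<theta>|lebesgue_on {a..s}. g \<theta> * (LINT x|lebesgue_on {\<theta>..s}. 1))"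
    by (rule integral_primitive_mult[OF g' integrable_const_Icc])
  also have "\<dots> = (LINT \<theta>|lebesgue_on {a..s}. (s - \<theta>) * g \<theta>)"
    by (rule Bochner_Integration.integral_cong) (auto simp: measure_restrict_space)
  finally show ?thesis .
qed

lemma primitive_cong_ae:
  assumes "ae_eq a b f g" "integrable (lebesgue_on {a..b}) f" "integrable (lebesgue_on {a..b}) g" "s \<in> {a..b}"
  shows "primitive a f s = primitive a g s"
  unfolding primitive_def
proof (rule integral_cong_AE)
  show "f \<in> borel_measurable (lebesgue_on {a..s})" "g \<in> borel_measurable (lebesgue_on {a..s})"
    using assms by (auto intro!: borel_measurable_integrable integrable_subinterval[of a b])
  show "AE x in lebesgue_on {a..s}. f x = g x"
    using assms by (auto simp: ae_eq_def AE_restrict_space_iff elim!: eventually_mono)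
qed

text \<open>This is Cauchy-Schwarz against the constant 1. It is derived from the nonnegative
  integral of (|g| - m)^2, where m is the mean of |g|.\<close>

lemma primitive_bound:
  assumes g: "g \<in> L2 a b" and s: "s \<in> {a..b}"
  shows "(primitive a g s)\<^sup>2 \<le> (b - a) * (LINT x|lebesgue_on {a..b}. (g x)\<^sup>2)"
proof -
  let ?I = "LINT x|lebesgue_on {a..b}. \<bar>g x\<bar>"
  have i: "integrable (lebesgue_on {a..b}) (\<lambda>x. \<bar>g x\<bar>)" using L2_integrable[OF g] by simp
  have i2: "integrable (lebesgue_on {a..b}) (\<lambda>x. (g x)\<^sup>2)" using g by (simp add: L2_def)
  have "\<bar>primitive a g s\<bar> \<le> (LINT x|lebesgue_on {a..s}. \<bar>g x\<bar>)"
    unfolding primitive_def by (rule integral_abs_bound)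
  also have "\<dots> \<le> ?I"
    using s by (intro integral_mono_lebesgue_on_AE[OF i]) auto
  finally have 1: "\<bar>primitive a g s\<bar> \<le> ?I" .
  show ?thesis
  proof (cases "a < b")
    case True
    define m where "m = ?I / (b - a)"
    have I: "?I = (b - a) * m" using True by (simp add: m_def)
    have "0 \<le> (LINT x|lebesgue_on {a..b}. (\<bar>g x\<bar> - m)\<^sup>2)"
      by (rule Bochner_Integration.integral_nonneg) simp
    also have "(\<lambda>x. (\<bar>g x\<bar> - m)\<^sup>2) = (\<lambda>x. (g x)\<^sup>2 - 2 * m * \<bar>g x\<bar> + m\<^sup>2)"
      by (auto simp: power2_eq_square algebra_simps)
    also have "(LINT x|lebesgue_on {a..b}. (g x)\<^sup>2 - 2 * m * \<bar>g x\<bar> + m\<^sup>2)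
       = (LINT x|lebesgue_on {a..b}. (g x)\<^sup>2) - 2 * m * ?I + (b - a) * m\<^sup>2"
      using i i2 True by (simp add: integrable_const_Icc measure_restrict_space)
    also have "\<dots> = (LINT x|lebesgue_on {a..b}. (g x)\<^sup>2) - (b - a) * m\<^sup>2"
      unfolding I by (simp add: power2_eq_square algebra_simps)
    finally have "(b - a) * ((b - a) * m\<^sup>2) \<le> (b - a) * (LINT x|lebesgue_on {a..b}. (g x)\<^sup>2)"
      using True by (intro mult_left_mono) auto
    then have "?I\<^sup>2 \<le> (b - a) * (LINT x|lebesgue_on {a..b}. (g x)\<^sup>2)"
      unfolding I by (simp add: power2_eq_square mult_ac)
    moreover have "(primitive a g s)\<^sup>2 \<le> ?I\<^sup>2" using 1 by (metis abs_ge_zero power2_abs power_mono)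
    ultimately show ?thesis by linarith
  next
    \<comment> \<open>As s lies in [a,b], the interval is a single point and both sides are
      zero.\<close>
    case False
    then have "s = a" "b = a" using s by auto
    then show ?thesis by simp
  qed
qed

section \<open>Block matrices and vector-valued integrals\<close>

lemma append_rows_mult_vec:
  assumes "dim_col A = dim_vec v" "dim_col C = dim_vec v"
  shows "(A @\<^sub>r C) *\<^sub>v v = (A *\<^sub>v v) @\<^sub>v (C *\<^sub>v v)"
  by (rule mat_mult_append[of _ "dim_row A" "dim_vec v" _ "dim_row C"]) (use assms in auto)

lemma append_cols_mult_vec:
  assumes "dim_row A = dim_row C" "dim_vec x = dim_col A" "dim_vec y = dim_col C"
  shows "(A @\<^sub>c C) *\<^sub>v (x @\<^sub>v y) = A *\<^sub>v x + C *\<^sub>v y"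
proof -
  have "(A @\<^sub>c C) *\<^sub>v (x @\<^sub>v y) = (A *\<^sub>v x + C *\<^sub>v y) @\<^sub>v (0\<^sub>m 0 (dim_col A) *\<^sub>v x + 0\<^sub>m 0 (dim_col C) *\<^sub>v y)"
    unfolding append_cols_def
    by (rule four_block_mat_mult_vec[of _ "dim_row A" "dim_col A" _ "dim_col C" _ 0]) (use assms in \<open>auto intro: carrier_vecI\<close>)
  also have "\<dots> = A *\<^sub>v x + C *\<^sub>v y"
    using assms by (intro eq_vecI) auto
  finally show ?thesis .
qed

lemma dim_append_rows [simp]:
  "dim_row (A @\<^sub>r C) = dim_row A + dim_row C" "dim_col (A @\<^sub>r C) = dim_col A"
  by (simp_all add: append_rows_def)

lemma dim_append_cols [simp]:
  "dim_row (A @\<^sub>c C) = dim_row A" "dim_col (A @\<^sub>c C) = dim_col A + dim_col C"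
  by (simp_all add: append_cols_def)

lemma zero_mat_mult_vec: "dim_vec v = nc \<Longrightarrow> 0\<^sub>m nr nc *\<^sub>v v = 0\<^sub>v nr"
  for v :: "real vec"
  by (intro eq_vecI) (auto simp: scalar_prod_def)

lemma one_mat_mult_vec: "dim_vec v = n \<Longrightarrow> 1\<^sub>m n *\<^sub>v v = v"
  for v :: "real vec"
  by (rule one_mult_mat_vec) (rule carrier_vecI)

lemma smult_mat_mult_vec: "dim_vec v = dim_col A \<Longrightarrow> (k \<cdot>\<^sub>m A) *\<^sub>v v = k \<cdot>\<^sub>v (A *\<^sub>v v)"
  for v :: "real vec"
  by (intro eq_vecI) (auto simp: scalar_prod_def sum_distrib_left mult.assoc)

lemma zero_vec_add: "dim_vec v = n \<Longrightarrow> 0\<^sub>v n + v = v" "dim_vec v = n \<Longrightarrow> v + 0\<^sub>v n = v"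
  for v :: "real vec"
  by (intro eq_vecI; auto)+

text \<open>The block matrices are used through their action on appended vectors. These rules
  evaluate such a product block by block, leaving only conditions on dimensions.\<close>

lemmas block_mult = append_rows_mult_vec append_cols_mult_vec zero_mat_mult_vec one_mat_mult_vec
  smult_mat_mult_vec zero_vec_add

context
  fixes n0 n1 n2 :: nat and x0 x1 x2 :: "real vec"
  assumes x: "dim_vec x0 = n0" "dim_vec x1 = n1" "dim_vec x2 = n2"
begin

lemma Q_mult: "Q_mat b n0 n1 n2 s \<theta> *\<^sub>v (x0 @\<^sub>v x1 @\<^sub>v x2)
    = 0\<^sub>v n1 @\<^sub>v x1 @\<^sub>v 0\<^sub>v n2 @\<^sub>v (b - \<theta>) \<cdot>\<^sub>v x2 @\<^sub>v 0\<^sub>v n2 @\<^sub>v x2"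
  unfolding Q_mat_def by (simp add: block_mult x)

lemma G0_mult: "G0 n0 n1 n2 s *\<^sub>v (x0 @\<^sub>v x1 @\<^sub>v x2) = x0 @\<^sub>v 0\<^sub>v n1 @\<^sub>v 0\<^sub>v n2"
  unfolding G0_def by (simp add: block_mult x)

lemma G3_mult: "G3 n0 n1 n2 s *\<^sub>v (x0 @\<^sub>v x1 @\<^sub>v x2) = x1 @\<^sub>v 0\<^sub>v n2"
  unfolding G3_def by (simp add: block_mult x)

end

lemma T_mult:
  assumes "dim_vec c1 = n1" "dim_vec c2 = n2" "dim_vec c3 = n2"
  shows "T_mat a b n1 n2 *\<^sub>v (c1 @\<^sub>v c2 @\<^sub>v c3)
    = c1 @\<^sub>v c1 @\<^sub>v c2 @\<^sub>v (c2 + (b - a) \<cdot>\<^sub>v c3) @\<^sub>v c3 @\<^sub>v c3"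
  unfolding T_mat_def by (simp add: block_mult assms)

lemma K_mult:
  assumes "dim_vec c1 = n1" "dim_vec c2 = n2" "dim_vec c3 = n2"
  shows "K_mat a n0 n1 n2 s *\<^sub>v (c1 @\<^sub>v c2 @\<^sub>v c3) = 0\<^sub>v n0 @\<^sub>v c1 @\<^sub>v (c2 + (s - a) \<cdot>\<^sub>v c3)"
  unfolding K_mat_def by (simp add: block_mult assms)

lemma V_mult:
  assumes "dim_vec c1 = n1" "dim_vec c2 = n2" "dim_vec c3 = n2"
  shows "V_mat n1 n2 *\<^sub>v (c1 @\<^sub>v c2 @\<^sub>v c3) = 0\<^sub>v n1 @\<^sub>v c3"
  unfolding V_mat_def by (simp add: block_mult assms)

lemma Q_carrier: "Q_mat b n0 n1 n2 s \<theta> \<in> carrier_mat (2 * n1 + 4 * n2) (n0 + n1 + n2)"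
  unfolding Q_mat_def by (intro carrier_matI) simp_all

lemma T_carrier: "T_mat a b n1 n2 \<in> carrier_mat (2 * n1 + 4 * n2) (n1 + 2 * n2)"
  unfolding T_mat_def by (intro carrier_matI) simp_all

lemma K_carrier: "K_mat a n0 n1 n2 s \<in> carrier_mat (n0 + n1 + n2) (n1 + 2 * n2)"
  unfolding K_mat_def by (intro carrier_matI) simp_all

lemma V_carrier: "V_mat n1 n2 \<in> carrier_mat (n1 + n2) (n1 + 2 * n2)"
  unfolding V_mat_def by (intro carrier_matI) simp_all

text \<open>Invertibility makes the matrix a unit of the matrix ring, so \<open>mat_inverse\<close>
  does not return \<open>None\<close> and the value taken by \<open>the\<close> is the two-sided
  inverse.\<close>

lemma BT_inv_props:
  assumes B: "B \<in> carrier_mat (n1 + 2 * n2) (2 * n1 + 4 * n2)"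
    and inv: "invertible_mat (B * T_mat a b n1 n2)"
  shows "BT_inv a b n1 n2 B \<in> carrier_mat (n1 + 2 * n2) (n1 + 2 * n2)"
    "B * T_mat a b n1 n2 * BT_inv a b n1 n2 B = 1\<^sub>m (n1 + 2 * n2)"
    "BT_inv a b n1 n2 B * (B * T_mat a b n1 n2) = 1\<^sub>m (n1 + 2 * n2)"
proof -
  let ?m = "n1 + 2 * n2" and ?A = "B * T_mat a b n1 n2"
  have A: "?A \<in> carrier_mat ?m ?m" using B T_carrier by (rule mult_carrier_mat)
  obtain C where C: "inverts_mat ?A C" "inverts_mat C ?A"
    using inv by (auto simp: invertible_mat_def)
  \<comment> \<open>\<open>inverts_mat\<close> fixes only the size of the identity through the row
    dimension of its first argument; the shape of C is read off by comparing dimensions in these two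
    equations.\<close>
  have C': "?A * C = 1\<^sub>m ?m" "C * ?A = 1\<^sub>m (dim_row C)" using C A by (auto simp: inverts_mat_def)
  have "dim_col C = ?m" using C'(1) by (metis index_mult_mat(3) index_one_mat(3))
  moreover have "dim_row C = ?m" using C'(2) A by (metis carrier_matD(2) index_mult_mat(3) index_one_mat(3))
  ultimately have "C \<in> carrier_mat ?m ?m" by auto
  then have "?A \<in> Units (ring_mat TYPE(real) ?m ())"
    using C' A by (auto simp: Units_def ring_mat_simps)
  then obtain D where D: "mat_inverse ?A = Some D"
    using mat_inverse(1)[OF A, of "()"] by (cases "mat_inverse ?A") auto
  show "BT_inv a b n1 n2 B \<in> carrier_mat ?m ?m" "?A * BT_inv a b n1 n2 B = 1\<^sub>m ?m" "BT_inv a b n1 n2 B * ?A = 1\<^sub>m ?m"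
    using mat_inverse(2)[OF A D] by (simp_all add: BT_inv_def D)
qed

section \<open>Componentwise integration of vector-valued functions\<close>

definition vint :: "nat \<Rightarrow> real \<Rightarrow> real \<Rightarrow> (real \<Rightarrow> real vec) \<Rightarrow> real vec" where
  "vint m u v f = vec m (\<lambda>i. LINT \<theta>|lebesgue_on {u..v}. f \<theta> $ i)"

text \<open>The dimension is part of the notion because components beyond it carry no information;
  it is asked for only on the interval, as in \<open>sobolev_vec\<close>.\<close>

definition vintegrable :: "nat \<Rightarrow> real \<Rightarrow> real \<Rightarrow> (real \<Rightarrow> real vec) \<Rightarrow> bool" where
  "vintegrable m u v f \<longleftrightarrow> (\<forall>\<theta>\<in>{u..v}. dim_vec (f \<theta>) = m) \<and>
     (\<forall>i<m. integrable (lebesgue_on {u..v}) (\<lambda>\<theta>. f \<theta> $ i))"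

lemma dim_vint [simp]: "dim_vec (vint m u v f) = m"
  by (simp add: vint_def)

lemma vint_carrier [simp]: "vint m u v f \<in> carrier_vec m"
  by (simp add: vint_def)

lemma vint_cong: "(\<And>\<theta>. \<theta> \<in> {u..v} \<Longrightarrow> f \<theta> = g \<theta>) \<Longrightarrow> vint m u v f = vint m u v g"
  unfolding vint_def by (intro eq_vecI) (auto intro!: Bochner_Integration.integral_cong)

lemma vintegrable_cong: "(\<And>\<theta>. \<theta> \<in> {u..v} \<Longrightarrow> f \<theta> = g \<theta>) \<Longrightarrow> vintegrable m u v f \<longleftrightarrow> vintegrable m u v g"
  unfolding vintegrable_def by (intro conj_cong ball_cong all_cong1 imp_cong Bochner_Integration.integrable_cong) auto

lemma vintegrable_subinterval:
  "vintegrable m a b f \<Longrightarrow> {u..v} \<subseteq> {a..b} \<Longrightarrow> vintegrable m u v f"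
  unfolding vintegrable_def by (blast intro: integrable_subinterval)

lemma vint_add:
  assumes f: "vintegrable m u v f" and g: "vintegrable m u v g"
  shows "vint m u v (\<lambda>\<theta>. f \<theta> + g \<theta>) = vint m u v f + vint m u v g"
proof (rule eq_vecI)
  fix i assume "i < dim_vec (vint m u v f + vint m u v g)"
  then have i: "i < m" by simp
  have "(LINT \<theta>|lebesgue_on {u..v}. (f \<theta> + g \<theta>) $ i) = (LINT \<theta>|lebesgue_on {u..v}. f \<theta> $ i + g \<theta> $ i)"
    using i f g by (intro Bochner_Integration.integral_cong) (auto simp: vintegrable_def)
  then show "vint m u v (\<lambda>\<theta>. f \<theta> + g \<theta>) $ i = (vint m u v f + vint m u v g) $ i"
    using i f g by (simp add: vint_def vintegrable_def)
qed simp

lemma vintegrable_add: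
  assumes "vintegrable m u v f" "vintegrable m u v g"
  shows "vintegrable m u v (\<lambda>\<theta>. f \<theta> + g \<theta>)"
  unfolding vintegrable_def
proof (intro conjI ballI allI impI)
  fix i assume i: "i < m"
  have "integrable (lebesgue_on {u..v}) (\<lambda>\<theta>. (f \<theta> + g \<theta>) $ i) \<longleftrightarrow> integrable (lebesgue_on {u..v}) (\<lambda>\<theta>. f \<theta> $ i + g \<theta> $ i)"
    using i assms by (intro Bochner_Integration.integrable_cong) (auto simp: vintegrable_def)
  then show "integrable (lebesgue_on {u..v}) (\<lambda>\<theta>. (f \<theta> + g \<theta>) $ i)" using i assms by (auto simp: vintegrable_def)
qed (use assms in \<open>auto simp: vintegrable_def\<close>)

lemma
  assumes C: "C \<in> carrier_mat p m" and f: "vintegrable m u v f"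
  shows vint_mult: "vint p u v (\<lambda>\<theta>. C *\<^sub>v f \<theta>) = C *\<^sub>v vint m u v f"
    and vintegrable_mult: "vintegrable p u v (\<lambda>\<theta>. C *\<^sub>v f \<theta>)"
proof -
  have e: "(C *\<^sub>v f \<theta>) $ i = (\<Sum>j<m. C $$ (i, j) * f \<theta> $ j)" if "i < p" "\<theta> \<in> {u..v}" for i \<theta>
    using that C f by (auto simp: scalar_prod_def vintegrable_def atLeast0LessThan intro!: sum.cong)
  have i: "integrable (lebesgue_on {u..v}) (\<lambda>\<theta>. \<Sum>j<m. C $$ (i, j) * f \<theta> $ j)" for i
    using f by (auto simp: vintegrable_def)
  show "vintegrable p u v (\<lambda>\<theta>. C *\<^sub>v f \<theta>)"
    unfolding vintegrable_def
  proof (intro conjI ballI allI impI)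
    fix k assume k: "k < p"
    have "integrable (lebesgue_on {u..v}) (\<lambda>\<theta>. (C *\<^sub>v f \<theta>) $ k) \<longleftrightarrow> integrable (lebesgue_on {u..v}) (\<lambda>\<theta>. \<Sum>j<m. C $$ (k, j) * f \<theta> $ j)"
      using k by (intro Bochner_Integration.integrable_cong) (auto simp: e)
    then show "integrable (lebesgue_on {u..v}) (\<lambda>\<theta>. (C *\<^sub>v f \<theta>) $ k)" using i by simp
  qed (use C in auto)
  show "vint p u v (\<lambda>\<theta>. C *\<^sub>v f \<theta>) = C *\<^sub>v vint m u v f"
  proof (rule eq_vecI)
    fix k assume "k < dim_vec (C *\<^sub>v vint m u v f)"
    then have k: "k < p" using C by simp
    have "(LINT \<theta>|lebesgue_on {u..v}. (C *\<^sub>v f \<theta>) $ k) = (LINT \<theta>|lebesgue_on {u..v}. (\<Sum>j<m. C $$ (k, j) * f \<theta> $ j))"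
      using k by (intro Bochner_Integration.integral_cong) (auto simp: e)
    also have "\<dots> = (\<Sum>j<m. C $$ (k, j) * (LINT \<theta>|lebesgue_on {u..v}. f \<theta> $ j))"
      using f by (subst Bochner_Integration.integral_sum) (auto simp: vintegrable_def)
    also have "\<dots> = (C *\<^sub>v vint m u v f) $ k"
      using k C by (auto simp: scalar_prod_def vint_def atLeast0LessThan intro!: sum.cong)
    finally show "vint p u v (\<lambda>\<theta>. C *\<^sub>v f \<theta>) $ k = (C *\<^sub>v vint m u v f) $ k"
      using k by (simp add: vint_def)
  qed (use C in auto)
qed

lemma vint_combine:
  assumes f: "vintegrable m a b f" and s: "s \<in> {a..b}"
  shows "vint m a s f + vint m s b f = vint m a b f"
  using f s by (intro eq_vecI) (auto simp: vint_def vintegrable_def integral_Icc_combine)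

lemma vint_append:
  assumes "\<And>\<theta>. \<theta> \<in> {u..v} \<Longrightarrow> dim_vec (f \<theta>) = m"  "\<And>\<theta>. \<theta> \<in> {u..v} \<Longrightarrow> dim_vec (g \<theta>) = k"
  shows "vint (m + k) u v (\<lambda>\<theta>. f \<theta> @\<^sub>v g \<theta>) = vint m u v f @\<^sub>v vint k u v g"
proof (rule eq_vecI)
  fix i assume "i < dim_vec (vint m u v f @\<^sub>v vint k u v g)"
  then have i: "i < m + k" by simp
  have "(LINT \<theta>|lebesgue_on {u..v}. (f \<theta> @\<^sub>v g \<theta>) $ i) = (LINT \<theta>|lebesgue_on {u..v}. (if i < m then f \<theta> $ i else g \<theta> $ (i - m)))"
    using i assms by (intro Bochner_Integration.integral_cong) auto
  then show "vint (m + k) u v (\<lambda>\<theta>. f \<theta> @\<^sub>v g \<theta>) $ i = (vint m u v f @\<^sub>v vint k u v g) $ i"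
    using i by (auto simp: vint_def)
qed simp

lemma vintegrable_append:
  assumes f: "vintegrable m u v f" and g: "vintegrable k u v g"
  shows "vintegrable (m + k) u v (\<lambda>\<theta>. f \<theta> @\<^sub>v g \<theta>)"
  unfolding vintegrable_def
proof (intro conjI ballI allI impI)
  fix i assume i: "i < m + k"
  have "integrable (lebesgue_on {u..v}) (\<lambda>\<theta>. (f \<theta> @\<^sub>v g \<theta>) $ i) \<longleftrightarrow> integrable (lebesgue_on {u..v}) (\<lambda>\<theta>. if i < m then f \<theta> $ i else g \<theta> $ (i - m))"
    using i f g by (intro Bochner_Integration.integrable_cong) (auto simp: vintegrable_def)
  then show "integrable (lebesgue_on {u..v}) (\<lambda>\<theta>. (f \<theta> @\<^sub>v g \<theta>) $ i)" using i f g by (cases "i < m") (auto simp: vintegrable_def)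
qed (use f g in \<open>auto simp: vintegrable_def\<close>)

lemma vint_zero: "vint m u v (\<lambda>_. 0\<^sub>v m) = 0\<^sub>v m"
  by (intro eq_vecI) (auto simp: vint_def)

lemma vintegrable_zero: "vintegrable m u v (\<lambda>_. 0\<^sub>v m)"
  by (auto simp: vintegrable_def)

lemma PI_op_eq:
  "PI_op a b n N0 N1 N2 x s = N0 s *\<^sub>v x s + vint n a s (\<lambda>\<theta>. N1 s \<theta> *\<^sub>v x \<theta>) + vint n s b (\<lambda>\<theta>. N2 s \<theta> *\<^sub>v x \<theta>)"
  by (simp add: PI_op_def vint_def)

section \<open>The operator and the generator in integrated form\<close>

abbreviation coord :: "(real \<Rightarrow> real vec) \<Rightarrow> nat \<Rightarrow> real \<Rightarrow> real" where
  "coord z k \<equiv> (\<lambda>s. z s $ k)"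

lemma L2_vec_iff: "z \<in> L2_vec a b m \<longleftrightarrow> (\<forall>s\<in>{a..b}. dim_vec (z s) = m) \<and> (\<forall>k<m. coord z k \<in> L2 a b)"
  by (auto simp: sobolev_vec_def intro: carrier_vecI)

lemma vec_parts:
  assumes "dim_vec (z s) = n0 + n1 + n2"
  shows "z s = part0 n0 z s @\<^sub>v part1 n0 n1 z s @\<^sub>v part2 n0 n1 n2 z s"
  using assms by (intro eq_vecI) (auto simp: part0_def part1_def part2_def)

lemma dim_parts [simp]:
  "dim_vec (part0 n0 z s) = n0" "dim_vec (part1 n0 n1 z s) = n1" "dim_vec (part2 n0 n1 n2 z s) = n2"
  by (auto simp: part0_def part1_def part2_def)

lemma primitive_eq_vint: "i < m \<Longrightarrow> vint m a s f $ i = primitive a (coord f i) s"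
  by (simp add: vint_def primitive_def)

lemma L2_integrable_coord: "z \<in> L2_vec a b m \<Longrightarrow> k < m \<Longrightarrow> integrable (lebesgue_on {a..b}) (coord z k)"
  by (auto simp: L2_vec_iff intro: L2_integrable)

lemma vintegrable_scaled:
  assumes h: "continuous_on {u..v} h" and f: "vintegrable m u v f"
  shows "vintegrable m u v (\<lambda>\<theta>. h \<theta> \<cdot>\<^sub>v f \<theta>)"
  unfolding vintegrable_def
proof (intro conjI allI impI ballI)
  fix i assume i: "i < m"
  have "integrable (lebesgue_on {u..v}) (\<lambda>\<theta>. (h \<theta> \<cdot>\<^sub>v f \<theta>) $ i) \<longleftrightarrow> integrable (lebesgue_on {u..v}) (\<lambda>\<theta>. h \<theta> * f \<theta> $ i)"
    using i f by (intro Bochner_Integration.integrable_cong) (auto simp: vintegrable_def)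
  then show "integrable (lebesgue_on {u..v}) (\<lambda>\<theta>. (h \<theta> \<cdot>\<^sub>v f \<theta>) $ i)"
    using i f integrable_continuous_mult[OF h] by (auto simp: vintegrable_def)
qed (use f in \<open>auto simp: vintegrable_def\<close>)

lemma vint_scaled:
  assumes f: "vintegrable m a b f" and s: "s \<in> {a..b}"
  shows "vint m a s (\<lambda>\<theta>. (s - \<theta>) \<cdot>\<^sub>v f \<theta>) = vec m (\<lambda>j. primitive a (primitive a (coord f j)) s)"
proof (rule eq_vecI)
  fix i assume "i < dim_vec (vec m (\<lambda>j. primitive a (primitive a (coord f j)) s))"
  then have i: "i < m" by simp
  have "(LINT \<theta>|lebesgue_on {a..s}. ((s - \<theta>) \<cdot>\<^sub>v f \<theta>) $ i) = (LINT \<theta>|lebesgue_on {a..s}. (s - \<theta>) * f \<theta> $ i)"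
    using i f s by (intro Bochner_Integration.integral_cong) (auto simp: vintegrable_def)
  also have "\<dots> = primitive a (primitive a (coord f i)) s"
    using i f s by (intro double_primitive[symmetric]) (auto simp: vintegrable_def)
  finally show "vint m a s (\<lambda>\<theta>. (s - \<theta>) \<cdot>\<^sub>v f \<theta>) $ i = vec m (\<lambda>j. primitive a (primitive a (coord f j)) s) $ i"
    using i by (simp add: vint_def)
qed simp

lemma primitive_cong: "(\<And>\<theta>. \<theta> \<in> {a..s} \<Longrightarrow> f \<theta> = g \<theta>) \<Longrightarrow> primitive a f s = primitive a g s"
  unfolding primitive_def by (rule Bochner_Integration.integral_cong) auto

locale boundary_value =
  fixes a b :: real and n0 n1 n2 :: nat and B :: "real mat"
  assumes ab: "a < b"
    and B: "B \<in> carrier_mat (n1 + 2 * n2) (2 * n1 + 4 * n2)"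
    and inv: "invertible_mat (B * T_mat a b n1 n2)"
begin

abbreviation n :: nat where "n \<equiv> n0 + n1 + n2"

abbreviation state_map :: "(real \<Rightarrow> real vec) \<Rightarrow> real \<Rightarrow> real vec" where
  "state_map \<equiv> PI_op a b n (G0 n0 n1 n2) (G1 a b n0 n1 n2 B) (G2 a b n0 n1 n2 B)"

abbreviation BT_inverse :: "real mat" where "BT_inverse \<equiv> BT_inv a b n1 n2 B"

lemmas BT_inverse = BT_inv_props[OF B inv]

text \<open>\<open>jump z\<close> is the integral of \<open>Q(s,\<theta>) z(\<theta>)\<close> over \<open>[a,b]\<close> (which does not depend on \<open>s\<close>), written with
  iterated primitives, and \<open>left_values z\<close> is the vector of the values \<open>x\<^sub>1(a), x\<^sub>2(a), \<partial>x\<^sub>2(a)\<close> that the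
  boundary condition imposes on the function with highest derivatives \<open>z\<close>.\<close>

definition jump :: "(real \<Rightarrow> real vec) \<Rightarrow> real vec" where
  "jump z = 0\<^sub>v n1 @\<^sub>v vec n1 (\<lambda>i. primitive a (coord z (n0 + i)) b) @\<^sub>v 0\<^sub>v n2
     @\<^sub>v vec n2 (\<lambda>j. primitive a (primitive a (coord z (n0 + n1 + j))) b) @\<^sub>v 0\<^sub>v n2
     @\<^sub>v vec n2 (\<lambda>j. primitive a (coord z (n0 + n1 + j)) b)"

definition left_values :: "(real \<Rightarrow> real vec) \<Rightarrow> real vec" where
  "left_values z = - (BT_inverse *\<^sub>v (B *\<^sub>v jump z))"

lemma dim_jump [simp]: "dim_vec (jump z) = 2 * n1 + 4 * n2"
  by (simp add: jump_def)

lemma jump_carrier: "jump z \<in> carrier_vec (2 * n1 + 4 * n2)"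
  by (rule carrier_vecI) simp

lemma dim_left_values [simp]: "dim_vec (left_values z) = n1 + 2 * n2"
  using BT_inverse(1) by (simp add: left_values_def)

lemma left_values_split:
  "left_values z = vec n1 (\<lambda>i. left_values z $ i) @\<^sub>v vec n2 (\<lambda>j. left_values z $ (n1 + j))
     @\<^sub>v vec n2 (\<lambda>j. left_values z $ (n1 + n2 + j))"
  by (rule eq_vecI) auto

lemma vintegrable_parts:
  assumes "z \<in> L2_vec a b n"
  shows "vintegrable n1 a b (part1 n0 n1 z)" "vintegrable n2 a b (part2 n0 n1 n2 z)"
  using L2_integrable_coord[OF assms] by (auto simp: vintegrable_def part1_def part2_def)

lemma vint_part1: "vint n1 a s (part1 n0 n1 z) = vec n1 (\<lambda>i. primitive a (coord z (n0 + i)) s)"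
  by (rule eq_vecI) (auto simp: primitive_eq_vint part1_def intro!: primitive_cong)

lemma vint_part2: "vint n2 a s (part2 n0 n1 n2 z) = vec n2 (\<lambda>j. primitive a (coord z (n0 + n1 + j)) s)"
  by (rule eq_vecI) (auto simp: primitive_eq_vint part2_def intro!: primitive_cong)

lemma vint_scaled_part2:
  assumes z: "z \<in> L2_vec a b n" and s: "s \<in> {a..b}"
  shows "vint n2 a s (\<lambda>\<theta>. (s - \<theta>) \<cdot>\<^sub>v part2 n0 n1 n2 z \<theta>) = vec n2 (\<lambda>j. primitive a (primitive a (coord z (n0 + n1 + j))) s)"
  unfolding vint_scaled[OF vintegrable_parts(2)[OF z] s]
  by (rule eq_vecI) (auto simp: part2_def)

lemma
  assumes z: "z \<in> L2_vec a b n"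
  shows vintegrable_Q: "vintegrable (2 * n1 + 4 * n2) a b (\<lambda>\<theta>. Q_mat b n0 n1 n2 s \<theta> *\<^sub>v z \<theta>)"
    and vint_Q: "vint (2 * n1 + 4 * n2) a b (\<lambda>\<theta>. Q_mat b n0 n1 n2 s \<theta> *\<^sub>v z \<theta>) = jump z"
proof -
  let ?x1 = "part1 n0 n1 z" and ?x2 = "part2 n0 n1 n2 z"
  let ?f = "\<lambda>\<theta>. 0\<^sub>v n1 @\<^sub>v ?x1 \<theta> @\<^sub>v 0\<^sub>v n2 @\<^sub>v (b - \<theta>) \<cdot>\<^sub>v ?x2 \<theta> @\<^sub>v 0\<^sub>v n2 @\<^sub>v ?x2 \<theta>"
  have Q: "Q_mat b n0 n1 n2 s \<theta> *\<^sub>v z \<theta> = ?f \<theta>" if "\<theta> \<in> {a..b}" for \<theta>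
    using z that by (subst vec_parts[of z \<theta> n0 n1 n2]) (auto simp: L2_vec_iff Q_mult)
  \<comment> \<open>The dimension is bracketed like the right-nested \<open>@\<^sub>v\<close>, so
    that \<open>vintegrable_append\<close> and \<open>vint_append\<close> split off one block at a
    time.\<close>
  have m: "2 * n1 + 4 * n2 = n1 + (n1 + (n2 + (n2 + (n2 + n2))))" by simp
  have "continuous_on {a..b} (\<lambda>\<theta>. b - \<theta>)" by (intro continuous_intros)
  then have "vintegrable (2 * n1 + 4 * n2) a b ?f"
    unfolding m by (intro vintegrable_append vintegrable_zero vintegrable_parts[OF z] vintegrable_scaled)
  then show "vintegrable (2 * n1 + 4 * n2) a b (\<lambda>\<theta>. Q_mat b n0 n1 n2 s \<theta> *\<^sub>v z \<theta>)"
    using vintegrable_cong[OF Q] by simp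
  have "vint (2 * n1 + 4 * n2) a b (\<lambda>\<theta>. Q_mat b n0 n1 n2 s \<theta> *\<^sub>v z \<theta>) = vint (2 * n1 + 4 * n2) a b ?f"
    by (rule vint_cong[OF Q])
  also have "\<dots> = jump z"
    unfolding m using vint_scaled_part2[OF z, of b] ab
    by (simp add: vint_append vint_zero vint_part1 vint_part2 jump_def)
  finally show "vint (2 * n1 + 4 * n2) a b (\<lambda>\<theta>. Q_mat b n0 n1 n2 s \<theta> *\<^sub>v z \<theta>) = jump z" .
qed

lemma uminus_BT_inverse_mult:
  assumes C: "C \<in> carrier_mat p (n1 + 2 * n2)"
  shows "- (C * BT_inverse * B) *\<^sub>v jump z = C *\<^sub>v left_values z"
proof -
  have CR: "C * BT_inverse \<in> carrier_mat p (n1 + 2 * n2)" using C BT_inverse(1) by (rule mult_carrier_mat)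
  have Bj: "B *\<^sub>v jump z \<in> carrier_vec (n1 + 2 * n2)" using B jump_carrier by (rule mult_mat_vec_carrier)
  have "- (C * BT_inverse * B) *\<^sub>v jump z = - ((C * BT_inverse * B) *\<^sub>v jump z)"
    using B by (intro uminus_mult_mat_vec) simp
  also have "(C * BT_inverse * B) *\<^sub>v jump z = C *\<^sub>v (BT_inverse *\<^sub>v (B *\<^sub>v jump z))"
    using assoc_mult_mat_vec[OF CR B jump_carrier] assoc_mult_mat_vec[OF C BT_inverse(1) Bj] by simp
  also have "- \<dots> = C *\<^sub>v left_values z"
    unfolding left_values_def using C BT_inverse(1)
    by (intro eq_vecI) auto
  finally show ?thesis .
qed

lemma uminus_mult_Q:
  assumes C: "C \<in> carrier_mat p (n1 + 2 * n2)" and v: "dim_vec v = n"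
  shows "- (C * BT_inverse * B * Q_mat b n0 n1 n2 s \<theta>) *\<^sub>v v = - (C * BT_inverse * B) *\<^sub>v (Q_mat b n0 n1 n2 s \<theta> *\<^sub>v v)"
proof -
  have CRB: "C * BT_inverse * B \<in> carrier_mat p (2 * n1 + 4 * n2)"
    using mult_carrier_mat[OF mult_carrier_mat[OF C BT_inverse(1)] B] .
  have "- (C * BT_inverse * B * Q_mat b n0 n1 n2 s \<theta>) *\<^sub>v v = - ((C * BT_inverse * B * Q_mat b n0 n1 n2 s \<theta>) *\<^sub>v v)"
    using v Q_carrier[of b n0 n1 n2 s \<theta>] by (intro uminus_mult_mat_vec) simp
  also have "(C * BT_inverse * B * Q_mat b n0 n1 n2 s \<theta>) *\<^sub>v v = (C * BT_inverse * B) *\<^sub>v (Q_mat b n0 n1 n2 s \<theta> *\<^sub>v v)"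
    using carrier_vecI[OF v] by (rule assoc_mult_mat_vec[OF CRB Q_carrier])
  also have "- \<dots> = - (C * BT_inverse * B) *\<^sub>v (Q_mat b n0 n1 n2 s \<theta> *\<^sub>v v)"
    using Q_carrier[of b n0 n1 n2 s \<theta>] B by (intro uminus_mult_mat_vec[symmetric]) simp
  finally show ?thesis .
qed

text \<open>The kernel pairs of the state and of its slope share one shape: N2 acts on both sides of
  s and D only below s. The two integrals of N2 thus combine to one over [a,b], which is -C (BT)^-1
  B applied to \<open>jump z\<close>, that is, C applied to the values at a. C will be K for the
  state and V for the slope.\<close>

lemma vint_split:
  assumes z: "z \<in> L2_vec a b n" and s: "s \<in> {a..b}"
    and C: "C \<in> carrier_mat p (n1 + 2 * n2)"
    and N2: "\<And>\<theta>. N2 \<theta> = - (C * BT_inverse * B * Q_mat b n0 n1 n2 s \<theta>)"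
    and N1: "\<And>\<theta>. N1 \<theta> = D \<theta> + N2 \<theta>"
    and D: "\<And>\<theta>. D \<theta> \<in> carrier_mat p n"
    and d: "\<And>\<theta>. \<theta> \<in> {a..b} \<Longrightarrow> D \<theta> *\<^sub>v z \<theta> = d \<theta>" "vintegrable p a b d"
  shows "vint p a s (\<lambda>\<theta>. N1 \<theta> *\<^sub>v z \<theta>) + vint p s b (\<lambda>\<theta>. N2 \<theta> *\<^sub>v z \<theta>) = vint p a s d + C *\<^sub>v left_values z"
    and "vintegrable p a b (\<lambda>\<theta>. N1 \<theta> *\<^sub>v z \<theta>)" "vintegrable p a b (\<lambda>\<theta>. N2 \<theta> *\<^sub>v z \<theta>)"
proof -
  let ?E = "- (C * BT_inverse * B)" and ?m = "2 * n1 + 4 * n2"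
  let ?q = "\<lambda>\<theta>. Q_mat b n0 n1 n2 s \<theta> *\<^sub>v z \<theta>"
  have E: "?E \<in> carrier_mat p ?m"
    using mult_carrier_mat[OF mult_carrier_mat[OF C BT_inverse(1)] B] by simp
  have dim: "dim_vec (z \<theta>) = n" if "\<theta> \<in> {a..b}" for \<theta> using z that by (auto simp: L2_vec_iff)
  have N2c: "N2 \<theta> \<in> carrier_mat p n" for \<theta>
    unfolding N2 using mult_carrier_mat[OF mult_carrier_mat[OF mult_carrier_mat[OF C BT_inverse(1)] B] Q_carrier] by simp
  have N2z: "N2 \<theta> *\<^sub>v z \<theta> = ?E *\<^sub>v ?q \<theta>" if "\<theta> \<in> {a..b}" for \<theta>
    unfolding N2 by (rule uminus_mult_Q[OF C dim[OF that]])
  have N1z: "N1 \<theta> *\<^sub>v z \<theta> = d \<theta> + ?E *\<^sub>v ?q \<theta>" if "\<theta> \<in> {a..b}" for \<theta>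
    unfolding N1 using add_mult_distrib_mat_vec[OF D N2c carrier_vecI[OF dim[OF that]]] N2z[OF that] d(1)[OF that] by simp
  have q: "vintegrable ?m a b ?q" by (rule vintegrable_Q[OF z])
  have sub: "{a..s} \<subseteq> {a..b}" "{s..b} \<subseteq> {a..b}" using s by auto
  have Eq: "vintegrable p a b (\<lambda>\<theta>. ?E *\<^sub>v ?q \<theta>)" by (rule vintegrable_mult[OF E q])
  show "vintegrable p a b (\<lambda>\<theta>. N2 \<theta> *\<^sub>v z \<theta>)" using vintegrable_cong[OF N2z] Eq by simp
  show "vintegrable p a b (\<lambda>\<theta>. N1 \<theta> *\<^sub>v z \<theta>)"
    using vintegrable_cong[OF N1z] vintegrable_add[OF d(2) Eq] by simp
  have "vint p a s (\<lambda>\<theta>. N1 \<theta> *\<^sub>v z \<theta>) = vint p a s (\<lambda>\<theta>. d \<theta> + ?E *\<^sub>v ?q \<theta>)"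
    using sub by (intro vint_cong N1z) auto
  also have "\<dots> = vint p a s d + vint p a s (\<lambda>\<theta>. ?E *\<^sub>v ?q \<theta>)"
    by (intro vint_add vintegrable_subinterval[OF _ sub(1)] d Eq)
  finally have "vint p a s (\<lambda>\<theta>. N1 \<theta> *\<^sub>v z \<theta>) + vint p s b (\<lambda>\<theta>. N2 \<theta> *\<^sub>v z \<theta>)
    = (vint p a s d + vint p a s (\<lambda>\<theta>. ?E *\<^sub>v ?q \<theta>)) + vint p s b (\<lambda>\<theta>. ?E *\<^sub>v ?q \<theta>)"
    using sub vint_cong[of s b "\<lambda>\<theta>. N2 \<theta> *\<^sub>v z \<theta>" "\<lambda>\<theta>. ?E *\<^sub>v ?q \<theta>" p] N2z by auto
  also have "\<dots> = vint p a s d + (vint p a s (\<lambda>\<theta>. ?E *\<^sub>v ?q \<theta>) + vint p s b (\<lambda>\<theta>. ?E *\<^sub>v ?q \<theta>))"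
    by (rule assoc_add_vec[of _ p]) auto
  also have "vint p a s (\<lambda>\<theta>. ?E *\<^sub>v ?q \<theta>) + vint p s b (\<lambda>\<theta>. ?E *\<^sub>v ?q \<theta>) = C *\<^sub>v left_values z"
    unfolding vint_combine[OF Eq s] vint_mult[OF E q] vint_Q[OF z] by (rule uminus_BT_inverse_mult[OF C])
  finally show "vint p a s (\<lambda>\<theta>. N1 \<theta> *\<^sub>v z \<theta>) + vint p s b (\<lambda>\<theta>. N2 \<theta> *\<^sub>v z \<theta>) = vint p a s d + C *\<^sub>v left_values z" .
qed

end

lemma mult_mat_vec_uminus: "dim_vec v = dim_col A \<Longrightarrow> A *\<^sub>v (- v) = - (A *\<^sub>v v)"
  for v :: "real vec"
  by (intro eq_vecI) (auto simp: scalar_prod_def sum_negf)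

section \<open>Taylor formulas for the operator and its space derivative\<close>

context boundary_value
begin

text \<open>\<open>state1\<close>, \<open>slope2\<close> and \<open>state2\<close> are x1, the
  derivative of x2, and x2, rebuilt by Taylor's formula from the highest derivatives z and from the
  values at a. The vector c lists those values as x1(a), x2(a) and the derivative of x2 at a, in
  blocks of length n1, n2, n2.\<close>

definition state1 :: "real vec \<Rightarrow> (real \<Rightarrow> real vec) \<Rightarrow> nat \<Rightarrow> real \<Rightarrow> real" where
  "state1 c z i s = c $ i + primitive a (coord z (n0 + i)) s"

definition slope2 :: "real vec \<Rightarrow> (real \<Rightarrow> real vec) \<Rightarrow> nat \<Rightarrow> real \<Rightarrow> real" where
  "slope2 c z j s = c $ (n1 + n2 + j) + primitive a (coord z (n0 + n1 + j)) s"

definition state2 :: "real vec \<Rightarrow> (real \<Rightarrow> real vec) \<Rightarrow> nat \<Rightarrow> real \<Rightarrow> real" where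
  "state2 c z j s = c $ (n1 + j) + (s - a) * c $ (n1 + n2 + j)
     + primitive a (primitive a (coord z (n0 + n1 + j))) s"

lemma K_left_values:
  "K_mat a n0 n1 n2 s *\<^sub>v left_values z = 0\<^sub>v n0 @\<^sub>v vec n1 (\<lambda>i. left_values z $ i)
     @\<^sub>v vec n2 (\<lambda>j. left_values z $ (n1 + j) + (s - a) * left_values z $ (n1 + n2 + j))"
proof -
  have "vec n2 (\<lambda>j. left_values z $ (n1 + j)) + (s - a) \<cdot>\<^sub>v vec n2 (\<lambda>j. left_values z $ (n1 + n2 + j))
    = vec n2 (\<lambda>j. left_values z $ (n1 + j) + (s - a) * left_values z $ (n1 + n2 + j))"
    by (rule eq_vecI) auto
  then show ?thesis by (subst left_values_split) (simp add: K_mult)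
qed

lemma V_left_values:
  "V_mat n1 n2 *\<^sub>v left_values z = 0\<^sub>v n1 @\<^sub>v vec n2 (\<lambda>j. left_values z $ (n1 + n2 + j))"
  by (subst left_values_split) (simp add: V_mult)

text \<open>D contributes the integral remainders and K, applied to the values at a, the Taylor
  polynomials. G0 keeps only the n0 block, since x1 and x2 depend on z through integrals
  alone.\<close>

lemma
  assumes z: "z \<in> L2_vec a b n" and s: "s \<in> {a..b}"
  shows state_map_formula: "state_map z s = part0 n0 z s @\<^sub>v vec n1 (\<lambda>i. state1 (left_values z) z i s) @\<^sub>v vec n2 (\<lambda>j. state2 (left_values z) z j s)"
    and vintegrable_G1: "vintegrable n a b (\<lambda>\<theta>. G1 a b n0 n1 n2 B s \<theta> *\<^sub>v z \<theta>)"
    and vintegrable_G2: "vintegrable n a b (\<lambda>\<theta>. G2 a b n0 n1 n2 B s \<theta> *\<^sub>v z \<theta>)"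
proof -
  let ?x0 = "part0 n0 z" and ?x1 = "part1 n0 n1 z" and ?x2 = "part2 n0 n1 n2 z"
  define D where "D \<theta> = (0\<^sub>m n0 n0 @\<^sub>c 0\<^sub>m n0 n1 @\<^sub>c 0\<^sub>m n0 n2) @\<^sub>r
      (0\<^sub>m n1 n0 @\<^sub>c 1\<^sub>m n1    @\<^sub>c 0\<^sub>m n1 n2) @\<^sub>r
      (0\<^sub>m n2 n0 @\<^sub>c 0\<^sub>m n2 n1 @\<^sub>c (s - \<theta>) \<cdot>\<^sub>m 1\<^sub>m n2)" for \<theta>
  define d where "d \<theta> = 0\<^sub>v n0 @\<^sub>v ?x1 \<theta> @\<^sub>v (s - \<theta>) \<cdot>\<^sub>v ?x2 \<theta>" for \<theta>
  have m: "n = n0 + (n1 + n2)" by simp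
  have D: "D \<theta> \<in> carrier_mat n n" for \<theta> unfolding D_def by (intro carrier_matI) simp_all
  have dz: "dim_vec (z \<theta>) = n" if "\<theta> \<in> {a..b}" for \<theta> using z that by (auto simp: L2_vec_iff)
  have d: "D \<theta> *\<^sub>v z \<theta> = d \<theta>" if "\<theta> \<in> {a..b}" for \<theta>
    using vec_parts[of z \<theta> n0 n1 n2, OF dz[OF that]] unfolding D_def d_def by (simp add: block_mult)
  have "continuous_on {a..b} (\<lambda>\<theta>. s - \<theta>)" by (intro continuous_intros)
  then have id: "vintegrable n a b d"
    unfolding m d_def by (intro vintegrable_append vintegrable_zero vintegrable_parts[OF z] vintegrable_scaled)
  have N2: "G2 a b n0 n1 n2 B s \<theta> = - (K_mat a n0 n1 n2 s * BT_inverse * B * Q_mat b n0 n1 n2 s \<theta>)" for \<theta>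
    by (rule G2_def)
  have N1: "G1 a b n0 n1 n2 B s \<theta> = D \<theta> + G2 a b n0 n1 n2 B s \<theta>" for \<theta>
    unfolding G1_def D_def ..
  note split = vint_split[OF z s K_carrier N2 N1 D d id]
  show "vintegrable n a b (\<lambda>\<theta>. G1 a b n0 n1 n2 B s \<theta> *\<^sub>v z \<theta>)" by (rule split(2))
  show "vintegrable n a b (\<lambda>\<theta>. G2 a b n0 n1 n2 B s \<theta> *\<^sub>v z \<theta>)" by (rule split(3))
  have sum: "vint n a s (\<lambda>\<theta>. G1 a b n0 n1 n2 B s \<theta> *\<^sub>v z \<theta>) + vint n s b (\<lambda>\<theta>. G2 a b n0 n1 n2 B s \<theta> *\<^sub>v z \<theta>)
      = vint n a s d + K_mat a n0 n1 n2 s *\<^sub>v left_values z" by (rule split(1))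
  have vd: "vint n a s d = 0\<^sub>v n0 @\<^sub>v vec n1 (\<lambda>i. primitive a (coord z (n0 + i)) s)
       @\<^sub>v vec n2 (\<lambda>j. primitive a (primitive a (coord z (n0 + n1 + j))) s)"
    unfolding m d_def using vint_scaled_part2[OF z s]
    by (simp add: vint_append vint_zero vint_part1)
  have G0: "G0 n0 n1 n2 s *\<^sub>v z s = ?x0 s @\<^sub>v 0\<^sub>v n1 @\<^sub>v 0\<^sub>v n2"
    by (subst vec_parts[of z s n0 n1 n2, OF dz[OF s]]) (simp add: G0_mult)
  have "state_map z s = G0 n0 n1 n2 s *\<^sub>v z s + (vint n a s (\<lambda>\<theta>. G1 a b n0 n1 n2 B s \<theta> *\<^sub>v z \<theta>)
      + vint n s b (\<lambda>\<theta>. G2 a b n0 n1 n2 B s \<theta> *\<^sub>v z \<theta>))"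
    unfolding PI_op_eq by (rule assoc_add_vec[of _ n]) (auto intro!: carrier_vecI simp: G0)
  also have "\<dots> = ?x0 s @\<^sub>v vec n1 (\<lambda>i. state1 (left_values z) z i s) @\<^sub>v vec n2 (\<lambda>j. state2 (left_values z) z j s)"
    unfolding sum vd G0 K_left_values state1_def state2_def
    by (rule eq_vecI) auto
  finally show "state_map z s = ?x0 s @\<^sub>v vec n1 (\<lambda>i. state1 (left_values z) z i s) @\<^sub>v vec n2 (\<lambda>j. state2 (left_values z) z j s)" .
qed

text \<open>The derivative of x1 is z itself, hence the multiplier G3, whereas the derivative of x2
  is one integration away from z and stays in the kernels G4 and G5.\<close>

lemma
  assumes z: "z \<in> L2_vec a b n" and s: "s \<in> {a..b}"
  shows slope_map_formula: "PI_op a b (n1 + n2) (G3 n0 n1 n2) (G4 a b n0 n1 n2 B) (G5 a b n0 n1 n2 B) z s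
      = part1 n0 n1 z s @\<^sub>v vec n2 (\<lambda>j. slope2 (left_values z) z j s)"
    and vintegrable_G4: "vintegrable (n1 + n2) a b (\<lambda>\<theta>. G4 a b n0 n1 n2 B s \<theta> *\<^sub>v z \<theta>)"
    and vintegrable_G5: "vintegrable (n1 + n2) a b (\<lambda>\<theta>. G5 a b n0 n1 n2 B s \<theta> *\<^sub>v z \<theta>)"
proof -
  let ?x1 = "part1 n0 n1 z" and ?x2 = "part2 n0 n1 n2 z"
  define D where "D \<theta> = (0\<^sub>m n1 n0 @\<^sub>c 0\<^sub>m n1 n1 @\<^sub>c 0\<^sub>m n1 n2) @\<^sub>r
      (0\<^sub>m n2 n0 @\<^sub>c 0\<^sub>m n2 n1 @\<^sub>c 1\<^sub>m n2)" for \<theta> :: real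
  define d where "d \<theta> = 0\<^sub>v n1 @\<^sub>v ?x2 \<theta>" for \<theta>
  have D: "D \<theta> \<in> carrier_mat (n1 + n2) n" for \<theta> unfolding D_def by (intro carrier_matI) simp_all
  have dz: "dim_vec (z \<theta>) = n" if "\<theta> \<in> {a..b}" for \<theta> using z that by (auto simp: L2_vec_iff)
  have d: "D \<theta> *\<^sub>v z \<theta> = d \<theta>" if "\<theta> \<in> {a..b}" for \<theta>
    using vec_parts[of z \<theta> n0 n1 n2, OF dz[OF that]] unfolding D_def d_def by (simp add: block_mult)
  have id: "vintegrable (n1 + n2) a b d"
    unfolding d_def by (intro vintegrable_append vintegrable_zero vintegrable_parts[OF z])
  have N2: "G5 a b n0 n1 n2 B s \<theta> = - (V_mat n1 n2 * BT_inverse * B * Q_mat b n0 n1 n2 s \<theta>)" for \<theta>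
    by (rule G5_def)
  have N1: "G4 a b n0 n1 n2 B s \<theta> = D \<theta> + G5 a b n0 n1 n2 B s \<theta>" for \<theta>
    unfolding G4_def D_def ..
  note split = vint_split[OF z s V_carrier N2 N1 D d id]
  show "vintegrable (n1 + n2) a b (\<lambda>\<theta>. G4 a b n0 n1 n2 B s \<theta> *\<^sub>v z \<theta>)" by (rule split(2))
  show "vintegrable (n1 + n2) a b (\<lambda>\<theta>. G5 a b n0 n1 n2 B s \<theta> *\<^sub>v z \<theta>)" by (rule split(3))
  have sum: "vint (n1 + n2) a s (\<lambda>\<theta>. G4 a b n0 n1 n2 B s \<theta> *\<^sub>v z \<theta>) + vint (n1 + n2) s b (\<lambda>\<theta>. G5 a b n0 n1 n2 B s \<theta> *\<^sub>v z \<theta>)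
      = vint (n1 + n2) a s d + V_mat n1 n2 *\<^sub>v left_values z" by (rule split(1))
  have vd: "vint (n1 + n2) a s d = 0\<^sub>v n1 @\<^sub>v vec n2 (\<lambda>j. primitive a (coord z (n0 + n1 + j)) s)"
    unfolding d_def by (simp add: vint_append vint_zero vint_part2)
  have G3: "G3 n0 n1 n2 s *\<^sub>v z s = ?x1 s @\<^sub>v 0\<^sub>v n2"
    by (subst vec_parts[of z s n0 n1 n2, OF dz[OF s]]) (simp add: G3_mult)
  have "PI_op a b (n1 + n2) (G3 n0 n1 n2) (G4 a b n0 n1 n2 B) (G5 a b n0 n1 n2 B) z s
    = G3 n0 n1 n2 s *\<^sub>v z s + (vint (n1 + n2) a s (\<lambda>\<theta>. G4 a b n0 n1 n2 B s \<theta> *\<^sub>v z \<theta>)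
      + vint (n1 + n2) s b (\<lambda>\<theta>. G5 a b n0 n1 n2 B s \<theta> *\<^sub>v z \<theta>))"
    unfolding PI_op_eq by (rule assoc_add_vec[of _ "n1 + n2"]) (auto intro!: carrier_vecI simp: G3)
  also have "\<dots> = ?x1 s @\<^sub>v vec n2 (\<lambda>j. slope2 (left_values z) z j s)"
    unfolding sum vd G3 V_left_values slope2_def
    by (rule eq_vecI) auto
  finally show "PI_op a b (n1 + n2) (G3 n0 n1 n2) (G4 a b n0 n1 n2 B) (G5 a b n0 n1 n2 B) z s
      = ?x1 s @\<^sub>v vec n2 (\<lambda>j. slope2 (left_values z) z j s)" .
qed

lemma G_carriers:
  "G0 n0 n1 n2 s \<in> carrier_mat n n" "G3 n0 n1 n2 s \<in> carrier_mat (n1 + n2) n"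
  "G2 a b n0 n1 n2 B s \<theta> \<in> carrier_mat n n" "G5 a b n0 n1 n2 B s \<theta> \<in> carrier_mat (n1 + n2) n"
  "G1 a b n0 n1 n2 B s \<theta> \<in> carrier_mat n n" "G4 a b n0 n1 n2 B s \<theta> \<in> carrier_mat (n1 + n2) n"
proof -
  show "G0 n0 n1 n2 s \<in> carrier_mat n n" "G3 n0 n1 n2 s \<in> carrier_mat (n1 + n2) n"
    unfolding G0_def G3_def by (intro carrier_matI; simp)+
  show G2: "G2 a b n0 n1 n2 B s \<theta> \<in> carrier_mat n n" and G5: "G5 a b n0 n1 n2 B s \<theta> \<in> carrier_mat (n1 + n2) n"
    using mult_carrier_mat[OF mult_carrier_mat[OF mult_carrier_mat[OF K_carrier BT_inverse(1)] B] Q_carrier]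
      mult_carrier_mat[OF mult_carrier_mat[OF mult_carrier_mat[OF V_carrier BT_inverse(1)] B] Q_carrier]
    unfolding G2_def G5_def by simp_all
  show "G1 a b n0 n1 n2 B s \<theta> \<in> carrier_mat n n" "G4 a b n0 n1 n2 B s \<theta> \<in> carrier_mat (n1 + n2) n"
    unfolding G1_def G4_def using G2 G5 by (intro add_carrier_mat; simp)+
qed

text \<open>A0(s) and A1(s) do not depend on \<theta>, so they leave the integrals and what remains
  are the operators for the state and for its slope. The second derivative of x2 is a block of z and
  enters through the multiplier alone.\<close>

lemma generator_formula:
  assumes z: "z \<in> L2_vec a b n" and s: "s \<in> {a..b}"
    and A0: "A0 s \<in> carrier_mat n n" and A1: "A1 s \<in> carrier_mat n (n1 + n2)" and A2: "A2 s \<in> carrier_mat n n2"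
    and H0: "H0 s = A0 s * G0 n0 n1 n2 s + A1 s * G3 n0 n1 n2 s + (0\<^sub>m n n0 @\<^sub>c 0\<^sub>m n n1 @\<^sub>c A2 s)"
    and H1: "\<And>\<theta>. H1 s \<theta> = A0 s * G1 a b n0 n1 n2 B s \<theta> + A1 s * G4 a b n0 n1 n2 B s \<theta>"
    and H2: "\<And>\<theta>. H2 s \<theta> = A0 s * G2 a b n0 n1 n2 B s \<theta> + A1 s * G5 a b n0 n1 n2 B s \<theta>"
  shows "PI_op a b n H0 H1 H2 z s = A0 s *\<^sub>v state_map z s
     + A1 s *\<^sub>v (part1 n0 n1 z s @\<^sub>v vec n2 (\<lambda>j. slope2 (left_values z) z j s)) + A2 s *\<^sub>v part2 n0 n1 n2 z s"
proof -
  have dz: "dim_vec (z \<theta>) = n" if "\<theta> \<in> {a..b}" for \<theta> using z that by (auto simp: L2_vec_iff)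
  have zc: "z \<theta> \<in> carrier_vec n" if "\<theta> \<in> {a..b}" for \<theta> using dz[OF that] by (rule carrier_vecI)
  note G = G_carriers[of s] G_carriers
  note mc = mult_carrier_mat[OF A0] mult_carrier_mat[OF A1]
  have lin: "(A0 s * X + A1 s * Y) *\<^sub>v z \<theta> = A0 s *\<^sub>v (X *\<^sub>v z \<theta>) + A1 s *\<^sub>v (Y *\<^sub>v z \<theta>)"
    if "X \<in> carrier_mat n n" "Y \<in> carrier_mat (n1 + n2) n" "\<theta> \<in> {a..b}" for X Y \<theta>
    using add_mult_distrib_mat_vec[OF mc(1)[OF that(1)] mc(2)[OF that(2)] zc[OF that(3)]]
      assoc_mult_mat_vec[OF A0 that(1) zc[OF that(3)]] assoc_mult_mat_vec[OF A1 that(2) zc[OF that(3)]] by simp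
  have A20: "(0\<^sub>m n n0 @\<^sub>c 0\<^sub>m n n1 @\<^sub>c A2 s) *\<^sub>v z s = A2 s *\<^sub>v part2 n0 n1 n2 z s"
    using A2 by (subst vec_parts[of z s n0 n1 n2, OF dz[OF s]]) (simp add: block_mult)
  have A20c: "(0\<^sub>m n n0 @\<^sub>c 0\<^sub>m n n1 @\<^sub>c A2 s) \<in> carrier_mat n n" using A2 by (intro carrier_matI) simp_all
  have h0: "H0 s *\<^sub>v z s = A0 s *\<^sub>v (G0 n0 n1 n2 s *\<^sub>v z s) + A1 s *\<^sub>v (G3 n0 n1 n2 s *\<^sub>v z s) + A2 s *\<^sub>v part2 n0 n1 n2 z s"
    unfolding H0 using add_mult_distrib_mat_vec[OF add_carrier_mat[OF mc(2)[OF G(2)]] A20c zc[OF s]] lin[OF G(1,2) s] A20 by simp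
  have sub: "{a..s} \<subseteq> {a..b}" "{s..b} \<subseteq> {a..b}" using s by auto
  \<comment> \<open>Distributing the integral over the two summands requires the integrability of
    each; this is where the integrability of the products of the kernels with z is used.\<close>
  have h: "vint n u v (\<lambda>\<theta>. (A0 s * X \<theta> + A1 s * Y \<theta>) *\<^sub>v z \<theta>)
      = A0 s *\<^sub>v vint n u v (\<lambda>\<theta>. X \<theta> *\<^sub>v z \<theta>) + A1 s *\<^sub>v vint (n1 + n2) u v (\<lambda>\<theta>. Y \<theta> *\<^sub>v z \<theta>)"
    if X: "\<And>\<theta>. X \<theta> \<in> carrier_mat n n" and Y: "\<And>\<theta>. Y \<theta> \<in> carrier_mat (n1 + n2) n"
      and iX: "vintegrable n a b (\<lambda>\<theta>. X \<theta> *\<^sub>v z \<theta>)" and iY: "vintegrable (n1 + n2) a b (\<lambda>\<theta>. Y \<theta> *\<^sub>v z \<theta>)"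
      and uv: "{u..v} \<subseteq> {a..b}" for X Y u v
  proof -
    note iX' = vintegrable_subinterval[OF iX uv] and iY' = vintegrable_subinterval[OF iY uv]
    have "vint n u v (\<lambda>\<theta>. (A0 s * X \<theta> + A1 s * Y \<theta>) *\<^sub>v z \<theta>)
      = vint n u v (\<lambda>\<theta>. A0 s *\<^sub>v (X \<theta> *\<^sub>v z \<theta>) + A1 s *\<^sub>v (Y \<theta> *\<^sub>v z \<theta>))"
      using uv by (intro vint_cong lin X Y) auto
    also have "\<dots> = vint n u v (\<lambda>\<theta>. A0 s *\<^sub>v (X \<theta> *\<^sub>v z \<theta>)) + vint n u v (\<lambda>\<theta>. A1 s *\<^sub>v (Y \<theta> *\<^sub>v z \<theta>))"
      by (rule vint_add[OF vintegrable_mult[OF A0 iX'] vintegrable_mult[OF A1 iY']])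
    finally show ?thesis unfolding vint_mult[OF A0 iX'] vint_mult[OF A1 iY'] .
  qed
  have distr0: "A0 s *\<^sub>v (x + y + w) = A0 s *\<^sub>v x + A0 s *\<^sub>v y + A0 s *\<^sub>v w"
    if "x \<in> carrier_vec n" "y \<in> carrier_vec n" "w \<in> carrier_vec n" for x y w
    unfolding mult_add_distrib_mat_vec[OF A0 add_carrier_vec[OF that(1,2)] that(3)] mult_add_distrib_mat_vec[OF A0 that(1,2)] ..
  have distr1: "A1 s *\<^sub>v (x + y + w) = A1 s *\<^sub>v x + A1 s *\<^sub>v y + A1 s *\<^sub>v w"
    if "x \<in> carrier_vec (n1 + n2)" "y \<in> carrier_vec (n1 + n2)" "w \<in> carrier_vec (n1 + n2)" for x y w
    unfolding mult_add_distrib_mat_vec[OF A1 add_carrier_vec[OF that(1,2)] that(3)] mult_add_distrib_mat_vec[OF A1 that(1,2)] ..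
  have "PI_op a b n H0 H1 H2 z s = A0 s *\<^sub>v state_map z s
     + A1 s *\<^sub>v PI_op a b (n1 + n2) (G3 n0 n1 n2) (G4 a b n0 n1 n2 B) (G5 a b n0 n1 n2 B) z s + A2 s *\<^sub>v part2 n0 n1 n2 z s"
    unfolding PI_op_eq H1 H2 h0
      h[OF G_carriers(5,6) vintegrable_G1[OF z s] vintegrable_G4[OF z s] sub(1)]
      h[OF G_carriers(3,4) vintegrable_G2[OF z s] vintegrable_G5[OF z s] sub(2)]
      distr0[OF mult_mat_vec_carrier[OF G_carriers(1) zc[OF s]] vint_carrier vint_carrier]
      distr1[OF mult_mat_vec_carrier[OF G_carriers(2) zc[OF s]] vint_carrier vint_carrier]
    using A0 A1 A2 by (intro eq_vecI) auto
  then show ?thesis unfolding slope_map_formula[OF z s] .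
qed

section \<open>The boundary condition as a linear equation for the values at a\<close>

text \<open>Existence half: \<open>BT_inverse\<close> as a right inverse of BT cancels in BT applied
  to \<open>left_values z\<close> and leaves minus B applied to the jump.\<close>

lemma boundary_identity:
  "B *\<^sub>v (T_mat a b n1 n2 *\<^sub>v left_values z + jump z) = 0\<^sub>v (n1 + 2 * n2)"
proof -
  let ?m = "n1 + 2 * n2"
  have Bj: "B *\<^sub>v jump z \<in> carrier_vec ?m" using B jump_carrier by (rule mult_mat_vec_carrier)
  have w: "BT_inverse *\<^sub>v (B *\<^sub>v jump z) \<in> carrier_vec ?m" using BT_inverse(1) Bj by (rule mult_mat_vec_carrier)
  have lv: "left_values z \<in> carrier_vec ?m" by (rule carrier_vecI) simp
  have BT: "B * T_mat a b n1 n2 \<in> carrier_mat ?m ?m" using B T_carrier by (rule mult_carrier_mat)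
  have "B *\<^sub>v (T_mat a b n1 n2 *\<^sub>v left_values z) = (B * T_mat a b n1 n2) *\<^sub>v left_values z"
    using assoc_mult_mat_vec[OF B T_carrier lv] by simp
  also have "\<dots> = - ((B * T_mat a b n1 n2) *\<^sub>v (BT_inverse *\<^sub>v (B *\<^sub>v jump z)))"
    unfolding left_values_def using carrier_matD(2)[OF BT] carrier_vecD[OF w]
    by (intro mult_mat_vec_uminus) (simp del: dim_mult_mat_vec index_mult_mat)
  also have "(B * T_mat a b n1 n2) *\<^sub>v (BT_inverse *\<^sub>v (B *\<^sub>v jump z)) = B *\<^sub>v jump z"
    using assoc_mult_mat_vec[OF BT BT_inverse(1) Bj] BT_inverse(2) Bj by simp
  finally have "B *\<^sub>v (T_mat a b n1 n2 *\<^sub>v left_values z) = - (B *\<^sub>v jump z)" .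
  moreover have "B *\<^sub>v (T_mat a b n1 n2 *\<^sub>v left_values z + jump z)
     = B *\<^sub>v (T_mat a b n1 n2 *\<^sub>v left_values z) + B *\<^sub>v jump z"
    by (rule mult_add_distrib_mat_vec[OF B mult_mat_vec_carrier[OF T_carrier lv] jump_carrier])
  ultimately show ?thesis using Bj by simp
qed

text \<open>Uniqueness half: \<open>BT_inverse\<close> as a left inverse of BT recovers c from BT c
  = -B q, with q the jump.\<close>

lemma boundary_unique:
  assumes c: "c \<in> carrier_vec (n1 + 2 * n2)"
    and 0: "B *\<^sub>v (T_mat a b n1 n2 *\<^sub>v c + jump z) = 0\<^sub>v (n1 + 2 * n2)"
  shows "c = left_values z"
proof -
  let ?m = "n1 + 2 * n2"
  have Bj: "B *\<^sub>v jump z \<in> carrier_vec ?m" using B jump_carrier by (rule mult_mat_vec_carrier)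
  have BT: "B * T_mat a b n1 n2 \<in> carrier_mat ?m ?m" using B T_carrier by (rule mult_carrier_mat)
  have BTc: "(B * T_mat a b n1 n2) *\<^sub>v c \<in> carrier_vec ?m" using BT c by (rule mult_mat_vec_carrier)
  have "(B * T_mat a b n1 n2) *\<^sub>v c + B *\<^sub>v jump z = 0\<^sub>v ?m"
    using 0 mult_add_distrib_mat_vec[OF B mult_mat_vec_carrier[OF T_carrier c] jump_carrier]
      assoc_mult_mat_vec[OF B T_carrier c] by simp
  then have e: "(B * T_mat a b n1 n2) *\<^sub>v c = - (B *\<^sub>v jump z)"
  proof -
    assume s0: "(B * T_mat a b n1 n2) *\<^sub>v c + B *\<^sub>v jump z = 0\<^sub>v ?m"
    show ?thesis
    proof (rule eq_vecI)
      fix i assume "i < dim_vec (- (B *\<^sub>v jump z))"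
      then have i: "i < ?m" using B by simp
      have "((B * T_mat a b n1 n2) *\<^sub>v c + B *\<^sub>v jump z) $ i = 0" unfolding s0 using i by simp
      moreover have "i < dim_vec ((B * T_mat a b n1 n2) *\<^sub>v c)" "i < dim_vec (B *\<^sub>v jump z)"
        using i carrier_vecD[OF BTc] carrier_vecD[OF Bj] by simp_all
      ultimately show "((B * T_mat a b n1 n2) *\<^sub>v c) $ i = (- (B *\<^sub>v jump z)) $ i"
        by (simp add: eq_neg_iff_add_eq_0 del: index_mult_mat_vec dim_mult_mat_vec)
    qed (use B in simp)
  qed
  have "c = 1\<^sub>m ?m *\<^sub>v c" using c by simp
  also have "\<dots> = BT_inverse *\<^sub>v ((B * T_mat a b n1 n2) *\<^sub>v c)"
    unfolding BT_inverse(3)[symmetric] by (rule assoc_mult_mat_vec[OF BT_inverse(1) BT c])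
  also have "\<dots> = left_values z"
    unfolding e left_values_def using BT_inverse(1) B by (intro mult_mat_vec_uminus) simp
  finally show ?thesis .
qed

end

section \<open>Range of the operator\<close>

lemma is_weak_deriv_L2_cong_AE:
  assumes "is_weak_deriv a b f g" "ae_eq a b f f'" "ae_eq a b g g'"
    and "f \<in> L2 a b" "f' \<in> L2 a b" "g \<in> L2 a b" "g' \<in> L2 a b"
  shows "is_weak_deriv a b f' g'"
  by (rule is_weak_deriv_cong_AE[OF assms(1-3)]) (use assms in \<open>auto intro: L2_measurable\<close>)

lemma ae_eq_refl: "ae_eq a b f f"
  by (simp add: ae_eq_def)

lemma primitive_add_const:
  assumes h: "integrable (lebesgue_on {a..b}) h" and s: "s \<in> {a..b}"
  shows "primitive a (\<lambda>x. c + h x) s = (s - a) * c + primitive a h s"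
proof -
  have "integrable (lebesgue_on {a..s}) h" using s by (intro integrable_subinterval[OF h]) auto
  then show ?thesis
    unfolding primitive_def using s integrable_const_Icc
    by (subst Bochner_Integration.integral_add) (auto simp: measure_restrict_space)
qed

lemma append_vec_plus:
  fixes x x' y y' :: "real vec"
  assumes "dim_vec x = dim_vec x'" "dim_vec y = dim_vec y'"
  shows "(x @\<^sub>v y) + (x' @\<^sub>v y') = (x + x') @\<^sub>v (y + y')"
  using assms by (intro append_vec_add[of _ "dim_vec x'" _ _ "dim_vec y'"]) (auto intro: carrier_vecI)

lemma vec_plus_vec: "vec n f + vec n g = vec n (\<lambda>i. f i + g i)"
  by (rule eq_vecI) auto

context boundary_value
begin

lemma L2_coord: "z \<in> L2_vec a b n \<Longrightarrow> k < n \<Longrightarrow> coord z k \<in> L2 a b"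
  by (simp add: L2_vec_iff)

lemma continuous_states:
  assumes z: "z \<in> L2_vec a b n"
  shows "i < n1 \<Longrightarrow> continuous_on {a..b} (state1 c z i)"
    and "j < n2 \<Longrightarrow> continuous_on {a..b} (slope2 c z j)"
    and "j < n2 \<Longrightarrow> continuous_on {a..b} (state2 c z j)"
  unfolding state1_def[abs_def] slope2_def[abs_def] state2_def[abs_def]
  by (intro continuous_intros continuous_on_primitive integrable_continuous L2_integrable L2_coord[OF z]; simp)+

text \<open>The term (s - a) c is the primitive of the constant part of the slope. In this form x2
  is a constant plus one primitive, so the rule for weak derivatives of primitives applies.\<close>

lemma state2_eq:
  assumes z: "z \<in> L2_vec a b n" and j: "j < n2" and s: "s \<in> {a..b}"
  shows "state2 c z j s = c $ (n1 + j) + primitive a (slope2 c z j) s"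
proof -
  have "integrable (lebesgue_on {a..b}) (primitive a (coord z (n0 + n1 + j)))"
    using j by (intro integrable_continuous continuous_on_primitive L2_integrable L2_coord[OF z]) simp
  then show ?thesis
    unfolding state2_def slope2_def[abs_def] using primitive_add_const[OF _ s] by simp
qed

lemma weak_deriv_states:
  assumes z: "z \<in> L2_vec a b n"
  shows "i < n1 \<Longrightarrow> is_weak_deriv a b (state1 c z i) (coord z (n0 + i))"
    and "j < n2 \<Longrightarrow> is_weak_deriv a b (slope2 c z j) (coord z (n0 + n1 + j))"
    and "j < n2 \<Longrightarrow> is_weak_deriv a b (state2 c z j) (slope2 c z j)"
proof -
  show "i < n1 \<Longrightarrow> is_weak_deriv a b (state1 c z i) (coord z (n0 + i))"
    unfolding state1_def[abs_def] using L2_integrable_coord[OF z] by (intro is_weak_deriv_primitive[OF ab]) simp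
  show "j < n2 \<Longrightarrow> is_weak_deriv a b (slope2 c z j) (coord z (n0 + n1 + j))"
    unfolding slope2_def[abs_def] using L2_integrable_coord[OF z] by (intro is_weak_deriv_primitive[OF ab]) simp
  assume j: "j < n2"
  have "is_weak_deriv a b (\<lambda>s. c $ (n1 + j) + primitive a (slope2 c z j) s) (slope2 c z j)"
    by (intro is_weak_deriv_primitive[OF ab] integrable_continuous continuous_states(2)[OF z j])
  then show "is_weak_deriv a b (state2 c z j) (slope2 c z j)"
    by (rule is_weak_deriv_cong[THEN iffD1, rotated 2]) (simp_all add: state2_eq[OF z j])
qed

text \<open>The values \<open>c\<close> at \<open>a\<close> are not tied to the boundary condition here: membership in \<open>X\<close> is what
  identifies them as \<open>left_values z\<close>.\<close>

definition represents :: "real vec \<Rightarrow> (real \<Rightarrow> real vec) \<Rightarrow> (real \<Rightarrow> real vec) \<Rightarrow> bool" where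
  "represents c z x \<longleftrightarrow> z \<in> L2_vec a b n \<and> x \<in> L2_vec a b n \<and>
     (\<forall>i<n0. ae_eq a b (coord x i) (coord z i)) \<and>
     (\<forall>i<n1. ae_eq a b (coord x (n0 + i)) (state1 c z i)) \<and>
     (\<forall>j<n2. ae_eq a b (coord x (n0 + n1 + j)) (state2 c z j))"

lemma state_map_coords:
  assumes z: "z \<in> L2_vec a b n" and s: "s \<in> {a..b}"
  shows "dim_vec (state_map z s) = n"
    and "i < n0 \<Longrightarrow> state_map z s $ i = z s $ i"
    and "i < n1 \<Longrightarrow> state_map z s $ (n0 + i) = state1 (left_values z) z i s"
    and "j < n2 \<Longrightarrow> state_map z s $ (n0 + n1 + j) = state2 (left_values z) z j s"
  unfolding state_map_formula[OF z s] by (auto simp: part0_def add.assoc)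

lemma index_cases:
  assumes "k < n"
  obtains "k < n0" | i where "i < n1" "k = n0 + i" | j where "j < n2" "k = n0 + n1 + j"
  using assms by (metis add_less_cancel_left le_add_diff_inverse not_less)

lemma represents_state_map:
  assumes z: "z \<in> L2_vec a b n"
  shows "represents (left_values z) z (state_map z)"
proof -
  have "coord (state_map z) k \<in> L2 a b" if "k < n" for k
    using that
  proof (cases rule: index_cases)
    case 1
    then show ?thesis using L2_cong[of a b "coord (state_map z) k" "coord z k"] state_map_coords(2)[OF z] L2_coord[OF z that] by simp
  next
    case (2 i)
    then show ?thesis
      using L2_cong[of a b "coord (state_map z) k" "state1 (left_values z) z i"] state_map_coords(3)[OF z]
        L2_continuous[OF continuous_states(1)[OF z]] by simp
  next
    case (3 j)
    then show ?thesis
      using L2_cong[of a b "coord (state_map z) k" "state2 (left_values z) z j"] state_map_coords(4)[OF z]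
        L2_continuous[OF continuous_states(3)[OF z]] by simp
  qed
  then have "state_map z \<in> L2_vec a b n" using state_map_coords(1)[OF z] by (simp add: L2_vec_iff)
  then show ?thesis
    unfolding represents_def using z state_map_coords[OF z] by (auto intro!: ae_eq_pointwise)
qed

text \<open>The Taylor formulas have the expected weak derivatives, and uniqueness transfers this to
  whatever functions \<open>weak_deriv\<close> happens to choose for x.\<close>

lemma represents_weak_derivs:
  assumes r: "represents c z x"
  shows "i < n1 \<Longrightarrow> is_weak_deriv a b (coord x (n0 + i)) (coord z (n0 + i))"
    and "i < n1 \<Longrightarrow> weak_deriv a b (coord x (n0 + i)) \<in> L2 a b"
    and "i < n1 \<Longrightarrow> ae_eq a b (weak_deriv a b (coord x (n0 + i))) (coord z (n0 + i))"
    and "j < n2 \<Longrightarrow> is_weak_deriv a b (coord x (n0 + n1 + j)) (slope2 c z j)"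
    and "j < n2 \<Longrightarrow> weak_deriv a b (coord x (n0 + n1 + j)) \<in> L2 a b"
    and "j < n2 \<Longrightarrow> ae_eq a b (weak_deriv a b (coord x (n0 + n1 + j))) (slope2 c z j)"
    and "j < n2 \<Longrightarrow> weak_deriv a b (weak_deriv a b (coord x (n0 + n1 + j))) \<in> L2 a b"
    and "j < n2 \<Longrightarrow> ae_eq a b (weak_deriv a b (weak_deriv a b (coord x (n0 + n1 + j)))) (coord z (n0 + n1 + j))"
proof -
  have z: "z \<in> L2_vec a b n" and x: "x \<in> L2_vec a b n" using r by (auto simp: represents_def)
  show w1: "is_weak_deriv a b (coord x (n0 + i)) (coord z (n0 + i))" if i: "i < n1"
  proof (rule is_weak_deriv_L2_cong_AE[OF weak_deriv_states(1)[OF z i] _ ae_eq_refl])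
    show "ae_eq a b (state1 c z i) (coord x (n0 + i))" using r i by (auto simp: represents_def intro: ae_eq_sym)
    show "state1 c z i \<in> L2 a b" by (intro L2_continuous continuous_states z i)
    show "coord x (n0 + i) \<in> L2 a b" "coord z (n0 + i) \<in> L2 a b" "coord z (n0 + i) \<in> L2 a b"
      using i by (auto intro: L2_coord x z)
  qed
  show "i < n1 \<Longrightarrow> weak_deriv a b (coord x (n0 + i)) \<in> L2 a b" "i < n1 \<Longrightarrow> ae_eq a b (weak_deriv a b (coord x (n0 + i))) (coord z (n0 + i))"
    using weak_deriv_props[OF ab w1 L2_coord[OF z]] by simp_all
  have sl: "slope2 c z j \<in> L2 a b" "state2 c z j \<in> L2 a b" if "j < n2"
    using that by (auto intro!: L2_continuous continuous_states z)
  show w2: "is_weak_deriv a b (coord x (n0 + n1 + j)) (slope2 c z j)" if j: "j < n2"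
  proof (rule is_weak_deriv_L2_cong_AE[OF weak_deriv_states(3)[OF z j] _ ae_eq_refl sl(2)[OF j] _ sl(1)[OF j] sl(1)[OF j]])
    show "ae_eq a b (state2 c z j) (coord x (n0 + n1 + j))" using r j by (auto simp: represents_def intro: ae_eq_sym)
    show "coord x (n0 + n1 + j) \<in> L2 a b" using j by (auto intro: L2_coord x)
  qed
  show L: "j < n2 \<Longrightarrow> weak_deriv a b (coord x (n0 + n1 + j)) \<in> L2 a b"
    and ae: "j < n2 \<Longrightarrow> ae_eq a b (weak_deriv a b (coord x (n0 + n1 + j))) (slope2 c z j)"
    using weak_deriv_props[OF ab w2 sl(1)] by simp_all
  \<comment> \<open>The second weak derivative is taken of the chosen first derivative, which is
    only almost everywhere equal to \<open>slope2\<close>; the relation has to be carried over to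
    it.\<close>
  have w3: "is_weak_deriv a b (weak_deriv a b (coord x (n0 + n1 + j))) (coord z (n0 + n1 + j))" if j: "j < n2"
    by (rule is_weak_deriv_L2_cong_AE[OF weak_deriv_states(2)[OF z j] ae_eq_sym[OF ae[OF j]] ae_eq_refl sl(1)[OF j] L[OF j]])
       (use j in \<open>auto intro: L2_coord z\<close>)
  show "j < n2 \<Longrightarrow> weak_deriv a b (weak_deriv a b (coord x (n0 + n1 + j))) \<in> L2 a b"
    "j < n2 \<Longrightarrow> ae_eq a b (weak_deriv a b (weak_deriv a b (coord x (n0 + n1 + j)))) (coord z (n0 + n1 + j))"
    using weak_deriv_props[OF ab w3 L2_coord[OF z]] by simp_all
qed

lemma coord_part1: "i < n1 \<Longrightarrow> coord (part1 n0 n1 x) i = coord x (n0 + i)"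
  and coord_part2: "j < n2 \<Longrightarrow> coord (part2 n0 n1 n2 x) j = coord x (n0 + n1 + j)"
  and coord_part0: "k < n0 \<Longrightarrow> coord (part0 n0 x) k = coord x k"
  and coord_weak_deriv_vec: "k < m \<Longrightarrow> coord (weak_deriv_vec a b m f) k = weak_deriv a b (coord f k)"
  by (auto simp: part0_def part1_def part2_def weak_deriv_vec_def)

text \<open>The Taylor formulas are continuous, so they are the continuous representatives on [a,b].
  At a all primitives vanish, which leaves the entries of c; at b the polynomial parts give the
  remaining rows of T c, and the primitives give the jump.\<close>

lemma boundary_vec_represents:
  assumes r: "represents c z x" and c: "c \<in> carrier_vec (n1 + 2 * n2)"
  shows "boundary_vec a b n1 n2 (part1 n0 n1 x) (part2 n0 n1 n2 x) = T_mat a b n1 n2 *\<^sub>v c + jump z"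
proof -
  have z: "z \<in> L2_vec a b n" using r by (auto simp: represents_def)
  have s1: "cont_rep a b (coord x (n0 + i)) s = state1 c z i s" if "i < n1" "s \<in> {a..b}" for i s
    using r that by (intro cont_rep_eq[OF ab continuous_states(1)[OF z]]) (auto simp: represents_def)
  have s2: "cont_rep a b (coord x (n0 + n1 + j)) s = state2 c z j s" if "j < n2" "s \<in> {a..b}" for j s
    using r that by (intro cont_rep_eq[OF ab continuous_states(3)[OF z]]) (auto simp: represents_def)
  have s3: "cont_rep a b (weak_deriv a b (coord x (n0 + n1 + j))) s = slope2 c z j s" if "j < n2" "s \<in> {a..b}" for j s
    using that by (intro cont_rep_eq[OF ab continuous_states(2)[OF z] represents_weak_derivs(6)[OF r]])
  have ba: "a \<in> {a..b}" "b \<in> {a..b}" using ab by auto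
  have v1: "cont_rep_vec a b n1 (part1 n0 n1 x) s = vec n1 (\<lambda>i. state1 c z i s)" if "s \<in> {a..b}" for s
    using that by (auto simp: cont_rep_vec_def coord_part1 s1 intro!: eq_vecI)
  have v2: "cont_rep_vec a b n2 (part2 n0 n1 n2 x) s = vec n2 (\<lambda>j. state2 c z j s)" if "s \<in> {a..b}" for s
    using that by (auto simp: cont_rep_vec_def coord_part2 s2 intro!: eq_vecI)
  have v3: "cont_rep_vec a b n2 (weak_deriv_vec a b n2 (part2 n0 n1 n2 x)) s = vec n2 (\<lambda>j. slope2 c z j s)" if "s \<in> {a..b}" for s
    using that by (auto simp: cont_rep_vec_def coord_part2 coord_weak_deriv_vec s3 intro!: eq_vecI)
  have zero: "0\<^sub>v k = vec k (\<lambda>_. 0)" for k by (rule eq_vecI) auto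
  have smult: "k \<cdot>\<^sub>v vec m f = vec m (\<lambda>i. k * f i)" for k :: real and m f by (rule eq_vecI) auto
  have csplit: "c = vec n1 (\<lambda>i. c $ i) @\<^sub>v vec n2 (\<lambda>j. c $ (n1 + j)) @\<^sub>v vec n2 (\<lambda>j. c $ (n1 + n2 + j))"
    using c by (intro eq_vecI) auto
  have Tc: "T_mat a b n1 n2 *\<^sub>v c = vec n1 (\<lambda>i. c $ i) @\<^sub>v vec n1 (\<lambda>i. c $ i) @\<^sub>v vec n2 (\<lambda>j. c $ (n1 + j))
     @\<^sub>v (vec n2 (\<lambda>j. c $ (n1 + j) + (b - a) * c $ (n1 + n2 + j))) @\<^sub>v vec n2 (\<lambda>j. c $ (n1 + n2 + j)) @\<^sub>v vec n2 (\<lambda>j. c $ (n1 + n2 + j))"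
    by (subst csplit) (simp add: T_mult vec_plus_vec smult)
  show ?thesis
    unfolding boundary_vec_def v1[OF ba(1)] v1[OF ba(2)] v2[OF ba(1)] v2[OF ba(2)] v3[OF ba(1)] v3[OF ba(2)] Tc jump_def zero
    by (simp add: append_vec_plus vec_plus_vec state1_def state2_def slope2_def)
qed

lemma represents_in_X:
  assumes r: "represents (left_values z) z x"
  shows "x \<in> X_space a b n0 n1 n2 B"
proof -
  have z: "z \<in> L2_vec a b n" and x: "x \<in> L2_vec a b n" using r by (auto simp: represents_def)
  have lv: "left_values z \<in> carrier_vec (n1 + 2 * n2)" by (rule carrier_vecI) simp
  have p0: "part0 n0 x \<in> L2_vec a b n0" using L2_coord[OF x] by (simp add: L2_vec_iff coord_part0)
  have p1: "coord x (n0 + i) \<in> sobolev a b 1" if "i < n1" for i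
    using that represents_weak_derivs(1)[OF r that] L2_coord[OF x] L2_coord[OF z] by auto
  have p2: "coord x (n0 + n1 + j) \<in> sobolev a b 2" if "j < n2" for j
  proof -
    have xj: "coord x (n0 + n1 + j) \<in> L2 a b" and zj: "coord z (n0 + n1 + j) \<in> L2 a b"
      using that by (auto intro: L2_coord x z)
    \<comment> \<open>Order two is built in two stages: \<open>slope2\<close> is the first-order
      witness, and z in turn witnesses the weak derivative of \<open>slope2\<close>.\<close>
    have "slope2 (left_values z) z j \<in> sobolev a b (Suc 0)"
      unfolding sobolev.simps
      by (intro CollectI conjI L2_continuous continuous_states(2)[OF z that] bexI[of _ "coord z (n0 + n1 + j)"] weak_deriv_states(2)[OF z that] zj)
    then have "\<exists>g\<in>sobolev a b (Suc 0). is_weak_deriv a b (coord x (n0 + n1 + j)) g"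
      by (rule bexI[rotated]) (rule represents_weak_derivs(4)[OF r that])
    then show ?thesis
      unfolding numeral_2_eq_2 sobolev.simps(2)[of a b "Suc 0"] using xj by (intro CollectI conjI)
  qed
  show ?thesis
    unfolding X_space_def boundary_vec_represents[OF r lv, symmetric]
    using p0 p1 p2 x boundary_identity[of z] boundary_vec_represents[OF r lv]
    by (auto simp: sobolev_vec_def coord_part1 coord_part2 intro: carrier_vecI)
qed

section \<open>The inverse of the operator on X\<close>

definition profile :: "(real \<Rightarrow> real vec) \<Rightarrow> real \<Rightarrow> real vec" where
  "profile x s = part0 n0 x s @\<^sub>v weak_deriv_vec a b n1 (part1 n0 n1 x) s
     @\<^sub>v weak_deriv_vec a b n2 (weak_deriv_vec a b n2 (part2 n0 n1 n2 x)) s"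

lemma profile_coords:
  "k < n0 \<Longrightarrow> coord (profile x) k = coord x k"
  "i < n1 \<Longrightarrow> coord (profile x) (n0 + i) = weak_deriv a b (coord x (n0 + i))"
  "j < n2 \<Longrightarrow> coord (profile x) (n0 + n1 + j) = weak_deriv a b (weak_deriv a b (coord x (n0 + n1 + j)))"
  by (auto simp: profile_def part0_def part1_def part2_def weak_deriv_vec_def fun_eq_iff add.assoc)

text \<open>Integrating the weak derivatives of x back gives Taylor formulas with unknown
  integration constants c. The boundary condition on x is then a linear equation for c, whose only
  solution is \<open>left_values (profile x)\<close>.\<close>

lemma X_represents:
  assumes x: "x \<in> X_space a b n0 n1 n2 B"
  shows "represents (left_values (profile x)) (profile x) x"
proof -
  let ?z = "profile x"
  have dim: "dim_vec (x s) = n" if "s \<in> {a..b}" for s using x that by (auto simp: X_space_def)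
  have x0: "coord x k \<in> L2 a b" if "k < n0" for k
    using x that by (auto simp: X_space_def L2_vec_iff coord_part0)
  have x1: "coord x (n0 + i) \<in> sobolev a b 1" if "i < n1" for i
    using x that coord_part1[of i x] by (auto simp: X_space_def sobolev_vec_def simp del: One_nat_def)
  have x2: "coord x (n0 + n1 + j) \<in> sobolev a b 2" if "j < n2" for j
    using x that coord_part2[of j x] by (auto simp: X_space_def sobolev_vec_def)
  have "\<exists>c. \<forall>i<n1. weak_deriv a b (coord x (n0 + i)) \<in> L2 a b \<and>
     ae_eq a b (coord x (n0 + i)) (\<lambda>s. c i + primitive a (weak_deriv a b (coord x (n0 + i))) s)"
  proof (rule choice, rule allI)
    fix i
    show "\<exists>c. i < n1 \<longrightarrow> weak_deriv a b (coord x (n0 + i)) \<in> L2 a b \<and>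
     ae_eq a b (coord x (n0 + i)) (\<lambda>s. c + primitive a (weak_deriv a b (coord x (n0 + i))) s)"
    proof (cases "i < n1")
      case True
      obtain g where f: "coord x (n0 + i) \<in> L2 a b" and g: "g \<in> L2 a b" "is_weak_deriv a b (coord x (n0 + i)) g"
        using x1[OF True] by auto
      note w = weak_deriv_props[OF ab g(2,1)]
      show ?thesis
        using weak_deriv_representation[OF ab w(2) L2_integrable[OF f] L2_integrable[OF w(1)]] w(1) by blast
    qed auto
  qed
  then obtain c1 where c1: "\<And>i. i < n1 \<Longrightarrow> weak_deriv a b (coord x (n0 + i)) \<in> L2 a b"
     "\<And>i. i < n1 \<Longrightarrow> ae_eq a b (coord x (n0 + i)) (\<lambda>s. c1 i + primitive a (weak_deriv a b (coord x (n0 + i))) s)" by auto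
  \<comment> \<open>Two integrations leave two constants per coordinate: the first entry of the pair
    is the value at a, the second the slope there.\<close>
  have "\<exists>c. \<forall>j<n2. weak_deriv a b (weak_deriv a b (coord x (n0 + n1 + j))) \<in> L2 a b \<and>
     ae_eq a b (coord x (n0 + n1 + j)) (\<lambda>s. fst (c j) + (s - a) * snd (c j)
       + primitive a (primitive a (weak_deriv a b (weak_deriv a b (coord x (n0 + n1 + j))))) s)"
  proof (rule choice, rule allI)
    fix j
    let ?w = "weak_deriv a b (coord x (n0 + n1 + j))"
    let ?w' = "weak_deriv a b ?w"
    show "\<exists>c. j < n2 \<longrightarrow> ?w' \<in> L2 a b \<and>
     ae_eq a b (coord x (n0 + n1 + j)) (\<lambda>s. fst c + (s - a) * snd c + primitive a (primitive a ?w') s)"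
    proof (cases "j < n2")
      case True
      obtain g h where f: "coord x (n0 + n1 + j) \<in> L2 a b" and g: "g \<in> L2 a b" "is_weak_deriv a b (coord x (n0 + n1 + j)) g"
        and h: "h \<in> L2 a b" "is_weak_deriv a b g h"
        using x2[OF True] unfolding numeral_2_eq_2 by auto
      note w = weak_deriv_props[OF ab g(2,1)]
      have "is_weak_deriv a b ?w h"
        by (rule is_weak_deriv_L2_cong_AE[OF h(2) ae_eq_sym[OF w(3)] ae_eq_refl g(1) w(1) h(1) h(1)])
      note w' = weak_deriv_props[OF ab this h(1)]
      obtain c2 where c2: "ae_eq a b (coord x (n0 + n1 + j)) (\<lambda>s. c2 + primitive a ?w s)"
        using weak_deriv_representation[OF ab w(2) L2_integrable[OF f] L2_integrable[OF w(1)]] by blast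
      obtain c3 where c3: "ae_eq a b ?w (\<lambda>s. c3 + primitive a ?w' s)"
        using weak_deriv_representation[OF ab w'(2) L2_integrable[OF w(1)] L2_integrable[OF w'(1)]] by blast
      have P: "continuous_on {a..b} (primitive a ?w')" by (intro continuous_on_primitive L2_integrable w')
      \<comment> \<open>The representation of the first derivative holds only almost everywhere, but
        its primitive does not see null sets, so this equality holds at every point.\<close>
      have "primitive a ?w s = (s - a) * c3 + primitive a (primitive a ?w') s" if "s \<in> {a..b}" for s
        using primitive_cong_ae[OF c3 L2_integrable[OF w(1)] _ that] primitive_add_const[OF _ that, of "primitive a ?w'" c3]
          integrable_continuous[OF P] integrable_continuous[of a b "\<lambda>s. c3 + primitive a ?w' s"] P
        by (auto intro: continuous_intros)
      then have "ae_eq a b (\<lambda>s. c2 + primitive a ?w s) (\<lambda>s. c2 + (s - a) * c3 + primitive a (primitive a ?w') s)"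
        by (intro ae_eq_pointwise) simp
      from ae_eq_trans[OF c2 this] w'(1) show ?thesis by (intro exI[of _ "(c2, c3)"]) simp
    qed auto
  qed
  then obtain c2 where c2: "\<And>j. j < n2 \<Longrightarrow> weak_deriv a b (weak_deriv a b (coord x (n0 + n1 + j))) \<in> L2 a b"
     "\<And>j. j < n2 \<Longrightarrow> ae_eq a b (coord x (n0 + n1 + j)) (\<lambda>s. fst (c2 j) + (s - a) * snd (c2 j)
       + primitive a (primitive a (weak_deriv a b (weak_deriv a b (coord x (n0 + n1 + j))))) s)" by auto
  define c where "c = vec n1 c1 @\<^sub>v vec n2 (\<lambda>j. fst (c2 j)) @\<^sub>v vec n2 (\<lambda>j. snd (c2 j))"
  have c: "c \<in> carrier_vec (n1 + 2 * n2)" by (rule carrier_vecI) (simp add: c_def)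
  have cc: "i < n1 \<Longrightarrow> c $ i = c1 i" "j < n2 \<Longrightarrow> c $ (n1 + j) = fst (c2 j)" "j < n2 \<Longrightarrow> c $ (n1 + n2 + j) = snd (c2 j)" for i j
    by (auto simp: c_def)
  have z: "?z \<in> L2_vec a b n"
    unfolding L2_vec_iff
  proof (intro conjI ballI allI impI)
    fix k assume "k < n"
    then show "coord ?z k \<in> L2 a b"
      by (cases rule: index_cases) (auto simp: profile_coords x0 c1 c2)
  qed (simp add: profile_def weak_deriv_vec_def)
  have xL: "x \<in> L2_vec a b n"
    unfolding L2_vec_iff
  proof (intro conjI ballI allI impI)
    fix k assume "k < n"
    then show "coord x k \<in> L2 a b"
    proof (cases rule: index_cases)
      case 1 then show ?thesis by (rule x0)
    next
      case (2 i) then show ?thesis using x1[of i] by auto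
    next
      case (3 j) then show ?thesis using x2[of j] by (auto simp: numeral_2_eq_2)
    qed
  qed (rule dim)
  have r: "represents c ?z x"
    unfolding represents_def
  proof (intro conjI allI impI z xL)
    show "ae_eq a b (coord x i) (coord ?z i)" if "i < n0" for i
      unfolding profile_coords(1)[OF that] by (rule ae_eq_refl)
    show "ae_eq a b (coord x (n0 + i)) (state1 c ?z i)" if "i < n1" for i
      unfolding state1_def[abs_def] profile_coords(2)[OF that] cc(1)[OF that] by (rule c1(2)[OF that])
    show "ae_eq a b (coord x (n0 + n1 + j)) (state2 c ?z j)" if "j < n2" for j
      unfolding state2_def[abs_def] profile_coords(3)[OF that] cc(2,3)[OF that] by (rule c2(2)[OF that])
  qed
  have "B *\<^sub>v boundary_vec a b n1 n2 (part1 n0 n1 x) (part2 n0 n1 n2 x) = 0\<^sub>v (n1 + 2 * n2)"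
    using x by (simp add: X_space_def)
  then have "c = left_values ?z"
    unfolding boundary_vec_represents[OF r c] by (rule boundary_unique[OF c])
  with r show ?thesis by simp
qed

end

section \<open>Norm equivalence\<close>

definition sqnorm :: "real \<Rightarrow> real \<Rightarrow> (real \<Rightarrow> real) \<Rightarrow> real" where
  "sqnorm a b f = (LINT s|lebesgue_on {a..b}. (f s)\<^sup>2)"

lemma sqnorm_nonneg: "0 \<le> sqnorm a b f"
  unfolding sqnorm_def by (rule Bochner_Integration.integral_nonneg) simp

lemma sqnorm_cong_AE:
  assumes ae: "ae_eq a b f g" and f: "f \<in> L2 a b" and g: "g \<in> L2 a b"
  shows "sqnorm a b f = sqnorm a b g"
proof -
  note [measurable] = L2_measurable[OF f] L2_measurable[OF g]
  show ?thesis
    unfolding sqnorm_def using ae by (intro integral_cong_AE) (auto simp: ae_eq_def)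
qed

lemma sqnorm_le:
  assumes ab: "a < b" and f: "f \<in> L2 a b" and le: "\<And>s. s \<in> {a..b} \<Longrightarrow> (f s)\<^sup>2 \<le> M"
  shows "sqnorm a b f \<le> (b - a) * M"
proof -
  have "sqnorm a b f \<le> (LINT s|lebesgue_on {a..b}. M)"
    unfolding sqnorm_def using f le integrable_const_Icc by (intro Bochner_Integration.integral_mono) (auto simp: L2_def)
  then show ?thesis using ab by (simp add: measure_restrict_space)
qed

lemma L2_norm_sq:
  assumes f: "f \<in> L2_vec a b m"
  shows "(L2_norm a b f)\<^sup>2 = (\<Sum>k<m. sqnorm a b (coord f k))"
proof -
  have "L2_inner a b f f = (LINT s|lebesgue_on {a..b}. (\<Sum>k<m. (f s $ k)\<^sup>2))"
    unfolding L2_inner_def using f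
    by (intro Bochner_Integration.integral_cong)
       (auto simp: L2_vec_iff scalar_prod_def power2_eq_square atLeast0LessThan)
  also have "\<dots> = (\<Sum>k<m. sqnorm a b (coord f k))"
    unfolding sqnorm_def using f by (subst Bochner_Integration.integral_sum) (auto simp: L2_vec_iff L2_def)
  finally show ?thesis
    unfolding L2_norm_def by (simp add: sum_nonneg sqnorm_nonneg)
qed

lemma L2_norm_nonneg: "0 \<le> L2_norm a b f" if "f \<in> L2_vec a b m"
proof -
  have "L2_inner a b f f \<ge> 0"
    unfolding L2_inner_def scalar_prod_def by (intro Bochner_Integration.integral_nonneg sum_nonneg) simp
  then show ?thesis by (simp add: L2_norm_def)
qed

context boundary_value
begin

lemma L2_norm_sq_blocks:
  assumes z: "z \<in> L2_vec a b n"
  shows "(L2_norm a b z)\<^sup>2 = (\<Sum>i<n0. sqnorm a b (coord z i)) + (\<Sum>i<n1. sqnorm a b (coord z (n0 + i)))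
    + (\<Sum>j<n2. sqnorm a b (coord z (n0 + n1 + j)))"
proof -
  have split: "(\<Sum>k<p + q. f k) = (\<Sum>k<p. f k) + (\<Sum>k<q. f (p + k))" for p q and f :: "nat \<Rightarrow> real"
    by (induction q) auto
  show ?thesis unfolding L2_norm_sq[OF z] split by simp
qed

text \<open>\<open>sqnorm\<close> ignores null sets, so the chosen weak derivatives inside the
  Sobolev norms may be replaced by the explicit functions of c and z.\<close>

lemma X_norm_sq:
  assumes r: "represents c z x"
  shows "(X_norm a b n0 n1 n2 x)\<^sup>2 = (\<Sum>i<n0. sqnorm a b (coord z i))
    + (\<Sum>i<n1. sqnorm a b (state1 c z i) + sqnorm a b (coord z (n0 + i)))
    + (\<Sum>j<n2. sqnorm a b (state2 c z j) + sqnorm a b (slope2 c z j) + sqnorm a b (coord z (n0 + n1 + j)))"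
proof -
  have z: "z \<in> L2_vec a b n" and x: "x \<in> L2_vec a b n" using r by (auto simp: represents_def)
  note w = represents_weak_derivs[OF r]
  have p0: "part0 n0 x \<in> L2_vec a b n0"
    using L2_coord[OF x] by (simp add: L2_vec_iff coord_part0)
  have n0: "(L2_norm a b (part0 n0 x))\<^sup>2 = (\<Sum>i<n0. sqnorm a b (coord z i))"
    unfolding L2_norm_sq[OF p0] using r L2_coord[OF x] L2_coord[OF z]
    by (intro sum.cong) (auto simp: coord_part0 represents_def intro!: sqnorm_cong_AE)
  let ?d1 = "weak_deriv_vec a b n1 (part1 n0 n1 x)"
  have p1: "part1 n0 n1 x \<in> L2_vec a b n1" and d1: "?d1 \<in> L2_vec a b n1"
    using L2_coord[OF x] w(2) by (simp_all add: L2_vec_iff coord_part1 coord_weak_deriv_vec) (simp add: weak_deriv_vec_def)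
  have "(sobolev_norm a b 1 n1 (part1 n0 n1 x))\<^sup>2 = (L2_norm a b (part1 n0 n1 x))\<^sup>2 + (L2_norm a b ?d1)\<^sup>2"
    unfolding sobolev_norm_def by (subst real_sqrt_pow2) (auto intro!: sum_nonneg)
  also have "\<dots> = (\<Sum>i<n1. sqnorm a b (state1 c z i) + sqnorm a b (coord z (n0 + i)))"
    unfolding L2_norm_sq[OF p1] L2_norm_sq[OF d1] sum.distrib
    using r w L2_coord[OF x] L2_coord[OF z] L2_continuous[OF continuous_states(1)[OF z]]
    by (intro arg_cong2[of _ _ _ _ "(+)"] sum.cong)
       (auto simp: coord_part1 coord_weak_deriv_vec represents_def intro!: sqnorm_cong_AE)
  finally have n1: "(sobolev_norm a b 1 n1 (part1 n0 n1 x))\<^sup>2 = (\<Sum>i<n1. sqnorm a b (state1 c z i) + sqnorm a b (coord z (n0 + i)))" .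
  let ?d2 = "weak_deriv_vec a b n2 (part2 n0 n1 n2 x)"
  let ?e2 = "weak_deriv_vec a b n2 ?d2"
  have p2: "part2 n0 n1 n2 x \<in> L2_vec a b n2"
    using L2_coord[OF x] by (simp add: L2_vec_iff coord_part2)
  have d2: "?d2 \<in> L2_vec a b n2"
    using w(5) by (simp add: L2_vec_iff coord_part2 coord_weak_deriv_vec) (simp add: weak_deriv_vec_def)
  have e2: "?e2 \<in> L2_vec a b n2"
    using w(7) by (simp add: L2_vec_iff coord_part2 coord_weak_deriv_vec) (simp add: weak_deriv_vec_def)
  have "(sobolev_norm a b 2 n2 (part2 n0 n1 n2 x))\<^sup>2 = (L2_norm a b (part2 n0 n1 n2 x))\<^sup>2 + (L2_norm a b ?d2)\<^sup>2 + (L2_norm a b ?e2)\<^sup>2"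
    unfolding sobolev_norm_def by (subst real_sqrt_pow2) (auto intro!: sum_nonneg simp: numeral_2_eq_2)
  also have "\<dots> = (\<Sum>j<n2. sqnorm a b (state2 c z j) + sqnorm a b (slope2 c z j) + sqnorm a b (coord z (n0 + n1 + j)))"
    unfolding L2_norm_sq[OF p2] L2_norm_sq[OF d2] L2_norm_sq[OF e2] sum.distrib
    using r w L2_coord[OF x] L2_coord[OF z] L2_continuous[OF continuous_states(2)[OF z]] L2_continuous[OF continuous_states(3)[OF z]]
    by (intro arg_cong2[of _ _ _ _ "(+)"] sum.cong)
       (auto simp: coord_part2 coord_weak_deriv_vec represents_def intro!: sqnorm_cong_AE)
  finally have n2: "(sobolev_norm a b 2 n2 (part2 n0 n1 n2 x))\<^sup>2 = (\<Sum>j<n2. sqnorm a b (state2 c z j) + sqnorm a b (slope2 c z j) + sqnorm a b (coord z (n0 + n1 + j)))" .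
  show ?thesis
    unfolding X_norm_def n0[symmetric] n1[symmetric] n2[symmetric] by (rule real_sqrt_pow2) simp
qed

lemma X_norm_nonneg: "0 \<le> X_norm a b n0 n1 n2 x"
  unfolding X_norm_def by simp

text \<open>The summands of the squared norm of z all occur among those of the squared norm of x,
  and the others are nonnegative. Hence c is arbitrary here.\<close>

lemma L2_norm_le_X_norm:
  assumes r: "represents c z x"
  shows "L2_norm a b z \<le> X_norm a b n0 n1 n2 x"
proof -
  have z: "z \<in> L2_vec a b n" using r by (auto simp: represents_def)
  have "(L2_norm a b z)\<^sup>2 \<le> (X_norm a b n0 n1 n2 x)\<^sup>2"
    unfolding L2_norm_sq_blocks[OF z] X_norm_sq[OF r]
    by (intro add_mono sum_mono) (auto simp: sqnorm_nonneg)
  then show ?thesis by (rule power2_le_imp_le) (rule X_norm_nonneg)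
qed

section \<open>Pointwise bounds by the L2 norm\<close>

text \<open>One predicate covers functions of s and, with s as a dummy argument, numbers such as the
  entries of \<open>left_values z\<close>. Its closure under sums and bounded factors lets the bound
  pass through the matrix products without naming constants.\<close>

definition dominated :: "((real \<Rightarrow> real vec) \<Rightarrow> real \<Rightarrow> real) \<Rightarrow> bool" where
  "dominated \<Phi> \<longleftrightarrow> (\<exists>C. \<forall>z\<in>L2_vec a b n. \<forall>s\<in>{a..b}. (\<Phi> z s)\<^sup>2 \<le> C * (L2_norm a b z)\<^sup>2)"

lemma dominated_zero: "dominated (\<lambda>z s. 0)"
  unfolding dominated_def by (intro exI[of _ 0]) simp

lemma dominated_add:
  assumes "dominated \<Phi>" "dominated \<Psi>"
  shows "dominated (\<lambda>z s. \<Phi> z s + \<Psi> z s)"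
proof -
  obtain C D where *: "\<And>z s. z \<in> L2_vec a b n \<Longrightarrow> s \<in> {a..b} \<Longrightarrow> (\<Phi> z s)\<^sup>2 \<le> C * (L2_norm a b z)\<^sup>2"
    "\<And>z s. z \<in> L2_vec a b n \<Longrightarrow> s \<in> {a..b} \<Longrightarrow> (\<Psi> z s)\<^sup>2 \<le> D * (L2_norm a b z)\<^sup>2"
    using assms unfolding dominated_def by meson
  have "(\<Phi> z s + \<Psi> z s)\<^sup>2 \<le> (2 * C + 2 * D) * (L2_norm a b z)\<^sup>2" if "z \<in> L2_vec a b n" "s \<in> {a..b}" for z s
  proof -
    \<comment> \<open>The factors 2 come from estimating the mixed term 2xy by x^2 + y^2.\<close>
    have "(\<Phi> z s + \<Psi> z s)\<^sup>2 \<le> 2 * (\<Phi> z s)\<^sup>2 + 2 * (\<Psi> z s)\<^sup>2"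
      using sum_squares_bound[of "\<Phi> z s" "\<Psi> z s"] by (simp add: power2_sum)
    then show ?thesis using *[OF that] by (simp add: algebra_simps)
  qed
  then show ?thesis unfolding dominated_def by blast
qed

lemma dominated_mult:
  assumes \<Phi>: "dominated \<Phi>" and h: "\<And>s. s \<in> {a..b} \<Longrightarrow> \<bar>h s\<bar> \<le> M"
  shows "dominated (\<lambda>z s. h s * \<Phi> z s)"
proof -
  obtain C where *: "\<And>z s. z \<in> L2_vec a b n \<Longrightarrow> s \<in> {a..b} \<Longrightarrow> (\<Phi> z s)\<^sup>2 \<le> C * (L2_norm a b z)\<^sup>2"
    using assms unfolding dominated_def by meson
  have "(h s * \<Phi> z s)\<^sup>2 \<le> (M\<^sup>2 * C) * (L2_norm a b z)\<^sup>2" if "z \<in> L2_vec a b n" "s \<in> {a..b}" for z s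
  proof -
    have "(h s)\<^sup>2 \<le> M\<^sup>2" using h[OF that(2)] by (metis abs_ge_zero power2_abs power_mono)
    then have "(h s)\<^sup>2 * (\<Phi> z s)\<^sup>2 \<le> M\<^sup>2 * (C * (L2_norm a b z)\<^sup>2)"
      using *[OF that] by (intro mult_mono) auto
    then show ?thesis by (simp add: power_mult_distrib mult.assoc)
  qed
  then show ?thesis unfolding dominated_def by blast
qed

lemma dominated_cmult: "dominated \<Phi> \<Longrightarrow> dominated (\<lambda>z s. c * \<Phi> z s)"
  by (rule dominated_mult[of _ "\<lambda>_. c" "\<bar>c\<bar>"]) auto

lemma dominated_sum: "(\<And>l. l \<in> A \<Longrightarrow> dominated (\<Phi> l)) \<Longrightarrow> dominated (\<lambda>z s. \<Sum>l\<in>A. \<Phi> l z s)"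
  by (induction A rule: infinite_finite_induct) (auto intro: dominated_add dominated_zero)

lemma dominated_at: "dominated \<Phi> \<Longrightarrow> t \<in> {a..b} \<Longrightarrow> dominated (\<lambda>z s. \<Phi> z t)"
  unfolding dominated_def by meson

lemma dominated_primitive:
  assumes "k < n"
  shows "dominated (\<lambda>z s. primitive a (coord z k) s)"
  unfolding dominated_def
proof (intro exI ballI)
  fix z s assume z: "z \<in> L2_vec a b n" and s: "s \<in> {a..b}"
  have "sqnorm a b (coord z k) \<le> (\<Sum>k<n. sqnorm a b (coord z k))"
    using assms by (intro member_le_sum) (auto simp: sqnorm_nonneg)
  then have "(b - a) * sqnorm a b (coord z k) \<le> (b - a) * (L2_norm a b z)\<^sup>2"
    unfolding L2_norm_sq[OF z] using ab by (intro mult_left_mono) auto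
  then show "(primitive a (coord z k) s)\<^sup>2 \<le> (b - a) * (L2_norm a b z)\<^sup>2"
    using primitive_bound[OF L2_coord[OF z assms] s] by (simp add: sqnorm_def)
qed

text \<open>The inner primitive is bounded uniformly in s, which bounds its L2 norm at the cost of a
  factor b - a; Cauchy-Schwarz for the outer one costs another.\<close>

lemma dominated_double_primitive:
  assumes "k < n"
  shows "dominated (\<lambda>z s. primitive a (primitive a (coord z k)) s)"
proof -
  obtain C where *: "\<And>z s. z \<in> L2_vec a b n \<Longrightarrow> s \<in> {a..b} \<Longrightarrow> (primitive a (coord z k) s)\<^sup>2 \<le> C * (L2_norm a b z)\<^sup>2"
    using dominated_primitive[OF assms] unfolding dominated_def by meson
  show ?thesis
    unfolding dominated_def
  proof (intro exI ballI)
    fix z s assume z: "z \<in> L2_vec a b n" and s: "s \<in> {a..b}"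
    have L: "primitive a (coord z k) \<in> L2 a b"
      by (intro L2_continuous continuous_on_primitive L2_integrable L2_coord[OF z assms])
    have "(primitive a (primitive a (coord z k)) s)\<^sup>2 \<le> (b - a) * sqnorm a b (primitive a (coord z k))"
      unfolding sqnorm_def by (rule primitive_bound[OF L s])
    also have "\<dots> \<le> (b - a) * ((b - a) * (C * (L2_norm a b z)\<^sup>2))"
      using ab *[OF z] by (intro mult_left_mono sqnorm_le[OF ab L]) auto
    finally show "(primitive a (primitive a (coord z k)) s)\<^sup>2 \<le> ((b - a) * ((b - a) * C)) * (L2_norm a b z)\<^sup>2"
      by (simp add: mult.assoc)
  qed
qed

lemma dominated_mat_vec:
  assumes A: "A \<in> carrier_mat p m" and v: "\<And>z. dim_vec (v z) = m"
    and d: "\<And>l. l < m \<Longrightarrow> dominated (\<lambda>z s. v z $ l)" and k: "k < p"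
  shows "dominated (\<lambda>z s. (A *\<^sub>v v z) $ k)"
proof -
  have "(A *\<^sub>v v z) $ k = (\<Sum>l<m. A $$ (k, l) * v z $ l)" for z
    using A v k by (auto simp: scalar_prod_def atLeast0LessThan intro!: sum.cong)
  moreover have "dominated (\<lambda>z s. \<Sum>l<m. A $$ (k, l) * v z $ l)"
    using d by (intro dominated_sum dominated_cmult) auto
  ultimately show ?thesis by simp
qed

lemma dominated_append:
  assumes "\<And>z. dim_vec (v z) = p" "\<And>z. dim_vec (w z) = q"
    and "\<And>l. l < p \<Longrightarrow> dominated (\<lambda>z s. v z $ l)" "\<And>l. l < q \<Longrightarrow> dominated (\<lambda>z s. w z $ l)"
    and "l < p + q"
  shows "dominated (\<lambda>z s. (v z @\<^sub>v w z) $ l)"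
proof (cases "l < p")
  case True
  then have "(v z @\<^sub>v w z) $ l = v z $ l" for z using assms by simp
  then show ?thesis using assms(3)[OF True] by simp
next
  case False
  then have "(v z @\<^sub>v w z) $ l = w z $ (l - p)" for z using assms by simp
  then show ?thesis using assms(4)[of "l - p"] False assms(5) by simp
qed

lemma dominated_jump: "l < 2 * n1 + 4 * n2 \<Longrightarrow> dominated (\<lambda>z s. jump z $ l)"
proof -
  assume l: "l < 2 * n1 + 4 * n2"
  have b: "b \<in> {a..b}" using ab by simp
  have m: "2 * n1 + 4 * n2 = n1 + (n1 + (n2 + (n2 + (n2 + n2))))" by simp
  have z: "\<And>l. l < k \<Longrightarrow> dominated (\<lambda>z s. 0\<^sub>v k $ l)" for k using dominated_zero by simp
  have d1: "\<And>i. i < n1 \<Longrightarrow> dominated (\<lambda>z s. vec n1 (\<lambda>i. primitive a (coord z (n0 + i)) b) $ i)"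
    using dominated_at[OF dominated_primitive b] by simp
  have d2: "\<And>i. i < n2 \<Longrightarrow> dominated (\<lambda>z s. vec n2 (\<lambda>j. primitive a (coord z (n0 + n1 + j)) b) $ i)"
    using dominated_at[OF dominated_primitive b] by simp
  have d3: "\<And>i. i < n2 \<Longrightarrow> dominated (\<lambda>z s. vec n2 (\<lambda>j. primitive a (primitive a (coord z (n0 + n1 + j))) b) $ i)"
    using dominated_at[OF dominated_double_primitive b] by simp
  have e5: "\<And>l. l < n2 + n2 \<Longrightarrow> dominated (\<lambda>z s. (0\<^sub>v n2 @\<^sub>v vec n2 (\<lambda>j. primitive a (coord z (n0 + n1 + j)) b)) $ l)"
    by (rule dominated_append[OF _ _ z d2]) simp_all
  have e4: "\<And>l. l < n2 + (n2 + n2) \<Longrightarrow> dominated (\<lambda>z s. (vec n2 (\<lambda>j. primitive a (primitive a (coord z (n0 + n1 + j))) b)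
     @\<^sub>v 0\<^sub>v n2 @\<^sub>v vec n2 (\<lambda>j. primitive a (coord z (n0 + n1 + j)) b)) $ l)"
    by (rule dominated_append[OF _ _ d3 e5]) simp_all
  have e3: "\<And>l. l < n2 + (n2 + (n2 + n2)) \<Longrightarrow> dominated (\<lambda>z s. (0\<^sub>v n2 @\<^sub>v vec n2 (\<lambda>j. primitive a (primitive a (coord z (n0 + n1 + j))) b)
     @\<^sub>v 0\<^sub>v n2 @\<^sub>v vec n2 (\<lambda>j. primitive a (coord z (n0 + n1 + j)) b)) $ l)"
    by (rule dominated_append[OF _ _ z e4]) simp_all
  have e2: "\<And>l. l < n1 + (n2 + (n2 + (n2 + n2))) \<Longrightarrow> dominated (\<lambda>z s. (vec n1 (\<lambda>i. primitive a (coord z (n0 + i)) b) @\<^sub>v 0\<^sub>v n2 @\<^sub>v vec n2 (\<lambda>j. primitive a (primitive a (coord z (n0 + n1 + j))) b)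
     @\<^sub>v 0\<^sub>v n2 @\<^sub>v vec n2 (\<lambda>j. primitive a (coord z (n0 + n1 + j)) b)) $ l)"
    by (rule dominated_append[OF _ _ d1 e3]) simp_all
  show ?thesis
    unfolding jump_def by (rule dominated_append[OF _ _ z e2 l[unfolded m]]) simp_all
qed

lemma dominated_left_values: "k < n1 + 2 * n2 \<Longrightarrow> dominated (\<lambda>z s. left_values z $ k)"
proof -
  assume k: "k < n1 + 2 * n2"
  have d: "\<And>l. l < n1 + 2 * n2 \<Longrightarrow> dominated (\<lambda>z s. (B *\<^sub>v jump z) $ l)"
    by (rule dominated_mat_vec[OF B dim_jump dominated_jump])
  have "dominated (\<lambda>z s. (-1) * (BT_inverse *\<^sub>v (B *\<^sub>v jump z)) $ k)"
    using B by (intro dominated_cmult dominated_mat_vec[OF BT_inverse(1) _ d k]) auto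
  moreover have "left_values z $ k = (-1) * (BT_inverse *\<^sub>v (B *\<^sub>v jump z)) $ k" for z
    unfolding left_values_def using BT_inverse(1) k by (simp del: index_mult_mat_vec)
  ultimately show ?thesis by simp
qed

lemma dominated_states:
  "i < n1 \<Longrightarrow> dominated (\<lambda>z s. state1 (left_values z) z i s)"
  "j < n2 \<Longrightarrow> dominated (\<lambda>z s. slope2 (left_values z) z j s)"
  "j < n2 \<Longrightarrow> dominated (\<lambda>z s. state2 (left_values z) z j s)"
proof -
  show "i < n1 \<Longrightarrow> dominated (\<lambda>z s. state1 (left_values z) z i s)"
    unfolding state1_def by (intro dominated_add dominated_left_values dominated_primitive) auto
  show "j < n2 \<Longrightarrow> dominated (\<lambda>z s. slope2 (left_values z) z j s)"
    unfolding slope2_def by (intro dominated_add dominated_left_values dominated_primitive) auto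
  show "j < n2 \<Longrightarrow> dominated (\<lambda>z s. state2 (left_values z) z j s)"
    unfolding state2_def
    by (intro dominated_add dominated_left_values dominated_double_primitive dominated_mult[of _ "\<lambda>s. s - a" "b - a"]) auto
qed

lemma dominated_sqnorm:
  assumes "dominated \<Phi>" and L: "\<And>z. z \<in> L2_vec a b n \<Longrightarrow> \<Phi> z \<in> L2 a b"
  shows "\<exists>C\<ge>0. \<forall>z\<in>L2_vec a b n. sqnorm a b (\<Phi> z) \<le> C * (L2_norm a b z)\<^sup>2"
proof -
  obtain C where *: "\<And>z s. z \<in> L2_vec a b n \<Longrightarrow> s \<in> {a..b} \<Longrightarrow> (\<Phi> z s)\<^sup>2 \<le> C * (L2_norm a b z)\<^sup>2"
    using assms unfolding dominated_def by meson
  \<comment> \<open>\<open>dominated\<close> puts no sign on its constant; the absolute value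
    supplies the nonnegative one claimed here.\<close>
  have "sqnorm a b (\<Phi> z) \<le> ((b - a) * \<bar>C\<bar>) * (L2_norm a b z)\<^sup>2" if z: "z \<in> L2_vec a b n" for z
  proof -
    have "(\<Phi> z s)\<^sup>2 \<le> \<bar>C\<bar> * (L2_norm a b z)\<^sup>2" if "s \<in> {a..b}" for s
      using *[OF z that] mult_right_mono[of C "\<bar>C\<bar>" "(L2_norm a b z)\<^sup>2", OF abs_ge_self zero_le_power2]
      by linarith
    then show ?thesis using sqnorm_le[OF ab L[OF z]] by (simp add: mult.assoc)
  qed
  then show ?thesis using ab by (intro exI[of _ "(b - a) * \<bar>C\<bar>"]) auto
qed

text \<open>Integration constants are invisible in z, so this direction relies on their being
  \<open>left_values z\<close>, which depends boundedly on z. All lower-order terms of the norm are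
  then dominated.\<close>

lemma X_norm_bound: "\<exists>C. \<forall>z x. represents (left_values z) z x \<longrightarrow> X_norm a b n0 n1 n2 x \<le> C * L2_norm a b z"
proof -
  have "\<forall>i<n1. \<exists>C. C \<ge> 0 \<and> (\<forall>z\<in>L2_vec a b n. sqnorm a b (state1 (left_values z) z i) \<le> C * (L2_norm a b z)\<^sup>2)"
    by (intro allI impI dominated_sqnorm dominated_states L2_continuous continuous_states)
  then obtain C1 where C1: "\<forall>i<n1. C1 i \<ge> 0 \<and> (\<forall>z\<in>L2_vec a b n. sqnorm a b (state1 (left_values z) z i) \<le> C1 i * (L2_norm a b z)\<^sup>2)"
    unfolding choice_iff' by blast
  have "\<forall>i<n2. \<exists>C. C \<ge> 0 \<and> (\<forall>z\<in>L2_vec a b n. sqnorm a b (slope2 (left_values z) z i) \<le> C * (L2_norm a b z)\<^sup>2)"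
    by (intro allI impI dominated_sqnorm dominated_states L2_continuous continuous_states)
  then obtain C2 where C2: "\<forall>i<n2. C2 i \<ge> 0 \<and> (\<forall>z\<in>L2_vec a b n. sqnorm a b (slope2 (left_values z) z i) \<le> C2 i * (L2_norm a b z)\<^sup>2)"
    unfolding choice_iff' by blast
  have "\<forall>i<n2. \<exists>C. C \<ge> 0 \<and> (\<forall>z\<in>L2_vec a b n. sqnorm a b (state2 (left_values z) z i) \<le> C * (L2_norm a b z)\<^sup>2)"
    by (intro allI impI dominated_sqnorm dominated_states L2_continuous continuous_states)
  then obtain C3 where C3: "\<forall>i<n2. C3 i \<ge> 0 \<and> (\<forall>z\<in>L2_vec a b n. sqnorm a b (state2 (left_values z) z i) \<le> C3 i * (L2_norm a b z)\<^sup>2)"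
    unfolding choice_iff' by blast
  \<comment> \<open>The 1 accounts for x0 and the highest derivatives, which make up the norm of z
    exactly; C1 belongs to x1, C3 to x2, and C2 to the derivative of x2.\<close>
  define C where "C = 1 + (\<Sum>i<n1. C1 i) + (\<Sum>j<n2. C3 j + C2 j)"
  have C: "C \<ge> 0" unfolding C_def using C1 C2 C3 by (intro add_nonneg_nonneg sum_nonneg) auto
  have "X_norm a b n0 n1 n2 x \<le> sqrt C * L2_norm a b z" if r: "represents (left_values z) z x" for z x
  proof (rule power2_le_imp_le)
    have z: "z \<in> L2_vec a b n" using r by (auto simp: represents_def)
    let ?N = "(L2_norm a b z)\<^sup>2"
    have "(X_norm a b n0 n1 n2 x)\<^sup>2 = ?N + (\<Sum>i<n1. sqnorm a b (state1 (left_values z) z i))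
      + (\<Sum>j<n2. sqnorm a b (state2 (left_values z) z j) + sqnorm a b (slope2 (left_values z) z j))"
      unfolding X_norm_sq[OF r] L2_norm_sq_blocks[OF z] by (simp add: sum.distrib)
    also have "\<dots> \<le> ?N + (\<Sum>i<n1. C1 i * ?N) + (\<Sum>j<n2. C3 j * ?N + C2 j * ?N)"
      using C1 C2 C3 z by (intro add_mono sum_mono) auto
    also have "\<dots> = C * ?N"
      unfolding C_def by (simp add: algebra_simps sum_distrib_right sum.distrib)
    also have "\<dots> = (sqrt C * L2_norm a b z)\<^sup>2" using C by (simp add: power_mult_distrib)
    finally show "(X_norm a b n0 n1 n2 x)\<^sup>2 \<le> (sqrt C * L2_norm a b z)\<^sup>2" .
    show "0 \<le> sqrt C * L2_norm a b z" using C L2_norm_nonneg[OF z] by simp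
  qed
  then show ?thesis by blast
qed

end

section \<open>Linearity and equivalence of solutions\<close>

text \<open>The combination u - v - r w is the shape of the remainder in the Frechet derivative: two
  values of the curve and an increment times the derivative. Linearity is needed and proved in this
  form throughout.\<close>

lemma L2_vec_lincomb:
  assumes u: "u \<in> L2_vec a b m" and v: "v \<in> L2_vec a b m" and w: "w \<in> L2_vec a b m"
  shows "(\<lambda>s. u s - v s - r \<cdot>\<^sub>v w s) \<in> L2_vec a b m"
  unfolding L2_vec_iff
proof (intro conjI ballI allI impI)
  fix k assume k: "k < m"
  have "coord (\<lambda>s. u s - v s - r \<cdot>\<^sub>v w s) k \<in> L2 a b \<longleftrightarrow> (\<lambda>s. u s $ k - v s $ k - r * w s $ k) \<in> L2 a b"
    using u v w k by (intro L2_cong) (simp add: L2_vec_iff)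
  moreover have "coord u k \<in> L2 a b" "coord v k \<in> L2 a b" "coord w k \<in> L2 a b"
    using u v w k by (simp_all add: L2_vec_iff)
  then have "(\<lambda>s. u s $ k - v s $ k - r * w s $ k) \<in> L2 a b"
    by (intro L2_diff L2_cmult)
  ultimately show "coord (\<lambda>s. u s - v s - r \<cdot>\<^sub>v w s) k \<in> L2 a b" by blast
qed (use w in \<open>simp add: L2_vec_iff\<close>)

lemma ae_eq_vecI:
  assumes "\<And>s. s \<in> {a..b} \<Longrightarrow> dim_vec (f s) = m" "\<And>s. s \<in> {a..b} \<Longrightarrow> dim_vec (g s) = m"
    and c: "\<And>k. k < m \<Longrightarrow> ae_eq a b (coord f k) (coord g k)"
  shows "ae_eq a b f g"
proof -
  have "AE s in lebesgue_on {a..b}. \<forall>k\<in>{..<m}. f s $ k = g s $ k"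
    using c by (intro AE_finite_allI) (auto simp: ae_eq_def)
  moreover have "AE s in lebesgue_on {a..b}. s \<in> {a..b}" by (rule AE_I2) simp
  ultimately show ?thesis
    unfolding ae_eq_def by eventually_elim (use assms(1,2) in auto)
qed

lemma ae_eq_coord: "ae_eq a b f g \<Longrightarrow> ae_eq a b (coord f k) (coord g k)"
  by (auto simp: ae_eq_def elim!: eventually_mono)

lemma ae_eq_lincomb:
  fixes f g h f' g' h' :: "real \<Rightarrow> real"
  assumes "ae_eq a b f f'" "ae_eq a b g g'" "ae_eq a b h h'"
  shows "ae_eq a b (\<lambda>s. f s - g s - r * h s) (\<lambda>s. f' s - g' s - r * h' s)"
  using assms unfolding ae_eq_def by eventually_elim simp

lemma primitive_lincomb:
  fixes f g h :: "real \<Rightarrow> real"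
  assumes f: "integrable (lebesgue_on {a..b}) f" and g: "integrable (lebesgue_on {a..b}) g"
    and h: "integrable (lebesgue_on {a..b}) h"
    and k: "\<And>s. s \<in> {a..b} \<Longrightarrow> k s = f s - g s - r * h s" and s: "s \<in> {a..b}"
  shows "primitive a k s = primitive a f s - primitive a g s - r * primitive a h s"
proof -
  have sub: "{a..s} \<subseteq> {a..b}" using s by auto
  note i = integrable_subinterval[OF f sub] integrable_subinterval[OF g sub] integrable_subinterval[OF h sub]
  have "primitive a k s = primitive a (\<lambda>s. f s - g s - r * h s) s"
    using k s by (intro primitive_cong) auto
  also have "\<dots> = primitive a f s - primitive a g s - r * primitive a h s"
    unfolding primitive_def using i by simp
  finally show ?thesis .
qed

context boundary_value
begin

lemma
  fixes r :: real
  assumes u: "u \<in> L2_vec a b n" and v: "v \<in> L2_vec a b n" and w: "w \<in> L2_vec a b n"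
    and k: "k < n" and s: "s \<in> {a..b}"
  defines "y \<equiv> \<lambda>s. u s - v s - r \<cdot>\<^sub>v w s"
  shows primitive_coord_lincomb:
      "primitive a (coord y k) s = primitive a (coord u k) s - primitive a (coord v k) s - r * primitive a (coord w k) s"
    and double_primitive_coord_lincomb:
      "primitive a (primitive a (coord y k)) s
        = primitive a (primitive a (coord u k)) s - primitive a (primitive a (coord v k)) s - r * primitive a (primitive a (coord w k)) s"
proof -
  have y: "coord y k s = coord u k s - coord v k s - r * coord w k s" if "s \<in> {a..b}" for s
    using u v w k that by (auto simp: L2_vec_iff y_def)
  note i = L2_integrable_coord[OF u k] L2_integrable_coord[OF v k] L2_integrable_coord[OF w k]
  have p: "primitive a (coord y k) s = primitive a (coord u k) s - primitive a (coord v k) s - r * primitive a (coord w k) s"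
    if "s \<in> {a..b}" for s
    by (rule primitive_lincomb[OF i y that])
  have i': "integrable (lebesgue_on {a..b}) (primitive a f)" if "integrable (lebesgue_on {a..b}) f" for f
    by (intro integrable_continuous continuous_on_primitive that)
  show "primitive a (coord y k) s = primitive a (coord u k) s - primitive a (coord v k) s - r * primitive a (coord w k) s"
    by (rule p[OF s])
  show "primitive a (primitive a (coord y k)) s
        = primitive a (primitive a (coord u k)) s - primitive a (primitive a (coord v k)) s - r * primitive a (primitive a (coord w k)) s"
    by (rule primitive_lincomb[OF i'[OF i(1)] i'[OF i(2)] i'[OF i(3)] p s])
qed

lemma jump_lincomb:
  assumes u: "u \<in> L2_vec a b n" and v: "v \<in> L2_vec a b n" and w: "w \<in> L2_vec a b n"
  shows "jump (\<lambda>s. u s - v s - r \<cdot>\<^sub>v w s) = jump u - jump v - r \<cdot>\<^sub>v jump w"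
proof -
  have b: "b \<in> {a..b}" using ab by simp
  have 1: "vec n1 (\<lambda>i. primitive a (coord (\<lambda>s. u s - v s - r \<cdot>\<^sub>v w s) (n0 + i)) b)
     = vec n1 (\<lambda>i. primitive a (coord u (n0 + i)) b - primitive a (coord v (n0 + i)) b - r * primitive a (coord w (n0 + i)) b)"
    by (rule eq_vecI) (auto simp: primitive_coord_lincomb[OF u v w _ b])
  have 2: "vec n2 (\<lambda>j. primitive a (coord (\<lambda>s. u s - v s - r \<cdot>\<^sub>v w s) (n0 + n1 + j)) b)
     = vec n2 (\<lambda>j. primitive a (coord u (n0 + n1 + j)) b - primitive a (coord v (n0 + n1 + j)) b - r * primitive a (coord w (n0 + n1 + j)) b)"
    by (rule eq_vecI) (auto simp: primitive_coord_lincomb[OF u v w _ b])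
  have 3: "vec n2 (\<lambda>j. primitive a (primitive a (coord (\<lambda>s. u s - v s - r \<cdot>\<^sub>v w s) (n0 + n1 + j))) b)
     = vec n2 (\<lambda>j. primitive a (primitive a (coord u (n0 + n1 + j))) b - primitive a (primitive a (coord v (n0 + n1 + j))) b
         - r * primitive a (primitive a (coord w (n0 + n1 + j))) b)"
    by (rule eq_vecI) (auto simp: double_primitive_coord_lincomb[OF u v w _ b])
  show ?thesis
    unfolding jump_def 1 2 3 by (rule eq_vecI) auto
qed

lemma left_values_lincomb:
  assumes u: "u \<in> L2_vec a b n" and v: "v \<in> L2_vec a b n" and w: "w \<in> L2_vec a b n"
  shows "left_values (\<lambda>s. u s - v s - r \<cdot>\<^sub>v w s) = left_values u - left_values v - r \<cdot>\<^sub>v left_values w"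
proof -
  have lin: "A *\<^sub>v (x - y - r \<cdot>\<^sub>v z) = A *\<^sub>v x - A *\<^sub>v y - r \<cdot>\<^sub>v (A *\<^sub>v z)"
    if "dim_vec x = dim_col A" "dim_vec y = dim_col A" "dim_vec z = dim_col A" for A and x y z :: "real vec"
    using that by (intro eq_vecI)
      (auto simp: scalar_prod_def algebra_simps sum_subtractf sum.distrib sum_distrib_left)
  have "B *\<^sub>v jump (\<lambda>s. u s - v s - r \<cdot>\<^sub>v w s) = B *\<^sub>v jump u - B *\<^sub>v jump v - r \<cdot>\<^sub>v (B *\<^sub>v jump w)"
    unfolding jump_lincomb[OF u v w] using B by (intro lin) auto
  then have "BT_inverse *\<^sub>v (B *\<^sub>v jump (\<lambda>s. u s - v s - r \<cdot>\<^sub>v w s))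
      = BT_inverse *\<^sub>v (B *\<^sub>v jump u) - BT_inverse *\<^sub>v (B *\<^sub>v jump v) - r \<cdot>\<^sub>v (BT_inverse *\<^sub>v (B *\<^sub>v jump w))"
    using B BT_inverse(1) by (simp only:) (intro lin, auto)
  then show ?thesis
    unfolding left_values_def by (intro eq_vecI) (auto simp del: index_mult_mat_vec)
qed

text \<open>Primitives and \<open>left_values\<close> are linear, so the remainder of the curve in
  L2 represents the remainder of the curve in X. This puts both norm estimates at the disposal of
  difference quotients.\<close>

lemma represents_lincomb:
  fixes r :: real
  assumes x: "represents (left_values u) u x" and y: "represents (left_values v) v y" and d: "represents (left_values w) w d"
  defines "z \<equiv> \<lambda>s. u s - v s - r \<cdot>\<^sub>v w s"
  shows "represents (left_values z) z (\<lambda>s. x s - y s - r \<cdot>\<^sub>v d s)"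
proof -
  let ?D = "\<lambda>s. x s - y s - r \<cdot>\<^sub>v d s"
  have L: "u \<in> L2_vec a b n" "v \<in> L2_vec a b n" "w \<in> L2_vec a b n" "x \<in> L2_vec a b n" "y \<in> L2_vec a b n" "d \<in> L2_vec a b n"
    using x y d by (auto simp: represents_def)
  have lv: "left_values z $ k = left_values u $ k - left_values v $ k - r * left_values w $ k" if "k < n1 + 2 * n2" for k
    unfolding z_def left_values_lincomb[OF L(1-3)] using that by simp
  have cD: "ae_eq a b (coord ?D k) (\<lambda>s. coord x k s - coord y k s - r * coord d k s)" if "k < n" for k
    using L that by (intro ae_eq_pointwise) (auto simp: L2_vec_iff)
  show ?thesis
    unfolding represents_def
  proof (intro conjI allI impI)
    show "z \<in> L2_vec a b n" "?D \<in> L2_vec a b n"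
      unfolding z_def using L by (auto intro!: L2_vec_lincomb)
    show "ae_eq a b (coord ?D i) (coord z i)" if i: "i < n0" for i
    proof -
      have "ae_eq a b (\<lambda>s. coord x i s - coord y i s - r * coord d i s) (\<lambda>s. coord u i s - coord v i s - r * coord w i s)"
        using x y d i by (intro ae_eq_lincomb) (auto simp: represents_def)
      moreover have "ae_eq a b (\<lambda>s. coord u i s - coord v i s - r * coord w i s) (coord z i)"
        using L i by (intro ae_eq_pointwise) (auto simp: L2_vec_iff z_def)
      ultimately show ?thesis using cD[of i] i by (meson ae_eq_trans trans_less_add1)
    qed
    show "ae_eq a b (coord ?D (n0 + i)) (state1 (left_values z) z i)" if i: "i < n1" for i
    proof -
      have "ae_eq a b (\<lambda>s. coord x (n0 + i) s - coord y (n0 + i) s - r * coord d (n0 + i) s)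
        (\<lambda>s. state1 (left_values u) u i s - state1 (left_values v) v i s - r * state1 (left_values w) w i s)"
        using x y d i by (intro ae_eq_lincomb) (auto simp: represents_def)
      moreover have "ae_eq a b (\<lambda>s. state1 (left_values u) u i s - state1 (left_values v) v i s - r * state1 (left_values w) w i s) (state1 (left_values z) z i)"
      proof (rule ae_eq_pointwise)
        fix s assume s: "s \<in> {a..b}"
        have "primitive a (coord z (n0 + i)) s = primitive a (coord u (n0 + i)) s - primitive a (coord v (n0 + i)) s - r * primitive a (coord w (n0 + i)) s"
          unfolding z_def by (rule primitive_coord_lincomb[OF L(1-3) _ s]) (use i in simp)
        then show "state1 (left_values u) u i s - state1 (left_values v) v i s - r * state1 (left_values w) w i s = state1 (left_values z) z i s"
          unfolding state1_def using lv[of i] i by (simp add: algebra_simps)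
      qed
      ultimately show ?thesis using cD[of "n0 + i"] i by (meson ae_eq_trans add_less_cancel_left trans_less_add1)
    qed
    show "ae_eq a b (coord ?D (n0 + n1 + j)) (state2 (left_values z) z j)" if j: "j < n2" for j
    proof -
      have "ae_eq a b (\<lambda>s. coord x (n0 + n1 + j) s - coord y (n0 + n1 + j) s - r * coord d (n0 + n1 + j) s)
        (\<lambda>s. state2 (left_values u) u j s - state2 (left_values v) v j s - r * state2 (left_values w) w j s)"
        using x y d j by (intro ae_eq_lincomb) (auto simp: represents_def)
      moreover have "ae_eq a b (\<lambda>s. state2 (left_values u) u j s - state2 (left_values v) v j s - r * state2 (left_values w) w j s) (state2 (left_values z) z j)"
      proof (rule ae_eq_pointwise)
        fix s assume s: "s \<in> {a..b}"
        have dp: "primitive a (primitive a (coord z (n0 + n1 + j))) s = primitive a (primitive a (coord u (n0 + n1 + j))) s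
            - primitive a (primitive a (coord v (n0 + n1 + j))) s - r * primitive a (primitive a (coord w (n0 + n1 + j))) s"
          unfolding z_def by (rule double_primitive_coord_lincomb[OF L(1-3) _ s]) (use j in simp)
        have k: "n1 + j < n1 + 2 * n2" "n1 + n2 + j < n1 + 2 * n2" using j by auto
        show "state2 (left_values u) u j s - state2 (left_values v) v j s - r * state2 (left_values w) w j s = state2 (left_values z) z j s"
          unfolding state2_def dp lv[OF k(1)] lv[OF k(2)] by (simp add: algebra_simps)
      qed
      ultimately show ?thesis using cD[of "n0 + n1 + j"] j by (meson ae_eq_trans add_less_cancel_left)
    qed
  qed
qed

section \<open>Independence of the chosen representatives\<close>

text \<open>The coordinates of z are, up to null sets, those of x or their weak derivatives of
  highest order, whatever the constants c and c' are. This is the injectivity of the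
  operator.\<close>

lemma represents_unique:
  assumes u: "represents c u x" and v: "represents c' v x"
  shows "ae_eq a b u v"
proof (rule ae_eq_vecI)
  show "dim_vec (u s) = n" "dim_vec (v s) = n" if "s \<in> {a..b}" for s
    using u v that by (auto simp: represents_def L2_vec_iff)
  fix k assume "k < n"
  then show "ae_eq a b (coord u k) (coord v k)"
  proof (cases rule: index_cases)
    case 1
    then show ?thesis using u v unfolding represents_def by (meson ae_eq_sym ae_eq_trans)
  next
    case (2 i)
    then show ?thesis using represents_weak_derivs(3)[OF u] represents_weak_derivs(3)[OF v] by (metis ae_eq_sym ae_eq_trans)
  next
    case (3 j)
    then show ?thesis using represents_weak_derivs(8)[OF u] represents_weak_derivs(8)[OF v] by (metis ae_eq_sym ae_eq_trans)
  qed
qed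

lemma represents_cong_AE:
  assumes r: "represents c z x" and e: "ae_eq a b x y" and y: "y \<in> L2_vec a b n"
  shows "represents c z y"
proof -
  have "ae_eq a b (coord y k) (coord x k)" for k by (rule ae_eq_coord[OF ae_eq_sym[OF e]])
  then show ?thesis using r y unfolding represents_def by (meson ae_eq_trans)
qed

lemma represents_ae_eq:
  assumes x: "represents c z x" and y: "represents c z y"
  shows "ae_eq a b x y"
proof (rule ae_eq_vecI)
  show "dim_vec (x s) = n" "dim_vec (y s) = n" if "s \<in> {a..b}" for s
    using x y that by (auto simp: represents_def L2_vec_iff)
  fix k assume "k < n"
  then show "ae_eq a b (coord x k) (coord y k)"
  proof (cases rule: index_cases)
    case 1
    then show ?thesis using x y unfolding represents_def by (meson ae_eq_sym ae_eq_trans)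
  next
    case (2 i)
    then show ?thesis using x y unfolding represents_def by (meson ae_eq_sym ae_eq_trans)
  next
    case (3 j)
    then show ?thesis using x y unfolding represents_def by (meson ae_eq_sym ae_eq_trans)
  qed
qed

lemma left_values_cong_AE:
  assumes u: "u \<in> L2_vec a b n" and v: "v \<in> L2_vec a b n" and e: "ae_eq a b u v"
  shows "left_values u = left_values v"
proof -
  have b: "b \<in> {a..b}" using ab by simp
  have p: "primitive a (coord u k) s = primitive a (coord v k) s" if "k < n" "s \<in> {a..b}" for k s
    by (rule primitive_cong_ae[OF ae_eq_coord[OF e] L2_integrable_coord[OF u that(1)] L2_integrable_coord[OF v that(1)] that(2)])
  have pp: "primitive a (primitive a (coord u k)) b = primitive a (primitive a (coord v k)) b" if "k < n" for k
    by (rule primitive_cong, rule p[OF that])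
  have "jump u = jump v" unfolding jump_def using b
    by (intro arg_cong2[of _ _ _ _ "(@\<^sub>v)"] refl eq_vecI) (auto simp: p pp)
  then show ?thesis by (simp add: left_values_def)
qed

text \<open>Primitives and \<open>left_values\<close> do not see null sets, so both images are
  represented by the same pair \<open>left_values u\<close>, u.\<close>

lemma state_map_cong_AE:
  assumes u: "u \<in> L2_vec a b n" and v: "v \<in> L2_vec a b n" and e: "ae_eq a b u v"
  shows "ae_eq a b (state_map u) (state_map v)"
proof (rule represents_ae_eq)
  show "represents (left_values u) u (state_map u)" by (rule represents_state_map[OF u])
  have p: "primitive a (coord u k) s = primitive a (coord v k) s" if "k < n" "s \<in> {a..b}" for k s
    by (rule primitive_cong_ae[OF ae_eq_coord[OF e] L2_integrable_coord[OF u that(1)] L2_integrable_coord[OF v that(1)] that(2)])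
  have pp: "primitive a (primitive a (coord u k)) s = primitive a (primitive a (coord v k)) s" if "k < n" "s \<in> {a..b}" for k s
    by (rule primitive_cong, rule p[OF that(1)]) (use that(2) in simp)
  have r: "represents (left_values v) v (state_map v)" by (rule represents_state_map[OF v])
  have lv: "left_values u = left_values v" by (rule left_values_cong_AE[OF u v e])
  have s1: "ae_eq a b (state1 (left_values v) v i) (state1 (left_values u) u i)" if "i < n1" for i
    using that by (intro ae_eq_pointwise) (simp add: state1_def lv p)
  have s2: "ae_eq a b (state2 (left_values v) v i) (state2 (left_values u) u i)" if "i < n2" for i
    using that by (intro ae_eq_pointwise) (simp add: state2_def lv pp)
  show "represents (left_values u) u (state_map v)"
    unfolding represents_def
  proof (intro conjI allI impI u)
    show "state_map v \<in> L2_vec a b n" using r by (simp add: represents_def)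
    show "ae_eq a b (coord (state_map v) i) (coord u i)" if "i < n0" for i
      by (rule ae_eq_trans[OF _ ae_eq_coord[OF ae_eq_sym[OF e]]]) (use r that in \<open>simp add: represents_def\<close>)
    show "ae_eq a b (coord (state_map v) (n0 + i)) (state1 (left_values u) u i)" if "i < n1" for i
      by (rule ae_eq_trans[OF _ s1[OF that]]) (use r that in \<open>simp add: represents_def\<close>)
    show "ae_eq a b (coord (state_map v) (n0 + n1 + j)) (state2 (left_values u) u j)" if "j < n2" for j
      by (rule ae_eq_trans[OF _ s2[OF that]]) (use r that in \<open>simp add: represents_def\<close>)
  qed
qed

text \<open>\<open>generator_formula\<close> holds at every point, but the weak derivatives in the
  equation are chosen functions. The two sides agree wherever these coincide with the coordinates of
  z and with \<open>slope2\<close>.\<close>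

lemma pde_rhs_eq:
  assumes z: "z \<in> L2_vec a b n"
    and A0: "\<And>s. s \<in> {a..b} \<Longrightarrow> A0 s \<in> carrier_mat n n"
    and A1: "\<And>s. s \<in> {a..b} \<Longrightarrow> A1 s \<in> carrier_mat n (n1 + n2)"
    and A2: "\<And>s. s \<in> {a..b} \<Longrightarrow> A2 s \<in> carrier_mat n n2"
    and H0: "\<And>s. H0 s = A0 s * G0 n0 n1 n2 s + A1 s * G3 n0 n1 n2 s + (0\<^sub>m n n0 @\<^sub>c 0\<^sub>m n n1 @\<^sub>c A2 s)"
    and H1: "\<And>s \<theta>. H1 s \<theta> = A0 s * G1 a b n0 n1 n2 B s \<theta> + A1 s * G4 a b n0 n1 n2 B s \<theta>"
    and H2: "\<And>s \<theta>. H2 s \<theta> = A0 s * G2 a b n0 n1 n2 B s \<theta> + A1 s * G5 a b n0 n1 n2 B s \<theta>"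
  shows "ae_eq a b (PI_op a b n H0 H1 H2 z) (\<lambda>s. A0 s *\<^sub>v state_map z s
          + A1 s *\<^sub>v (weak_deriv_vec a b n1 (part1 n0 n1 (state_map z)) s
                      @\<^sub>v weak_deriv_vec a b n2 (part2 n0 n1 n2 (state_map z)) s)
          + A2 s *\<^sub>v (weak_deriv_vec a b n2 (weak_deriv_vec a b n2 (part2 n0 n1 n2 (state_map z)))) s)"
proof -
  let ?d1 = "weak_deriv_vec a b n1 (part1 n0 n1 (state_map z))"
  let ?d2 = "weak_deriv_vec a b n2 (part2 n0 n1 n2 (state_map z))"
  let ?e2 = "weak_deriv_vec a b n2 ?d2"
  have r: "represents (left_values z) z (state_map z)" by (rule represents_state_map[OF z])
  have d1: "ae_eq a b ?d1 (part1 n0 n1 z)"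
  proof (rule ae_eq_vecI)
    show "ae_eq a b (coord ?d1 k) (coord (part1 n0 n1 z) k)" if "k < n1" for k
      using represents_weak_derivs(3)[OF r that] that by (simp add: coord_weak_deriv_vec coord_part1)
  qed (simp_all add: weak_deriv_vec_def)
  have d2: "ae_eq a b ?d2 (\<lambda>s. vec n2 (\<lambda>j. slope2 (left_values z) z j s))"
  proof (rule ae_eq_vecI)
    show "ae_eq a b (coord ?d2 k) (coord (\<lambda>s. vec n2 (\<lambda>j. slope2 (left_values z) z j s)) k)" if "k < n2" for k
      using represents_weak_derivs(6)[OF r that] that by (simp add: coord_weak_deriv_vec coord_part2)
  qed (simp_all add: weak_deriv_vec_def)
  have e2: "ae_eq a b ?e2 (part2 n0 n1 n2 z)"
  proof (rule ae_eq_vecI)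
    show "ae_eq a b (coord ?e2 k) (coord (part2 n0 n1 n2 z) k)" if "k < n2" for k
      using represents_weak_derivs(8)[OF r that] that by (simp add: coord_weak_deriv_vec coord_part2)
  qed (simp_all add: weak_deriv_vec_def)
  have "AE s in lebesgue_on {a..b}. s \<in> {a..b}" by (rule AE_I2) simp
  then show ?thesis
    using d1 d2 e2 unfolding ae_eq_def
  proof eventually_elim
    case (elim s)
    show ?case
      unfolding elim(2-4) by (rule generator_formula[of z s A0 A1 A2 H0 H1 H2, OF z elim(1) A0[OF elim(1)] A1[OF elim(1)] A2[OF elim(1)] H0 H1 H2])
  qed
qed

text \<open>By linearity the remainders of the two curves correspond under the operator, so their
  norms bound each other up to a constant C and the two quotients tend to zero together. It suffices
  that d is represented by w: the derivative of a curve in X is an arbitrary representative of its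
  class.\<close>

lemma frechet_state_map_iff:
  assumes xh: "\<And>t. t \<ge> 0 \<Longrightarrow> xh t \<in> L2_vec a b n" and t: "t \<ge> 0"
    and d: "represents (left_values w) w d"
  shows "has_frechet_derivative (X_space a b n0 n1 n2 B) (X_norm a b n0 n1 n2) (\<lambda>t. state_map (xh t)) d t
    \<longleftrightarrow> has_frechet_derivative (L2_vec a b n) (L2_norm a b) xh w t"
proof -
  have w: "w \<in> L2_vec a b n" using d by (simp add: represents_def)
  define X where "X r = X_norm a b n0 n1 n2 (\<lambda>s. state_map (xh r) s - state_map (xh t) s - (r - t) \<cdot>\<^sub>v d s)" for r
  define L where "L r = L2_norm a b (\<lambda>s. xh r s - xh t s - (r - t) \<cdot>\<^sub>v w s)" for r
  obtain C where C: "\<And>z x. represents (left_values z) z x \<Longrightarrow> X_norm a b n0 n1 n2 x \<le> C * L2_norm a b z"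
    using X_norm_bound by blast
  have rep: "represents (left_values (\<lambda>s. xh r s - xh t s - (r - t) \<cdot>\<^sub>v w s)) (\<lambda>s. xh r s - xh t s - (r - t) \<cdot>\<^sub>v w s)
       (\<lambda>s. state_map (xh r) s - state_map (xh t) s - (r - t) \<cdot>\<^sub>v d s)" if "r \<ge> 0" for r
    by (intro represents_lincomb represents_state_map xh d t that)
  have X: "X r \<le> C * L r" "L r \<le> X r" if "r \<ge> 0" for r
    unfolding X_def L_def using C[OF rep[OF that]] L2_norm_le_X_norm[OF rep[OF that]] by auto
  have L0: "0 \<le> L r" if "r \<ge> 0" for r
    unfolding L_def by (rule L2_norm_nonneg[OF L2_vec_lincomb[OF xh[OF that] xh[OF t] w]])
  have X0: "0 \<le> X r" for r unfolding X_def by (rule X_norm_nonneg)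
  \<comment> \<open>The curve lies in L2 only for nonnegative times, so the estimates hold along the
    one-sided filter only.\<close>
  have ev: "\<forall>\<^sub>F r in at t within {0..}. r \<ge> 0" by (auto simp: eventually_at_filter)
  have "((\<lambda>r. X r / \<bar>r - t\<bar>) \<longlongrightarrow> 0) (at t within {0..}) \<longleftrightarrow> ((\<lambda>r. L r / \<bar>r - t\<bar>) \<longlongrightarrow> 0) (at t within {0..})"
  proof
    assume l: "((\<lambda>r. X r / \<bar>r - t\<bar>) \<longlongrightarrow> 0) (at t within {0..})"
    show "((\<lambda>r. L r / \<bar>r - t\<bar>) \<longlongrightarrow> 0) (at t within {0..})"
    proof (rule tendsto_sandwich[OF _ _ tendsto_const l])
      show "\<forall>\<^sub>F r in at t within {0..}. 0 \<le> L r / \<bar>r - t\<bar>"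
        using ev by eventually_elim (simp add: L0)
      show "\<forall>\<^sub>F r in at t within {0..}. L r / \<bar>r - t\<bar> \<le> X r / \<bar>r - t\<bar>"
        using ev by eventually_elim (simp add: X divide_right_mono)
    qed
  next
    assume "((\<lambda>r. L r / \<bar>r - t\<bar>) \<longlongrightarrow> 0) (at t within {0..})"
    then have l: "((\<lambda>r. C * (L r / \<bar>r - t\<bar>)) \<longlongrightarrow> 0) (at t within {0..})"
      by (rule tendsto_mult_right_zero)
    show "((\<lambda>r. X r / \<bar>r - t\<bar>) \<longlongrightarrow> 0) (at t within {0..})"
    proof (rule tendsto_sandwich[OF _ _ tendsto_const l])
      show "\<forall>\<^sub>F r in at t within {0..}. 0 \<le> X r / \<bar>r - t\<bar>"
        by (simp add: X0)
      show "\<forall>\<^sub>F r in at t within {0..}. X r / \<bar>r - t\<bar> \<le> C * (L r / \<bar>r - t\<bar>)"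
        using ev
      proof eventually_elim
        case (elim r)
        then have "X r / \<bar>r - t\<bar> \<le> (C * L r) / \<bar>r - t\<bar>" using X by (intro divide_right_mono) auto
        then show ?case by simp
      qed
    qed
  qed
  then show ?thesis
    unfolding has_frechet_derivative_def X_def L_def using represents_in_X[OF d] w by simp
qed

end

theorem lemma14:
  fixes a b :: real and n0 n1 n2 n :: nat
    and B :: "real mat" and A0 A1 A2 :: "real \<Rightarrow> real mat"
    and H0 :: "real \<Rightarrow> real mat" and H1 H2 :: "real \<Rightarrow> real \<Rightarrow> real mat"
    and \<T> \<A> :: "(real \<Rightarrow> real vec) \<Rightarrow> real \<Rightarrow> real vec"
    and xh0 :: "real \<Rightarrow> real vec" and xh :: "real \<Rightarrow> real \<Rightarrow> real vec"
  assumes "a < b"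
    and "n = n0 + n1 + n2"
    and "B \<in> carrier_mat (n1 + 2 * n2) (2 * n1 + 4 * n2)"
    and "invertible_mat (B * T_mat a b n1 n2)"
    and "\<And>s. s \<in> {a..b} \<Longrightarrow> A0 s \<in> carrier_mat n n"
    and "\<And>s. s \<in> {a..b} \<Longrightarrow> A1 s \<in> carrier_mat n (n1 + n2)"
    and "\<And>s. s \<in> {a..b} \<Longrightarrow> A2 s \<in> carrier_mat n n2"
    and "\<And>s. H0 s = A0 s * G0 n0 n1 n2 s + A1 s * G3 n0 n1 n2 s
                      + (0\<^sub>m n n0 @\<^sub>c 0\<^sub>m n n1 @\<^sub>c A2 s)"
    and "\<And>s \<theta>. H1 s \<theta> = A0 s * G1 a b n0 n1 n2 B s \<theta> + A1 s * G4 a b n0 n1 n2 B s \<theta>"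
    and "\<And>s \<theta>. H2 s \<theta> = A0 s * G2 a b n0 n1 n2 B s \<theta> + A1 s * G5 a b n0 n1 n2 B s \<theta>"
    and "\<T> = PI_op a b n (G0 n0 n1 n2) (G1 a b n0 n1 n2 B) (G2 a b n0 n1 n2 B)"
    and "\<A> = PI_op a b n H0 H1 H2"
    and "xh0 \<in> L2_vec a b n"
    and "\<And>t. t \<ge> 0 \<Longrightarrow> xh t \<in> L2_vec a b n"
  shows "PIE_solution a b n \<T> \<A> xh0 xh
           \<longleftrightarrow> PDE_solution a b n0 n1 n2 B A0 A1 A2 (\<T> xh0) (\<lambda>t. \<T> (xh t))"
proof -
  interpret boundary_value a b n0 n1 n2 B
    by unfold_locales (fact assms(1) assms(3) assms(4))+
  note n = assms(2)
  have T: "\<T> = state_map" using assms(11) n by simp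
  have xh0: "xh0 \<in> L2_vec a b (n0 + n1 + n2)" and xh: "\<And>t. t \<ge> 0 \<Longrightarrow> xh t \<in> L2_vec a b (n0 + n1 + n2)"
    using assms(13,14) n by simp_all
  define rhs where "rhs t = (\<lambda>s. A0 s *\<^sub>v state_map (xh t) s
          + A1 s *\<^sub>v (weak_deriv_vec a b n1 (part1 n0 n1 (state_map (xh t))) s
                      @\<^sub>v weak_deriv_vec a b n2 (part2 n0 n1 n2 (state_map (xh t))) s)
          + A2 s *\<^sub>v (weak_deriv_vec a b n2 (weak_deriv_vec a b n2 (part2 n0 n1 n2 (state_map (xh t))))) s)" for t
  have A: "ae_eq a b (\<A> (xh t)) (rhs t)" if "t \<ge> 0" for t
    unfolding assms(12) rhs_def n using pde_rhs_eq[OF xh[OF that] assms(5-10)[unfolded n]] .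
  have inX: "state_map z \<in> X_space a b n0 n1 n2 B" if "z \<in> L2_vec a b (n0 + n1 + n2)" for z
    by (rule represents_in_X[OF represents_state_map[OF that]])
  \<comment> \<open>The initial conditions are equivalent because the operator respects null sets in
    one direction and is injective up to null sets in the other.\<close>
  have "ae_eq a b (xh 0) xh0 \<longleftrightarrow> ae_eq a b (state_map (xh 0)) (state_map xh0)"
  proof
    show "ae_eq a b (state_map (xh 0)) (state_map xh0)" if "ae_eq a b (xh 0) xh0"
      by (rule state_map_cong_AE[OF xh xh0 that]) simp
    assume e: "ae_eq a b (state_map (xh 0)) (state_map xh0)"
    have r: "represents (left_values xh0) xh0 (state_map xh0)" by (rule represents_state_map[OF xh0])
    then have "represents (left_values (xh 0)) (xh 0) (state_map xh0)"
      by (intro represents_cong_AE[OF represents_state_map[OF xh] e]) (auto simp: represents_def)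
    then show "ae_eq a b (xh 0) xh0" by (rule represents_unique[OF _ r])
  qed
  \<comment> \<open>At each time the derivatives correspond: the image of w under the operator
    serves as d in one direction, and \<open>profile d\<close> serves as w in the other.\<close>
  moreover have "(\<exists>w. has_frechet_derivative (L2_vec a b n) (L2_norm a b) xh w t \<and> ae_eq a b (state_map w) (\<A> (xh t)))
    \<longleftrightarrow> (\<exists>d. has_frechet_derivative (X_space a b n0 n1 n2 B) (X_norm a b n0 n1 n2) (\<lambda>t. state_map (xh t)) d t \<and> ae_eq a b d (rhs t))"
    if t: "t \<ge> 0" for t
  proof
    assume "\<exists>w. has_frechet_derivative (L2_vec a b n) (L2_norm a b) xh w t \<and> ae_eq a b (state_map w) (\<A> (xh t))"
    then obtain w where w: "has_frechet_derivative (L2_vec a b n) (L2_norm a b) xh w t" "ae_eq a b (state_map w) (\<A> (xh t))"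
      by blast
    then have "w \<in> L2_vec a b (n0 + n1 + n2)" by (simp add: has_frechet_derivative_def n)
    then have "has_frechet_derivative (X_space a b n0 n1 n2 B) (X_norm a b n0 n1 n2) (\<lambda>t. state_map (xh t)) (state_map w) t"
      using w(1) frechet_state_map_iff[OF xh t represents_state_map] by (simp add: n)
    then show "\<exists>d. has_frechet_derivative (X_space a b n0 n1 n2 B) (X_norm a b n0 n1 n2) (\<lambda>t. state_map (xh t)) d t \<and> ae_eq a b d (rhs t)"
      using ae_eq_trans[OF w(2) A[OF t]] by blast
  next
    assume "\<exists>d. has_frechet_derivative (X_space a b n0 n1 n2 B) (X_norm a b n0 n1 n2) (\<lambda>t. state_map (xh t)) d t \<and> ae_eq a b d (rhs t)"
    then obtain d where d: "has_frechet_derivative (X_space a b n0 n1 n2 B) (X_norm a b n0 n1 n2) (\<lambda>t. state_map (xh t)) d t" "ae_eq a b d (rhs t)"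
      by blast
    then have r: "represents (left_values (profile d)) (profile d) d"
      by (intro X_represents) (simp add: has_frechet_derivative_def)
    then have "profile d \<in> L2_vec a b (n0 + n1 + n2)" by (simp add: represents_def)
    \<comment> \<open>Both functions are represented by \<open>profile d\<close> with the same
      constants, which makes \<open>profile d\<close> a preimage of d up to a null set.\<close>
    then have "ae_eq a b (state_map (profile d)) d" by (intro represents_ae_eq[OF represents_state_map r])
    then have "ae_eq a b (state_map (profile d)) (\<A> (xh t))"
      using d(2) ae_eq_sym[OF A[OF t]] by (blast intro: ae_eq_trans)
    moreover have "has_frechet_derivative (L2_vec a b n) (L2_norm a b) xh (profile d) t"
      using d(1) frechet_state_map_iff[OF xh t r] by (simp add: n)
    ultimately show "\<exists>w. has_frechet_derivative (L2_vec a b n) (L2_norm a b) xh w t \<and> ae_eq a b (state_map w) (\<A> (xh t))"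
      by blast
  qed
  ultimately show ?thesis
    unfolding PIE_solution_def PDE_solution_def T rhs_def
    using xh0 xh inX by (auto simp: n)
qed

end
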